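(* Let $X=\Sigma_{\mathbf{a}}\times\mathbb{T}$, where the $\mathbf{a}$-adic solenoid $\Sigma_{\mathbf{a}}$ contains no elements of order $2$. Let $G$ be the subgroup of $X$ generated by the element of order $2$. Let $\alpha=\left(\begin{matrix}a&b\\0&1\end{matrix}\right)$ be a topological automorphism of $X$, where $\mathrm{Ker}(I+a)=\{0\}$. Let $\xi_1$ and $\xi_2$ be independent random variables with values in $X$ and distributions $\mu_1$ and $\mu_2$ with nonvanishing characteristic functions. Assume that the conditional distribution of the linear form $L_2=\xi_1+\alpha\xi_2$ given $L_1=\xi_1+\xi_2$ is symmetric. If $a<0$, then there is a continuous monomorphism $\phi\colon\mathbb{R}\times\mathbb{Z}(2)\to X$ such that the distributions $\mu_j$, $j=1,2$, are represented in the form $\mu_j=\phi(M_j)*E_{x_j}$, where $x_j\in X$ and $M_j$ are distributions on the group $\mathbb{R}\times\mathbb{Z}(2)$ belonging to the class $\Theta$. If $a>0$, then some shifts of the distributions $\mu_j$ are supported in $G$.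
   Context: $\mathbb{T}$ is the circle group; $\mathbb{Z}(2)=\{0,1\}$ is the group of residue classes modulo 2. Let $\mathbf{a}=(a_0,a_1,\dots)$ be a sequence of integers all greater than 1 and $\Delta_{\mathbf{a}}$ the group of $\mathbf{a}$-adic integers. The $\mathbf{a}$-adic solenoid is $\Sigma_{\mathbf{a}}=(\mathbb{R}\times\Delta_{\mathbf{a}})/B$, where $B=\{(n,n\mathbf{u}):n\in\mathbb{Z}\}$, $\mathbf{u}=(1,0,0,\dots)$. It is a compact connected Abelian group of dimension 1, whose character group is identified with the discrete group $$H_{\mathbf{a}}=\left\{\frac{m}{a_0a_1\cdots a_n}: n=0,1,\dots;\ m\in\mathbb{Z}\right\}\subset\mathbb{R}.$$ Each topological automorphism $a$ of $\Sigma_{\mathbf{a}}$ has the form $a=f_pf_q^{-1}$ with $p,q$ relatively prime nonzero integers, where $f_n$ is multiplication by $n$ and $f_p,f_q$ are automorphisms of $\Sigma_{\mathbf{a}}$; $a$ is identified with the real number $p/q$ (this is the meaning of $a<0$, $a>0$). $I$ is the identity automorphism, and $\mathrm{Ker}(I+a)$ is the kernel in $\Sigma_{\mathbf{a}}$. Elements of $X=\Sigma_{\mathbf{a}}\times\mathbb{T}$ are $(g,z)$; the group operation of $X$ is written additively. The matrix $\left(\begin{matrix}a&b\\0&1\end{matrix}\right)$, with $a$ a topological automorphism of $\Sigma_{\mathbf{a}}$ and $b\in H_{\mathbf{a}}$, denotes the automorphism $\alpha(g,z)=(ag,(g,b)z)$ of $X$, where $(g,b)$ is the value of the character $b$ at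 $g$. Here $G=\{(0,\pm1)\}$. For a probability distribution $\mu$, $\hat\mu(y)=\int (x,y)\,d\mu(x)$ is its characteristic function (on the character group); $*$ is convolution; $E_x$ is the degenerate distribution at $x$; a shift of $\mu$ is a distribution $\mu*E_x$; $\phi(M)$ is the image of $M$ under $\phi$. The conditional distribution of $L_2$ given $L_1$ is symmetric if, equivalently, $(L_1,L_2)$ and $(L_1,-L_2)$ are identically distributed. Class $\Theta$: identify the character group of $\mathbb{R}\times\mathbb{Z}(2)$ with $\mathbb{R}\times\mathbb{Z}(2)$ via $((t,k),(s,l))=e^{its}(-1)^{kl}$. A probability distribution $M$ on $\mathbb{R}\times\mathbb{Z}(2)$ belongs to $\Theta$ if $$\hat M(s,0)=\exp\{-\sigma s^2+i\beta s\},\qquad \hat M(s,1)=\kappa\exp\{-\sigma' s^2+i\beta' s\},\qquad s\in\mathbb{R},$$ with $\sigma,\sigma'\ge0$, $\beta,\beta',\kappa\in\mathbb{R}$, where either $0<\sigma'<\sigma$ and $0<|\kappa|\le\sqrt{\sigma'/\sigma}\,\exp\left\{-\frac{(\beta-\beta')^2}{4(\sigma-\sigma')}\right\}$, or $\sigma=\sigma'$, $\beta=\beta'$ and $|\kappa|\le1$. *)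

theory Defs
  imports
    "HOL-Probability.Probability"
    "HOL-Algebra.Elementary_Groups"
    "HOL-Algebra.Multiplicative_Group"
    "HOL-Algebra.Generated_Groups"
begin

text \<open>
  A topological group is a pair of a group \<open>G\<close> and a topology \<open>T\<close> with \<open>topspace T = carrier G\<close>.
  All groups are in the (multiplicative) notation of HOL-Algebra, also the additively written ones.
\<close>

subsection \<open>Topological groups and probability distributions on them\<close>

definition quotient_topology :: "'a topology \<Rightarrow> ('a \<Rightarrow> 'b) \<Rightarrow> 'b topology" where
  "quotient_topology T q =
     topology (\<lambda>U. U \<subseteq> q ` topspace T \<and> openin T {x \<in> topspace T. q x \<in> U})"

lemma openin_quotient_topology:
  "openin (quotient_topology T q) U \<longleftrightarrow>
     U \<subseteq> q ` topspace T \<and> openin T {x \<in> topspace T. q x \<in> U}"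
proof -
  have "istopology (\<lambda>U. U \<subseteq> q ` topspace T \<and> openin T {x \<in> topspace T. q x \<in> U})"
    unfolding istopology_def
  proof (intro conjI allI impI)
    fix S U
    assume S: "S \<subseteq> q ` topspace T \<and> openin T {x \<in> topspace T. q x \<in> S}"
      and U: "U \<subseteq> q ` topspace T \<and> openin T {x \<in> topspace T. q x \<in> U}"
    show "S \<inter> U \<subseteq> q ` topspace T" using S by blast
    have "{x \<in> topspace T. q x \<in> S \<inter> U} =
        {x \<in> topspace T. q x \<in> S} \<inter> {x \<in> topspace T. q x \<in> U}" by blast
    then show "openin T {x \<in> topspace T. q x \<in> S \<inter> U}" using S U by auto
  next
    fix K
    assume K: "\<forall>U\<in>K. U \<subseteq> q ` topspace T \<and> openin T {x \<in> topspace T. q x \<in> U}"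
    show "\<Union>K \<subseteq> q ` topspace T" using K by blast
    have "{x \<in> topspace T. q x \<in> \<Union>K} = (\<Union>U\<in>K. {x \<in> topspace T. q x \<in> U})" by blast
    then show "openin T {x \<in> topspace T. q x \<in> \<Union>K}" using K by auto
  qed
  then show ?thesis
    by (simp add: quotient_topology_def topology_inverse')
qed

lemma quotient_map_quotient_topology: "quotient_map T (quotient_topology T q) q"
proof -
  have "{x \<in> topspace T. q x \<in> q ` topspace T} = topspace T" by blast
  then have "openin (quotient_topology T q) (q ` topspace T)"
    by (simp only: openin_quotient_topology openin_topspace subset_refl)
  then have "topspace (quotient_topology T q) = q ` topspace T"
    by (meson openin_quotient_topology openin_subset openin_topspace subset_antisym)
  then show ?thesis
    by (auto simp: quotient_map_def openin_quotient_topology)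
qed

definition borel_of :: "'a topology \<Rightarrow> 'a measure" where
  "borel_of T = sigma (topspace T) {U. openin T U}"

definition top_auts :: "('a, 'm) monoid_scheme \<Rightarrow> 'a topology \<Rightarrow> ('a \<Rightarrow> 'a) set" where
  "top_auts G T = {f \<in> iso G G. homeomorphic_map T T f}"

definition circle_group :: "complex monoid" where
  "circle_group = \<lparr>carrier = sphere 0 1, monoid.mult = (*), one = 1\<rparr>"

definition circle_top :: "complex topology" where
  "circle_top = top_of_set (sphere 0 1)"

definition characters :: "('a, 'm) monoid_scheme \<Rightarrow> 'a topology \<Rightarrow> ('a \<Rightarrow> complex) set" where
  "characters G T = {y \<in> hom G circle_group. continuous_map T circle_top y}"

definition char_fun :: "'a measure \<Rightarrow> ('a \<Rightarrow> complex) \<Rightarrow> complex" where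
  "char_fun \<mu> y = (\<integral>x. y x \<partial>\<mu>)"

definition group_conv ::
    "('a, 'm) monoid_scheme \<Rightarrow> 'a topology \<Rightarrow> 'a measure \<Rightarrow> 'a measure \<Rightarrow> 'a measure" where
  "group_conv G T \<mu> \<nu> = distr (\<mu> \<Otimes>\<^sub>M \<nu>) (borel_of T) (\<lambda>(x, y). x \<otimes>\<^bsub>G\<^esub> y)"

definition group_shift ::
    "('a, 'm) monoid_scheme \<Rightarrow> 'a topology \<Rightarrow> 'a measure \<Rightarrow> 'a \<Rightarrow> 'a measure" where
  "group_shift G T \<mu> x = group_conv G T \<mu> (return (borel_of T) x)"

definition supported_in :: "'a measure \<Rightarrow> 'a set \<Rightarrow> bool" where
  "supported_in \<mu> S \<longleftrightarrow> S \<in> sets \<mu> \<and> emeasure \<mu> (space \<mu> - S) = 0"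

text \<open>Symmetry of the conditional distribution of \<open>L2\<close> given \<open>L1\<close>.\<close>

definition cond_symmetric ::
    "('a, 'm) monoid_scheme \<Rightarrow> 'a topology \<Rightarrow> 'w measure \<Rightarrow> ('w \<Rightarrow> 'a) \<Rightarrow> ('w \<Rightarrow> 'a) \<Rightarrow> bool" where
  "cond_symmetric G T P L2 L1 \<longleftrightarrow>
     distr P (borel_of T \<Otimes>\<^sub>M borel_of T) (\<lambda>\<omega>. (L1 \<omega>, L2 \<omega>)) =
     distr P (borel_of T \<Otimes>\<^sub>M borel_of T) (\<lambda>\<omega>. (L1 \<omega>, inv\<^bsub>G\<^esub> (L2 \<omega>)))"


subsection \<open>The a-adic integers and the a-adic solenoid\<close>

definition real_group :: "real monoid" where
  "real_group = \<lparr>carrier = UNIV, monoid.mult = (+), one = 0\<rparr>"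

text \<open>Addition of a-adic integers is addition of digits with carry to the right;
  \<open>adic_carry a x y n\<close> is the carry into position \<open>n\<close>.\<close>

primrec adic_carry :: "(nat \<Rightarrow> nat) \<Rightarrow> (nat \<Rightarrow> nat) \<Rightarrow> (nat \<Rightarrow> nat) \<Rightarrow> nat \<Rightarrow> nat" where
  "adic_carry a x y 0 = 0"
| "adic_carry a x y (Suc n) = (x n + y n + adic_carry a x y n) div a n"

definition adic_group :: "(nat \<Rightarrow> nat) \<Rightarrow> (nat \<Rightarrow> nat) monoid" where
  "adic_group a =
     \<lparr>carrier = {x. \<forall>n. x n < a n},
      monoid.mult = (\<lambda>x y n. (x n + y n + adic_carry a x y n) mod a n),
      one = (\<lambda>n. 0)\<rparr>"

definition adic_top :: "(nat \<Rightarrow> nat) \<Rightarrow> (nat \<Rightarrow> nat) topology" where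
  "adic_top a = product_topology (\<lambda>n. discrete_topology {..<a n}) UNIV"

definition adic_unit :: "nat \<Rightarrow> nat" where
  "adic_unit = (\<lambda>n. if n = 0 then 1 else 0)"

definition solenoid_rel :: "(nat \<Rightarrow> nat) \<Rightarrow> (real \<times> (nat \<Rightarrow> nat)) set" where
  "solenoid_rel a = range (\<lambda>n::int. (of_int n, adic_unit [^]\<^bsub>adic_group a\<^esub> n))"

type_synonym solenoid_elt = "(real \<times> (nat \<Rightarrow> nat)) set"

definition solenoid :: "(nat \<Rightarrow> nat) \<Rightarrow> solenoid_elt monoid" where
  "solenoid a = (real_group \<times>\<times> adic_group a) Mod solenoid_rel a"

definition solenoid_top :: "(nat \<Rightarrow> nat) \<Rightarrow> solenoid_elt topology" where
  "solenoid_top a =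
     quotient_topology (prod_topology euclideanreal (adic_top a))
       (\<lambda>x. solenoid_rel a #>\<^bsub>real_group \<times>\<times> adic_group a\<^esub> x)"

definition H_group :: "(nat \<Rightarrow> nat) \<Rightarrow> real set" where
  "H_group a = {of_int m / real (\<Prod>i\<le>n. a i) | (m::int) (n::nat). True}"

text \<open>
  The value \<open>(g, b)\<close> of the character \<open>b = m / (a\<^sub>0 \<dots> a\<^sub>n)\<close> at the class \<open>g\<close> of \<open>(t, x)\<close> is
  \<open>exp (2\<pi>i b (t - (x\<^sub>0 + a\<^sub>0 x\<^sub>1 + \<dots> + a\<^sub>0 \<dots> a\<^sub>n\<^sub>-\<^sub>1 x\<^sub>n)))\<close>.  It depends neither on the representative
  \<open>(t, x)\<close> nor on the fraction chosen for \<open>b\<close>: replacing \<open>(t, x)\<close> by another representative changes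
  the bracket by a multiple of \<open>a\<^sub>0 \<dots> a\<^sub>n\<close>, as does adding further digits.
\<close>

definition solenoid_char :: "(nat \<Rightarrow> nat) \<Rightarrow> real \<Rightarrow> solenoid_elt \<Rightarrow> complex" where
  "solenoid_char a b g =
     (THE c. \<exists>t x (m::int) n.
        (t, x) \<in> g \<and> b = of_int m / real (\<Prod>i\<le>n. a i) \<and>
        c = cis (2 * pi * b * (t - real (\<Sum>k\<le>n. x k * (\<Prod>i<k. a i)))))"

text \<open>\<open>aut_number a A r\<close>: the topological automorphism \<open>A\<close> is identified with the real
  number \<open>r\<close>.\<close>

definition aut_number :: "(nat \<Rightarrow> nat) \<Rightarrow> (solenoid_elt \<Rightarrow> solenoid_elt) \<Rightarrow> real \<Rightarrow> bool" where
  "aut_number a A r \<longleftrightarrow>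
     (\<exists>p q::int. p \<noteq> 0 \<and> q \<noteq> 0 \<and> coprime p q \<and>
        (\<lambda>g. g [^]\<^bsub>solenoid a\<^esub> p) \<in> top_auts (solenoid a) (solenoid_top a) \<and>
        (\<lambda>g. g [^]\<^bsub>solenoid a\<^esub> q) \<in> top_auts (solenoid a) (solenoid_top a) \<and>
        (\<forall>g \<in> carrier (solenoid a).
           A g = inv_into (carrier (solenoid a)) (\<lambda>h. h [^]\<^bsub>solenoid a\<^esub> q) g [^]\<^bsub>solenoid a\<^esub> p) \<and>
        r = of_int p / of_int q)"


subsection \<open>The group \<open>X\<close>\<close>

type_synonym X_elt = "solenoid_elt \<times> complex"

definition X_group :: "(nat \<Rightarrow> nat) \<Rightarrow> X_elt monoid" where
  "X_group a = solenoid a \<times>\<times> circle_group"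

definition X_top :: "(nat \<Rightarrow> nat) \<Rightarrow> X_elt topology" where
  "X_top a = prod_topology (solenoid_top a) circle_top"

text \<open>The automorphism of \<open>X\<close> with matrix \<open>(A b; 0 1)\<close>.\<close>

definition matrix_aut ::
    "(nat \<Rightarrow> nat) \<Rightarrow> (solenoid_elt \<Rightarrow> solenoid_elt) \<Rightarrow> real \<Rightarrow> X_elt \<Rightarrow> X_elt" where
  "matrix_aut a A b = (\<lambda>(g, z). (A g, solenoid_char a b g * z))"

text \<open>If the solenoid has no elements of order 2, the generating set is the singleton
  \<open>{(0, -1)}\<close>.\<close>

definition G_subgroup :: "(nat \<Rightarrow> nat) \<Rightarrow> X_elt set" where
  "G_subgroup a = generate (X_group a) {x \<in> carrier (X_group a). group.ord (X_group a) x = 2}"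


subsection \<open>The class \<open>\<Theta>\<close> of distributions on \<open>\<real> \<times> \<int>(2)\<close>\<close>

definition RZ2_group :: "(real \<times> int) monoid" where
  "RZ2_group = real_group \<times>\<times> integer_mod_group 2"

definition RZ2_top :: "(real \<times> int) topology" where
  "RZ2_top = prod_topology euclideanreal (discrete_topology (carrier (integer_mod_group 2)))"

definition RZ2_char :: "real \<Rightarrow> int \<Rightarrow> real \<times> int \<Rightarrow> complex" where
  "RZ2_char s l = (\<lambda>(t, k). exp (\<i> * of_real t * of_real s) * (-1) ^ nat (k * l))"

definition Theta_class :: "(real \<times> int) measure set" where
  "Theta_class = {M. prob_space M \<and> sets M = sets (borel_of RZ2_top) \<and>
     (\<exists>\<sigma> \<sigma>' \<beta> \<beta>' \<kappa> :: real. \<sigma> \<ge> 0 \<and> \<sigma>' \<ge> 0 \<and>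
        (\<forall>s::real. char_fun M (RZ2_char s 0) =
            exp (of_real (- \<sigma> * s\<^sup>2) + \<i> * of_real (\<beta> * s))) \<and>
        (\<forall>s::real. char_fun M (RZ2_char s 1) =
            of_real \<kappa> * exp (of_real (- \<sigma>' * s\<^sup>2) + \<i> * of_real (\<beta>' * s))) \<and>
        ((0 < \<sigma>' \<and> \<sigma>' < \<sigma> \<and> 0 < \<bar>\<kappa>\<bar> \<and>
            \<bar>\<kappa>\<bar> \<le> sqrt (\<sigma>' / \<sigma>) * exp (- ((\<beta> - \<beta>')\<^sup>2 / (4 * (\<sigma> - \<sigma>'))))) \<or>
         (\<sigma> = \<sigma>' \<and> \<beta> = \<beta>' \<and> \<bar>\<kappa>\<bar> \<le> 1)))}"

end

(* Write h, h' for the characteristic functions of the two distributions on the dual group Y = H x Z.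
   The symmetry of the conditional distribution is the functional equation
   h(u + v) h'(u + ev) = h(u - v) h'(u - ev), where e(s, n) = (rs + bn, n) and a = r as a number.

   Third differences along H show that -log|h|, -log|h'| are s1 s^2, s2 s^2 on H with s1 = -r s2 (both vanish if r = 1), and
   u = v bounds -log|h(2v)| by a multiple of w(v)^2, where w(s, n) = s + bn/(r - 1) is the eigenform of e.
   If r > 0 this forces |h| = 1 on H x 2Z, so a shift of the distribution lives on the annihilator of
   H x 2Z, which is G.  If r < 0, then |h(u)| -> 1 as w(u) -> 0 on H x 2Z; hence for the symmetrized
   distribution the characters u_k with w(u_k) -> 0 fast converge to 1 almost surely, which puts the
   symmetrized distribution on the image of R x Z(2), and by Fubini it puts a shift of the distribution
   itself there.  The functional equation now has continuous solutions on R x Z(2), whose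
   logarithms are quadratic polynomials; testing against Gaussian kernels gives the inequality
   between the parameters. *)

theory Submission
  imports Defs "HOL-Number_Theory.Residues"
begin

text \<open>The group H is discrete as a dual group, so the characteristic functions need not be
  continuous on it for the topology of the line, and H need not be divisible by r - 1. Third
  differences therefore give the quadratic forms exactly only on (r - 1)H. Elsewhere density and
  positivity give them as lower bounds, and one instance of the equation shows that these bounds are
  attained. The absence of elements of order 2 and the triviality of Ker(I + a) reach the equation
  as divisibility of H by 2 and by 1 + r. The estimates concern H x 2Z because only there an element
  of Y can be halved. A Gaussian lower bound survives the passage to the closure, so the even parts
  of the extensions to the line have no zeros. On the odd part nonvanishing is known only on a dense
  set, which a continuous extension may leave, and the equation itself has to exclude zeros. The
  factor Z(2) appears because the characters with second coordinate 2 determine only the square of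
  the circle coordinate.\<close>

section \<open>The functional equation on the real line\<close>

text \<open>Three substitutions move u + v and fix one of the other arguments: (u + rk, v + k) fixes
  u - rv, (u + l, v + l) fixes u - v, and (u + rm, v - m) fixes u + rv. So each difference removes
  one of the other terms, and the vertices are reached from u = x, v = 0. The additive
  \<open>\<tau>\<close> cancels as well; it leaves room for the characters that come from shifts of
  the distributions.\<close>

lemma third_difference_eq_0:
  fixes f g \<tau> :: "real \<Rightarrow> 'b::ab_group_add" and H :: "real set"
  assumes add: "\<And>x y. x \<in> H \<Longrightarrow> y \<in> H \<Longrightarrow> x + y \<in> H"
    and uminus: "\<And>x. x \<in> H \<Longrightarrow> - x \<in> H"
    and mult_r: "\<And>x. x \<in> H \<Longrightarrow> r * x \<in> H"
    and eq: "\<And>u v. u \<in> H \<Longrightarrow> v \<in> H \<Longrightarrow> f (u + v) + g (u + r * v) = f (u - v) + g (u - r * v) + \<tau> v"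
    and \<tau>: "\<And>u v. u \<in> H \<Longrightarrow> v \<in> H \<Longrightarrow> \<tau> (u + v) = \<tau> u + \<tau> v"
    and H: "x \<in> H" "k \<in> H" "l \<in> H" "m \<in> H"
  defines "d \<equiv> (r - 1) * m" and "e \<equiv> 2 * l" and "h \<equiv> (1 + r) * k"
  shows "f (x + d + e + h) - f (x + d + e) - f (x + d + h) - f (x + e + h)
           + f (x + d) + f (x + e) + f (x + h) - f x = 0"
proof -
  define z where "z = (0::real)"
  have zH: "z \<in> H" unfolding z_def using add[OF H(1) uminus[OF H(1)]] by simp
  note cl = add uminus mult_r H zH
  have \<tau>0: "\<tau> z = 0" using \<tau>[OF zH zH] by (simp add: z_def)
  have \<tau>m: "\<tau> (-m) = - \<tau> m"
    using \<tau>[OF uminus[OF H(4)] H(4)] \<tau>0 by (simp add: z_def eq_neg_iff_add_eq_0)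
  have E: "f p = f p' + g q' + t - g q"
    if "u \<in> H" "v \<in> H" "u + v = p" "u + r * v = q" "u - v = p'" "u - r * v = q'" "\<tau> v = t"
    for u v p q p' q' t
    using eq[OF that(1,2)] that(3-7) by (simp add: algebra_simps)
  define n where "n = -m"
  have mH: "n \<in> H" and \<tau>n: "\<tau> n = - \<tau> m" using cl \<tau>m by (auto simp: n_def)
  have \<tau>2: "\<tau> (k + l) = \<tau> k + \<tau> l" "\<tau> (k + n) = \<tau> k - \<tau> m"
    "\<tau> (l + n) = \<tau> l - \<tau> m" "\<tau> (k + l + n) = \<tau> k + \<tau> l - \<tau> m"
    using \<tau> \<tau>n mH cl by auto
  \<comment> \<open>Each of these points occurs in the equations of two vertices and cancels in the
    alternating sum.\<close>
  define A B C D' where "A = x + (r-1)*k + (1+r)*m" and "B = x + (1-r)*l + 2*r*m"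
    and "C = x + 2*r*k + (1+r)*l" and "D' = x + (1+r)*m"
  define A1 B1 C1 D1 where "A1 = x + (1+r)*l" and "B1 = x + 2*r*m"
    and "C1 = x + 2*r*k" and "D1 = x + (1-r)*l"
  define F1 where "F1 = x + (r-1)*k"
  note df = A_def B_def C_def D'_def A1_def B1_def C1_def D1_def F1_def d_def e_def h_def
  have e1: "f (x + d + e + h) = f A + g B + (\<tau> k + \<tau> l - \<tau> m) - g C"
    by (rule E[of "x + r*k + l + r*m" "k + l + n"]; use \<tau>2 \<tau>n mH cl in \<open>(simp; fail) | (simp add: df n_def algebra_simps; fail)\<close>)
  have e2: "f (x + d + e) = f D' + g B + (\<tau> l - \<tau> m) - g A1"
    by (rule E[of "x + l + r*m" "l + n"]; use \<tau>2 \<tau>n mH cl in \<open>(simp; fail) | (simp add: df n_def algebra_simps; fail)\<close>)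
  have e3: "f (x + d + h) = f A + g B1 + (\<tau> k - \<tau> m) - g C1"
    by (rule E[of "x + r*k + r*m" "k + n"]; use \<tau>2 \<tau>n mH cl in \<open>(simp; fail) | (simp add: df n_def algebra_simps; fail)\<close>)
  have e4: "f (x + e + h) = f F1 + g D1 + (\<tau> k + \<tau> l) - g C"
    by (rule E[of "x + r*k + l" "k + l"]; use \<tau>2 \<tau>n mH cl in \<open>(simp; fail) | (simp add: df n_def algebra_simps; fail)\<close>)
  have e5: "f (x + d) = f D' + g B1 + (- \<tau> m) - g x"
    by (rule E[of "x + r*m" "n"]; use \<tau>2 \<tau>n mH cl in \<open>(simp; fail) | (simp add: df n_def algebra_simps; fail)\<close>)
  have e6: "f (x + e) = f x + g D1 + \<tau> l - g A1"
    by (rule E[of "x + l" "l"]; use \<tau>2 \<tau>n mH cl in \<open>(simp; fail) | (simp add: df n_def algebra_simps; fail)\<close>)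
  have e7: "f (x + h) = f F1 + g x + \<tau> k - g C1"
    by (rule E[of "x + r*k" "k"]; use \<tau>2 \<tau>n mH cl in \<open>(simp; fail) | (simp add: df n_def algebra_simps; fail)\<close>)
  show ?thesis
    unfolding e1 e2 e3 e4 e5 e6 e7 by (simp add: algebra_simps)
qed

section \<open>The equation on a dense group of rationals, without continuity\<close>

locale heyde_group =
  fixes H :: "real set" and r :: real
  assumes one: "1 \<in> H"
    and add: "\<And>x y. x \<in> H \<Longrightarrow> y \<in> H \<Longrightarrow> x + y \<in> H"
    and uminus: "\<And>x. x \<in> H \<Longrightarrow> - x \<in> H"
    and half: "\<And>x. x \<in> H \<Longrightarrow> x / 2 \<in> H"
    and mult_r: "\<And>x. x \<in> H \<Longrightarrow> r * x \<in> H"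
    and div_r: "\<And>x. x \<in> H \<Longrightarrow> x / r \<in> H"
    and div_1r: "\<And>x. x \<in> H \<Longrightarrow> x / (1 + r) \<in> H"
    and rat: "H \<subseteq> \<rat>"
    and r0: "r \<noteq> 0" and r1: "1 + r \<noteq> 0"
begin

lemma zero: "0 \<in> H"
  using add[OF one uminus[OF one]] by simp

lemma diff: "x \<in> H \<Longrightarrow> y \<in> H \<Longrightarrow> x - y \<in> H"
  using add[of x "- y"] uminus by simp

lemma of_nat_mult: "x \<in> H \<Longrightarrow> of_nat n * x \<in> H"
  by (induction n) (auto simp: zero algebra_simps intro: add)

lemma of_int_mult: "x \<in> H \<Longrightarrow> of_int n * x \<in> H"
  by (cases n rule: int_cases2) (auto simp: of_nat_mult dest: uminus of_nat_mult)

lemma div_power2: "x \<in> H \<Longrightarrow> x / 2 ^ n \<in> H"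
  using half by (induction n arbitrary: x) (auto simp flip: divide_divide_eq_left)

text \<open>Replacing v by v / r exchanges the two functions in the equation, with 1 / r in place of
  r. What is proved for the first function thus holds for the second.\<close>

lemma inverse: "heyde_group H (1 / r)"
proof
  show "x / (1 + 1 / r) \<in> H" if "x \<in> H" for x
  proof -
    have "x / (1 + 1 / r) = r * (x / (1 + r))" using r0 r1 by (simp add: field_simps)
    then show ?thesis using mult_r div_1r that by simp
  qed
qed (use one add uminus half mult_r div_r rat r0 r1 in \<open>auto simp: field_simps\<close>)

text \<open>The integer multiples of d / 2 ^ n are already dense as n grows.\<close>

lemma dense_multiples:
  assumes "d \<in> H" "d \<noteq> 0" "\<epsilon> > 0"
  obtains h where "h \<in> H" "\<bar>h * d - t\<bar> < \<epsilon>"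
proof -
  obtain n where n: "(1/2::real) ^ n < \<epsilon> / \<bar>d\<bar>"
    using real_arch_pow_inv[of "\<epsilon> / \<bar>d\<bar>" "1/2"] assms by auto
  define k where "k = \<lfloor>t / d * 2 ^ n\<rfloor>"
  have "\<bar>of_int k - t / d * 2 ^ n\<bar> < 1" unfolding k_def by linarith
  then have "\<bar>of_int k - t / d * 2 ^ n\<bar> * (\<bar>d\<bar> / 2 ^ n) < 1 * (\<bar>d\<bar> / 2 ^ n)"
    using assms by (intro mult_strict_right_mono) auto
  also have "\<bar>of_int k - t / d * 2 ^ n\<bar> * (\<bar>d\<bar> / 2 ^ n) = \<bar>(of_int k - t / d * 2 ^ n) * (d / 2 ^ n)\<bar>"
    by (simp add: abs_mult)
  also have "(of_int k - t / d * 2 ^ n) * (d / 2 ^ n) = of_int k / 2 ^ n * d - t"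
    using assms by (simp add: field_simps)
  also have "1 * (\<bar>d\<bar> / 2 ^ n) < \<epsilon>" using n assms by (simp add: field_simps)
  finally show ?thesis
    using that[of "of_int k * (1 / 2 ^ n)"] of_int_mult[OF div_power2[OF one], of k n] by simp
qed

text \<open>Rationality of H replaces continuity here: clearing the denominator of h is
  enough.\<close>

lemma additive_linear:
  fixes B :: "real \<Rightarrow> real"
  assumes B: "\<And>x y. x \<in> H \<Longrightarrow> y \<in> H \<Longrightarrow> B (x + y) = B x + B y" and h: "h \<in> H"
  shows "B h = h * B 1"
proof -
  have nat: "B (of_nat n * x) = of_nat n * B x" if "x \<in> H" for n x
    using B[OF zero zero] by (induction n) (auto simp: distrib_right B that of_nat_mult)
  have neg: "B (- x) = - B x" if "x \<in> H" for x
    using B[OF that uminus[OF that]] B[OF zero zero] by simp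
  have int: "B (of_int k * x) = of_int k * B x" if "x \<in> H" for k x
    by (cases k rule: int_cases2) (auto simp: nat neg that of_nat_mult)
  from h rat have "h \<in> \<rat>" by blast
  then obtain m n :: int where mn: "n > 0" "h = of_int m / of_int n"
    by (auto elim!: Rats_cases')
  then have "of_int n * h = of_int m * 1" by simp
  then have "of_int n * B h = of_int m * B 1"
    using int[OF h, of n] int[OF one, of m] by metis
  then have "B h = of_int m / of_int n * B 1" using mn(1) by (simp add: field_simps)
  then show ?thesis using mn(2) by simp
qed

text \<open>The form is exact on (r - 1)H only. Outside, the difference of \<open>\<phi>\<close> and
  the form is invariant under translations by (r - 1)H. A translation brings any point close to 0,
  where the form is small and \<open>\<phi>\<close> is nonnegative, so the difference is
  nonnegative. This takes the place of continuity of \<open>\<phi>\<close>.\<close>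

lemma quadratic_minorant:
  fixes \<phi> \<psi> :: "real \<Rightarrow> real"
  assumes r: "r \<noteq> 1"
    and eq: "\<And>u v. u \<in> H \<Longrightarrow> v \<in> H \<Longrightarrow> \<phi> (u + v) + \<psi> (u + r * v) = \<phi> (u - v) + \<psi> (u - r * v)"
    and \<phi>0: "\<phi> 0 = 0" and even: "\<And>u. u \<in> H \<Longrightarrow> \<phi> (- u) = \<phi> u"
    and nonneg: "\<And>u. u \<in> H \<Longrightarrow> 0 \<le> \<phi> u"
  obtains \<sigma> where "\<sigma> \<ge> 0" "\<And>h. h \<in> H \<Longrightarrow> \<sigma> * h\<^sup>2 \<le> \<phi> h"
    "\<And>m. m \<in> H \<Longrightarrow> \<phi> ((r - 1) * m) = \<sigma> * ((r - 1) * m)\<^sup>2"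
proof -
  define B where "B m h = \<phi> (h + (r - 1) * m) - \<phi> h - \<phi> ((r - 1) * m)" for m h
  have dH: "(r - 1) * m \<in> H" if "m \<in> H" for m
    using diff[OF mult_r[OF that] that] by (simp add: algebra_simps)
  have Badd: "B m (k + l) = B m k + B m l" if "m \<in> H" "k \<in> H" "l \<in> H" for m k l
  proof -
    \<comment> \<open>The steps l / 2 and k / (1 + r) make two of the edges arbitrary elements of H;
      from the base point 0 the vanishing third difference is additivity of
      \<open>B m\<close>.\<close>
    have "\<phi> (0 + (r - 1) * m + 2 * (l / 2) + (1 + r) * (k / (1 + r)))
      - \<phi> (0 + (r - 1) * m + 2 * (l / 2)) - \<phi> (0 + (r - 1) * m + (1 + r) * (k / (1 + r)))
      - \<phi> (0 + 2 * (l / 2) + (1 + r) * (k / (1 + r))) + \<phi> (0 + (r - 1) * m)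
      + \<phi> (0 + 2 * (l / 2)) + \<phi> (0 + (1 + r) * (k / (1 + r))) - \<phi> 0 = 0"
      by (rule third_difference_eq_0[where \<tau> = "\<lambda>_. 0" and g = \<psi> and H = H])
        (use add uminus mult_r eq zero half div_1r that in auto)
    then show ?thesis using r1 by (simp add: B_def \<phi>0 add_ac)
  qed
  have Blin: "B m h = h * B m 1" if "m \<in> H" "h \<in> H" for m h
    by (rule additive_linear) (use Badd that in auto)
  define \<sigma> where "\<sigma> = B 1 1 / (r - 1) / 2"
  have B1: "B m 1 = 2 * \<sigma> * ((r - 1) * m)" if "m \<in> H" for m
  proof -
    \<comment> \<open>The second difference is symmetric in its two increments, which makes the
      slope of \<open>B m\<close> proportional to m.\<close>
    have "B m ((r - 1) * 1) = B 1 ((r - 1) * m)" by (simp add: B_def add_ac)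
    then have "(r - 1) * B m 1 = (r - 1) * (m * B 1 1)"
      using Blin[OF that dH[OF one]] Blin[OF one dH[OF that]] by auto
    then have "B m 1 = m * B 1 1" using r by auto
    moreover have "y = 2 * (y / x / 2) * x" if "x \<noteq> 0" for x y :: real
      using that by simp
    from this[of "r - 1" "B 1 1"] have "B 1 1 = 2 * \<sigma> * (r - 1)" using r by (simp only: \<sigma>_def)
    ultimately show ?thesis by simp
  qed
  have D: "\<phi> ((r - 1) * m) = \<sigma> * ((r - 1) * m)\<^sup>2" if "m \<in> H" for m
  proof -
    define x where "x = (r - 1) * m"
    have "B m (- x) = - 2 * \<phi> x"
      using even[OF dH[OF that]] by (simp add: B_def \<phi>0 x_def)
    moreover have "B m (- x) = - x * (2 * \<sigma> * x)"
      using Blin[OF that uminus[OF dH[OF that]]] B1[OF that] by (simp add: x_def)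
    ultimately show ?thesis unfolding x_def[symmetric] by (simp add: power2_eq_square mult_ac)
  qed
  have \<sigma>: "\<sigma> \<ge> 0"
  proof -
    have "0 \<le> \<sigma> * (r - 1)\<^sup>2" using D[OF one] nonneg[OF dH[OF one]] by simp
    then show ?thesis using r by (simp add: zero_le_mult_iff)
  qed
  have shift: "\<phi> h - \<sigma> * h\<^sup>2 = \<phi> (h + (r - 1) * m) - \<sigma> * (h + (r - 1) * m)\<^sup>2"
    if "m \<in> H" "h \<in> H" for m h
  proof -
    define x where "x = (r - 1) * m"
    have "\<phi> (h + x) - \<phi> h - \<phi> x = h * (2 * \<sigma> * x)"
      using Blin[OF that] unfolding B1[OF that(1)] unfolding B_def x_def .
    moreover have "\<phi> x = \<sigma> * x\<^sup>2" unfolding x_def by (rule D[OF that(1)])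
    ultimately show ?thesis unfolding x_def[symmetric] by (simp add: power2_eq_square algebra_simps)
  qed
  have "\<sigma> * h\<^sup>2 \<le> \<phi> h" if h: "h \<in> H" for h
  proof (rule field_le_epsilon)
    fix e :: real assume "e > 0"
    \<comment> \<open>Chosen so that \<open>\<sigma> * \<epsilon>\<^sup>2\<close> is at most e; the
      summand 1 covers the case of a vanishing form.\<close>
    define \<epsilon> where "\<epsilon> = sqrt (e / (\<sigma> + 1))"
    have \<epsilon>: "\<epsilon> > 0" "\<epsilon>\<^sup>2 = e / (\<sigma> + 1)" using \<open>e > 0\<close> \<sigma> by (auto simp: \<epsilon>_def)
    obtain m where m: "m \<in> H" "\<bar>m * (r - 1) - (- h)\<bar> < \<epsilon>"
      using dense_multiples[of "r - 1" \<epsilon> "- h"] dH[OF one] r \<epsilon> by auto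
    then have "\<bar>h + (r - 1) * m\<bar> \<le> \<bar>\<epsilon>\<bar>" by (simp add: algebra_simps)
    then have "(h + (r - 1) * m)\<^sup>2 \<le> \<epsilon>\<^sup>2" by (simp only: abs_le_square_iff)
    then have "\<sigma> * (h + (r - 1) * m)\<^sup>2 \<le> \<sigma> * (e / (\<sigma> + 1))"
      using \<sigma> \<epsilon> by (intro mult_left_mono) auto
    also have "\<dots> \<le> e" using \<sigma> \<open>e > 0\<close> by (simp add: field_simps)
    finally show "\<sigma> * h\<^sup>2 \<le> \<phi> h + e"
      using shift[OF m(1) h] nonneg[OF add[OF h dH[OF m(1)]]] by linarith
  qed
  with \<sigma> D that show thesis by blast
qed

text \<open>For u = rv one argument becomes 0 and the right side becomes the value of
  \<open>\<phi>\<close> at (r - 1)v, which is known exactly. By the relation between the two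
  constants it equals the sum of the two minorants on the left, so both minorants are attained.
  Every element of H has the form (1 + r)v and also the form 2rv.\<close>

lemma quadratic_solution:
  fixes \<phi> \<psi> :: "real \<Rightarrow> real"
  assumes r: "r \<noteq> 1"
    and eq: "\<And>u v. u \<in> H \<Longrightarrow> v \<in> H \<Longrightarrow> \<phi> (u + v) + \<psi> (u + r * v) = \<phi> (u - v) + \<psi> (u - r * v)"
    and \<phi>: "\<phi> 0 = 0" "\<And>u. u \<in> H \<Longrightarrow> \<phi> (- u) = \<phi> u" "\<And>u. u \<in> H \<Longrightarrow> 0 \<le> \<phi> u"
    and \<psi>: "\<psi> 0 = 0" "\<And>u. u \<in> H \<Longrightarrow> \<psi> (- u) = \<psi> u" "\<And>u. u \<in> H \<Longrightarrow> 0 \<le> \<psi> u"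
  obtains \<sigma> \<sigma>' where "\<sigma> \<ge> 0" "\<sigma>' \<ge> 0" "\<sigma> = - r * \<sigma>'"
    "\<And>h. h \<in> H \<Longrightarrow> \<phi> h = \<sigma> * h\<^sup>2" "\<And>h. h \<in> H \<Longrightarrow> \<psi> h = \<sigma>' * h\<^sup>2"
proof -
  interpret inv: heyde_group H "1 / r" by (rule inverse)
  have dH: "(r - 1) * m \<in> H" if "m \<in> H" for m
    using diff[OF mult_r[OF that] that] by (simp add: algebra_simps)
  obtain \<sigma> where \<sigma>: "\<sigma> \<ge> 0" "\<And>h. h \<in> H \<Longrightarrow> \<sigma> * h\<^sup>2 \<le> \<phi> h"
      "\<And>m. m \<in> H \<Longrightarrow> \<phi> ((r - 1) * m) = \<sigma> * ((r - 1) * m)\<^sup>2"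
    using quadratic_minorant[OF r eq \<phi>] by metis
  have eq': "\<psi> (u + v) + \<phi> (u + 1 / r * v) = \<psi> (u - v) + \<phi> (u - 1 / r * v)" if "u \<in> H" "v \<in> H" for u v
    using eq[OF that(1) div_r[OF that(2)]] r0 by (simp add: add.commute)
  have "1 / r \<noteq> 1" using r by auto
  then obtain \<sigma>' where \<sigma>': "\<sigma>' \<ge> 0" "\<And>h. h \<in> H \<Longrightarrow> \<sigma>' * h\<^sup>2 \<le> \<psi> h"
      "\<And>m. m \<in> H \<Longrightarrow> \<psi> ((1 / r - 1) * m) = \<sigma>' * ((1 / r - 1) * m)\<^sup>2"
    using inv.quadratic_minorant[OF _ eq' \<psi>] by metis
  have \<sigma>'D: "\<psi> ((r - 1) * m) = \<sigma>' * ((r - 1) * m)\<^sup>2" if "m \<in> H" for m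
  proof -
    have "(1 / r - 1) * (- (r * m)) = (r - 1) * m" using r0 by (simp add: field_simps)
    then show ?thesis using \<sigma>'(3)[OF uminus[OF mult_r[OF that]]] by simp
  qed
  have base: "\<phi> ((1 + r) * v) + \<psi> (2 * r * v) = \<sigma> * ((r - 1) * v)\<^sup>2" if "v \<in> H" for v
    using eq[OF mult_r[OF that] that] \<sigma>(3)[OF that] \<psi>(1) by (simp add: algebra_simps)
  \<comment> \<open>For v = r - 1 all three arguments lie in (r - 1)H, where both forms are
    exact.\<close>
  have rel: "\<sigma> = - r * \<sigma>'"
  proof -
    have "\<phi> ((r - 1) * (1 + r)) = \<sigma> * ((r - 1) * (1 + r))\<^sup>2"
      by (rule \<sigma>(3)) (use add one mult_r[OF one] in auto)
    moreover have "\<psi> ((r - 1) * (2 * r)) = \<sigma>' * ((r - 1) * (2 * r))\<^sup>2"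
      by (rule \<sigma>'D) (use add[OF mult_r[OF one] mult_r[OF one]] in auto)
    ultimately have "\<sigma> * ((r - 1) * (1 + r))\<^sup>2 + \<sigma>' * ((r - 1) * (2 * r))\<^sup>2 = \<sigma> * ((r - 1) * (r - 1))\<^sup>2"
      using base[OF dH[OF one]] by (simp add: mult_ac)
    then have "(r - 1)\<^sup>2 * (4 * r) * (\<sigma> + r * \<sigma>') = 0"
      by (simp add: power2_eq_square algebra_simps)
    then show ?thesis using r r0 by (simp add: eq_neg_iff_add_eq_0)
  qed
  have both: "\<phi> ((1 + r) * v) = \<sigma> * ((1 + r) * v)\<^sup>2 \<and> \<psi> (2 * r * v) = \<sigma>' * (2 * r * v)\<^sup>2" if "v \<in> H" for v
  proof -
    have "\<sigma> * ((1 + r) * v)\<^sup>2 + \<sigma>' * (2 * r * v)\<^sup>2 = \<sigma> * ((r - 1) * v)\<^sup>2"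
      unfolding rel by (simp add: power2_eq_square algebra_simps)
    moreover have "\<sigma> * ((1 + r) * v)\<^sup>2 \<le> \<phi> ((1 + r) * v)"
      using add[OF that mult_r[OF that]] by (intro \<sigma>) (simp add: algebra_simps)
    moreover have "\<sigma>' * (2 * r * v)\<^sup>2 \<le> \<psi> (2 * r * v)"
      using add[OF mult_r[OF that] mult_r[OF that]] by (intro \<sigma>') (simp add: algebra_simps)
    ultimately show ?thesis using base[OF that] by linarith
  qed
  have "\<phi> h = \<sigma> * h\<^sup>2" if "h \<in> H" for h
    using both[OF div_1r[OF that]] r1 by simp
  moreover have "\<psi> h = \<sigma>' * h\<^sup>2" if "h \<in> H" for h
    using both[OF half[OF div_r[OF that]]] r0 by simp
  ultimately show thesis using that \<sigma>(1) \<sigma>'(1) rel by blast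
qed

end

section \<open>Continuous solutions on the whole line\<close>

lemma continuous_additive_linear:
  fixes f :: "real \<Rightarrow> complex"
  assumes add: "\<And>x y. f (x + y) = f x + f y" and cont: "continuous_on UNIV f"
  shows "f x = of_real x * f 1"
proof -
  have f0: "f 0 = 0" using add[of 0 0] by simp
  have nat: "f (of_nat n * y) = of_nat n * f y" for n y
    by (induction n) (auto simp: f0 algebra_simps add)
  have int: "f (of_int k * y) = of_int k * f y" for k y
    using add[of "of_int k * y" "- (of_int k * y)"]
    by (cases k rule: int_cases2) (auto simp: f0 nat add_eq_0_iff)
  have rat: "f q - of_real q * f 1 = 0" if "q \<in> \<rat>" for q
  proof -
    from that obtain m n :: int where mn: "n > 0" "q = of_int m / of_int n"
      by (auto elim!: Rats_cases')
    then have "of_int n * q = of_int m * 1" by simp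
    then have "of_int n * f q = of_int m * f 1" using int[of n q] int[of m 1] by metis
    then have "f q = of_int m / of_int n * f 1" using mn(1) by (simp add: field_simps)
    then show ?thesis using mn(2) by simp
  qed
  have "continuous_on (closure \<rat>) (\<lambda>q. f q - of_real q * f 1)"
    by (intro continuous_intros continuous_on_subset[OF cont]) simp
  then have "f x - of_real x * f 1 = 0"
    by (rule continuous_constant_on_closure[OF _ rat]) (simp_all add: Rats_closure_real)
  then show ?thesis by simp
qed

text \<open>The values lie in the discrete set of multiples of 2 \<pi> i. This is how identities
  between exponentials become identities between continuous logarithms.\<close>

lemma exp_eq_1_imp_const:
  fixes h :: "real \<Rightarrow> complex"
  assumes "continuous_on UNIV h" "\<And>x. exp (h x) = 1"
  shows "h x = h y"
proof -
  have "h constant_on UNIV"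
  proof (rule continuous_discrete_range_constant)
    show "\<exists>e>0. \<forall>y. y \<in> UNIV \<and> h y \<noteq> h x \<longrightarrow> e \<le> norm (h y - h x)" for x
    proof (intro exI conjI allI impI)
      fix y assume y: "y \<in> UNIV \<and> h y \<noteq> h x"
      have "exp (h y - h x) = 1" using assms by (simp add: exp_diff)
      then obtain n :: int where n: "Re (h y - h x) = 0" "Im (h y - h x) = of_int (2 * n) * pi"
        by (auto simp: exp_eq_1)
      then have "n \<noteq> 0" using y by (auto simp: complex_eq_iff)
      then have "1 * 1 \<le> \<bar>of_int (2 * n)\<bar> * pi" using pi_gt3 by (intro mult_mono) auto
      then have "1 \<le> \<bar>Im (h y - h x)\<bar>" unfolding n(2) by (simp add: abs_mult)
      then show "1 \<le> norm (h y - h x)" using abs_Im_le_cmod[of "h y - h x"] by linarith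
    qed simp
  qed (use assms in auto)
  then show ?thesis by (metis constant_on_def UNIV_I)
qed

text \<open>The second difference is additive and continuous in each increment, hence bilinear;
  subtracting its quadratic form leaves an affine function.\<close>

lemma quadratic_if_third_difference_eq_0:
  fixes \<eta> :: "real \<Rightarrow> complex"
  assumes cont: "continuous_on UNIV \<eta>"
    and d3: "\<And>d e h. \<eta> (d + e + h) - \<eta> (d + e) - \<eta> (d + h) - \<eta> (e + h) + \<eta> d + \<eta> e + \<eta> h - \<eta> 0 = 0"
  obtains A B C where "\<And>s. \<eta> s = A + B * of_real s + C * of_real (s\<^sup>2)"
proof -
  define B where "B d h = \<eta> (d + h) - \<eta> d - \<eta> h + \<eta> 0" for d h
  have Badd: "B d (h + e) = B d h + B d e" for d h e
    using d3[of d h e] by (simp add: B_def algebra_simps)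
  have contB: "continuous_on UNIV (B d)" for d
    unfolding B_def
    by (intro continuous_intros continuous_on_compose2[OF cont]) auto
  have Blin: "B d h = of_real h * B d 1" for d h
    using continuous_additive_linear[OF Badd contB] .
  have Bsym: "B d h = B h d" for d h by (simp add: B_def algebra_simps)
  define C where "C = B 1 1 / 2"
  have BC: "B d h = 2 * C * of_real (d * h)" for d h
  proof -
    have "B d h = of_real h * (of_real d * B 1 1)"
      using Blin[of d h] Blin[of 1 d] Bsym[of d 1] by metis
    then show ?thesis by (simp add: C_def)
  qed
  define Q where "Q s = \<eta> s - \<eta> 0 - C * of_real (s\<^sup>2)" for s
  have Qadd: "Q (x + y) = Q x + Q y" for x y
    using BC[of x y] by (simp add: Q_def B_def power2_eq_square algebra_simps)
  have "continuous_on UNIV Q"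
    unfolding Q_def by (intro continuous_intros cont)
  then have "Q s = of_real s * Q 1" for s
    by (rule continuous_additive_linear[OF Qadd])
  then have "\<eta> s = \<eta> 0 + Q 1 * of_real s + C * of_real (s\<^sup>2)" for s
  proof -
    have "\<eta> s = \<eta> 0 + Q s + C * of_real (s\<^sup>2)" by (simp add: Q_def)
    then show ?thesis unfolding \<open>Q s = of_real s * Q 1\<close> by (simp add: mult.commute)
  qed
  then show thesis by (rule that)
qed

text \<open>\<open>E\<close> is the multiplier by which shifts of the distributions twist the
  equation. For continuous logarithms the defect \<open>T x y\<close> is determined by y up to
  multiples of 2 \<pi> i. By continuity it is independent of x and additive in y, so it can serve as
  \<open>\<tau>\<close>. On the line all edges can be divided by r - 1, hence all third differences
  vanish.\<close>

lemma heyde_equation_real: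
  fixes F G E :: "real \<Rightarrow> complex"
  assumes r: "r \<noteq> 0" "r \<noteq> 1" "1 + r \<noteq> 0"
    and cont: "continuous_on UNIV F" "continuous_on UNIV G"
    and nz: "\<And>x. F x \<noteq> 0" "\<And>x. G x \<noteq> 0"
    and eq: "\<And>x y. E y * (F (x + y) * G (x + r * y)) = F (x - y) * G (x - r * y)"
    and E: "\<And>x y. E (x + y) = E x * E y"
  obtains A B C where "\<And>s. F s = exp (A + B * of_real s + C * of_real (s\<^sup>2))"
proof -
  obtain \<eta> where \<eta>: "continuous_on UNIV \<eta>" "\<And>x. F x = exp (\<eta> x)"
    by (rule continuous_logarithm_on_contractible[OF cont(1) convex_imp_contractible[OF convex_UNIV]])
      (use nz in auto)
  obtain \<zeta> where \<zeta>: "continuous_on UNIV \<zeta>" "\<And>x. G x = exp (\<zeta> x)"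
    by (rule continuous_logarithm_on_contractible[OF cont(2) convex_imp_contractible[OF convex_UNIV]])
      (use nz in auto)
  define T where "T x y = \<eta> (x + y) + \<zeta> (x + r * y) - \<eta> (x - y) - \<zeta> (x - r * y)" for x y
  have expT: "E y * exp (T x y) = 1" for x y
  proof -
    have "E y * (exp (\<eta> (x + y)) * exp (\<zeta> (x + r * y))) = exp (\<eta> (x - y)) * exp (\<zeta> (x - r * y))"
      using eq[of y x] unfolding \<eta>(2) \<zeta>(2) .
    then show ?thesis unfolding T_def exp_add exp_diff by (simp add: divide_simps)
  qed
  have contT: "continuous_on UNIV (\<lambda>x. T x y)" "continuous_on UNIV (T x)" for x y
    unfolding T_def
    by (intro continuous_intros continuous_on_compose2[OF \<eta>(1)] continuous_on_compose2[OF \<zeta>(1)]; simp)+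
  have "exp (T x y - T 0 y) = 1" for x y
  proof -
    have "E y \<noteq> 0" using expT[of y 0] by auto
    then have "exp (T x y) = exp (T 0 y)" using expT[of y x] expT[of y 0] by (metis mult_cancel_left)
    then show ?thesis by (simp add: exp_diff)
  qed
  then have "T x y - T 0 y = T 0 y - T 0 y" for x y
    by (intro exp_eq_1_imp_const[where h = "\<lambda>x. T x y - T 0 y"] continuous_intros contT) auto
  then have T: "T x y = T 0 y" for x y by simp
  have T0: "T x 0 = 0" for x by (simp add: T_def)
  have "exp (T 0 (x + y) - T 0 x - T 0 y) = 1" for x y
  proof -
    have 1: "E x * exp (T 0 x) = 1" and 2: "E y * exp (T 0 y) = 1"
      and 3: "E x * E y * exp (T 0 (x + y)) = 1" using expT E by metis+
    then have "E x \<noteq> 0" "E y \<noteq> 0" by auto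
    with 1 2 3 have "exp (T 0 x) = 1 / E x" "exp (T 0 y) = 1 / E y" "exp (T 0 (x + y)) = 1 / (E x * E y)"
      by (simp_all add: field_simps)
    then show ?thesis using \<open>E x \<noteq> 0\<close> \<open>E y \<noteq> 0\<close> by (simp add: exp_diff)
  qed
  then have "T 0 (x + y) - T 0 x - T 0 y = T 0 (0 + y) - T 0 0 - T 0 y" for x y
    by (intro exp_eq_1_imp_const[where h = "\<lambda>x. T 0 (x + y) - T 0 x - T 0 y"]
        continuous_intros continuous_on_compose2[OF contT(2)]) auto
  then have Tadd: "T 0 (x + y) = T 0 x + T 0 y" for x y
    by (simp add: T0 algebra_simps)
  have "\<eta> (d + e + h) - \<eta> (d + e) - \<eta> (d + h) - \<eta> (e + h) + \<eta> d + \<eta> e + \<eta> h - \<eta> 0 = 0" for d e h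
  proof -
    have "\<eta> (u + v) + \<zeta> (u + r * v) = \<eta> (u - v) + \<zeta> (u - r * v) + T 0 v" for u v
      using T[of u v] by (simp add: T_def algebra_simps)
    from third_difference_eq_0[of UNIV, OF _ _ _ this Tadd,
        of 0 "h / (1 + r)" "e / 2" "d / (r - 1)"]
    show ?thesis using r by simp
  qed
  then obtain A B C where "\<And>s. \<eta> s = A + B * of_real s + C * of_real (s\<^sup>2)"
    using quadratic_if_third_difference_eq_0[OF \<eta>(1)] by metis
  then show thesis using that \<eta>(2) by simp
qed

text \<open>Symmetry at 0 makes the factor \<kappa> real, possibly negative. The modulus is even,
  which removes the real part of B. The phase of the quadratic term is trivial modulo 2 \<pi> for
  every s and continuous, hence zero. Boundedness fixes the sign of the real part of C.\<close>

lemma hermitian_exp_quadratic: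
  fixes F :: "real \<Rightarrow> complex"
  assumes F: "\<And>s. F s = exp (A + B * of_real s + C * of_real (s\<^sup>2))"
    and herm: "\<And>s. F (- s) = cnj (F s)" and bound: "\<And>s. norm (F s) \<le> 1"
  obtains \<kappa> \<sigma> \<beta> where "\<sigma> \<ge> 0" "\<kappa> \<noteq> 0"
    "\<And>s. F s = of_real \<kappa> * exp (of_real (- \<sigma> * s\<^sup>2) + \<i> * of_real (\<beta> * s))"
proof -
  have F0: "F 0 = exp A" using F[of 0] by simp
  have im0: "Im (exp A) = 0"
  proof -
    have "cnj (exp A) = exp A" using herm[of 0] F0 by simp
    then show ?thesis by (metis Reals_cnj_iff complex_is_Real_iff)
  qed
  define \<kappa> where "\<kappa> = Re (exp A)"
  have \<kappa>: "exp A = of_real \<kappa>" using im0 by (simp add: \<kappa>_def complex_eq_iff)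
  then have "\<kappa> \<noteq> 0" by (metis exp_not_eq_zero of_real_0)
  have Fk: "F s = of_real \<kappa> * exp (B * of_real s + C * of_real (s\<^sup>2))" for s
    unfolding F \<kappa>[symmetric] by (simp add: exp_add mult_ac)
  have "norm (F (- s)) = norm (F s)" for s unfolding herm by simp
  moreover have "norm (F s) = \<bar>\<kappa>\<bar> * exp (Re B * s + Re C * s\<^sup>2)" for s
    unfolding Fk by (simp add: norm_mult)
  ultimately have "\<bar>\<kappa>\<bar> * exp (Re B * (- 1) + Re C * (- 1)\<^sup>2) = \<bar>\<kappa>\<bar> * exp (Re B * 1 + Re C * 1\<^sup>2)" by metis
  then have "exp (Re B * (- 1) + Re C * (- 1)\<^sup>2) = exp (Re B * 1 + Re C * 1\<^sup>2)"
    using \<open>\<kappa> \<noteq> 0\<close> by simp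
  then have ReB: "Re B = 0" by simp
  have sum_real: "exp (2 * \<i> * of_real (Im C * s\<^sup>2)) = 1" for s
  proof -
    have "cnj (F s) = of_real \<kappa> * exp (cnj B * of_real s + cnj C * of_real (s\<^sup>2))"
      unfolding Fk by (simp add: exp_cnj)
    also have "cnj B = - B" using ReB by (simp add: complex_eq_iff)
    finally have "exp (- B * of_real s + C * of_real (s\<^sup>2)) = exp (- B * of_real s + cnj C * of_real (s\<^sup>2))"
      using herm[of s] Fk[of "- s"] \<open>\<kappa> \<noteq> 0\<close> by simp
    then have "exp (C * of_real (s\<^sup>2)) = exp (cnj C * of_real (s\<^sup>2))"
      unfolding exp_add by simp
    then have "exp ((C - cnj C) * of_real (s\<^sup>2)) = 1"
      unfolding left_diff_distrib exp_diff by simp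
    moreover have "(C - cnj C) * of_real (s\<^sup>2) = 2 * \<i> * of_real (Im C * s\<^sup>2)"
      by (simp add: complex_eq_iff)
    ultimately show ?thesis by metis
  qed
  have "continuous_on UNIV (\<lambda>s. 2 * \<i> * complex_of_real (Im C * s\<^sup>2))"
    by (intro continuous_intros)
  from exp_eq_1_imp_const[OF this sum_real, of 1 0]
  have ImC: "Im C = 0" by simp
  have form: "F s = of_real \<kappa> * exp (of_real (- (- Re C) * s\<^sup>2) + \<i> * of_real (Im B * s))" for s
  proof -
    have "B * of_real s + C * of_real (s\<^sup>2) = of_real (- (- Re C) * s\<^sup>2) + \<i> * of_real (Im B * s)"
      using ReB ImC by (simp add: complex_eq_iff)
    then show ?thesis unfolding Fk by simp
  qed
  have "0 \<le> - Re C"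
  proof (rule ccontr)
    assume "\<not> 0 \<le> - Re C"
    then have pos: "Re C > 0" by simp
    \<comment> \<open>At this point the modulus is |\<kappa>| exp (1 / |\<kappa>|), which is at
      least |\<kappa>| + 1.\<close>
    define s where "s = sqrt ((1 / \<bar>\<kappa>\<bar>) / Re C)"
    have "Re C * s\<^sup>2 = 1 / \<bar>\<kappa>\<bar>" using pos by (simp add: s_def)
    then have "norm (F s) = \<bar>\<kappa>\<bar> * exp (1 / \<bar>\<kappa>\<bar>)"
      unfolding form by (simp add: norm_mult norm_exp_eq_Re)
    moreover have "1 + 1 / \<bar>\<kappa>\<bar> \<le> exp (1 / \<bar>\<kappa>\<bar>)" by (rule exp_ge_add_one_self)
    then have "\<bar>\<kappa>\<bar> * (1 + 1 / \<bar>\<kappa>\<bar>) \<le> \<bar>\<kappa>\<bar> * exp (1 / \<bar>\<kappa>\<bar>)" by (intro mult_left_mono) auto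
    ultimately show False using bound[of s] \<open>\<kappa> \<noteq> 0\<close> by (simp add: algebra_simps)
  qed
  then show thesis using \<open>\<kappa> \<noteq> 0\<close> form by (rule that)
qed

section \<open>Gaussian kernels\<close>

text \<open>The substitution z = y / sqrt (1 + 2 a) absorbs the quadratic factor into the normal
  density and leaves a characteristic function.\<close>

lemma gaussian_char_integral:
  fixes a b :: real
  assumes "a \<ge> 0"
  shows "(\<integral>z. exp (of_real (- a * z\<^sup>2) + \<i> * of_real (b * z)) \<partial>std_normal_distribution)
    = complex_of_real (exp (- b\<^sup>2 / (2 * (1 + 2 * a))) / sqrt (1 + 2 * a))"
proof -
  define k where "k = sqrt (1 + 2 * a)"
  have k: "k > 0" "k\<^sup>2 = 1 + 2 * a" using assms by (auto simp: k_def)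
  have int: "(\<integral>z. f z \<partial>std_normal_distribution) = (\<integral>z. std_normal_density z *\<^sub>R f z \<partial>lborel)"
    if "f \<in> borel_measurable borel" for f :: "real \<Rightarrow> complex"
    using that by (intro integral_density) auto
  let ?g = "\<lambda>z. std_normal_density z *\<^sub>R exp (of_real (- a * z\<^sup>2) + \<i> * of_real (b * z))"
  have *: "?g (0 + 1 / k * y) = std_normal_density y *\<^sub>R iexp (b / k * y)" for y
  proof -
    have "- a * (1 / k * y)\<^sup>2 + - ((1 / k * y)\<^sup>2 / 2) = - (1 + 2 * a) * (y / k)\<^sup>2 / 2"
      by (simp add: algebra_simps)
    also have "\<dots> = - (y\<^sup>2 / 2)" unfolding k(2)[symmetric] using k(1) by (simp add: power_divide)
    finally have "exp (- ((1 / k * y)\<^sup>2 / 2)) * exp (- a * (1 / k * y)\<^sup>2) = exp (- (y\<^sup>2 / 2))"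
      by (metis exp_add add.commute)
    then have "std_normal_density (1 / k * y) * exp (- a * (1 / k * y)\<^sup>2) = std_normal_density y"
      by (simp add: std_normal_density_def field_simps)
    moreover have "?g (0 + 1 / k * y)
        = of_real (std_normal_density (1 / k * y) * exp (- a * (1 / k * y)\<^sup>2)) * iexp (b / k * y)"
      unfolding exp_add exp_of_real by (simp add: scaleR_conv_of_real mult_ac)
    ultimately show ?thesis by (simp only: scaleR_conv_of_real)
  qed
  have "(\<integral>z. exp (of_real (- a * z\<^sup>2) + \<i> * of_real (b * z)) \<partial>std_normal_distribution) = (\<integral>z. ?g z \<partial>lborel)"
    by (rule int) simp
  also have "\<dots> = \<bar>1 / k\<bar> *\<^sub>R (\<integral>y. ?g (0 + 1 / k * y) \<partial>lborel)"
    by (rule lborel_integral_real_affine) (use k in simp)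
  also have "\<dots> = (1 / k) *\<^sub>R char std_normal_distribution (b / k)"
    unfolding * char_def using k by (subst int) auto
  also have "\<dots> = complex_of_real (exp (- b\<^sup>2 / (2 * (1 + 2 * a))) / sqrt (1 + 2 * a))"
    unfolding char_std_normal_distribution k(2)[symmetric] using k by (simp add: k_def scaleR_conv_of_real power_divide)
  finally show ?thesis .
qed

text \<open>Integrating against the Gaussian kernels \<open>exp (- (t - x)\<^sup>2 / (4 * \<epsilon>))\<close>, written as Fourier
  integrals, compares the two characteristic functions without inverting them; this also covers the
  degenerate cases \<open>\<sigma> = 0\<close> and \<open>\<sigma>' = 0\<close>.\<close>

lemma (in prob_space) gaussian_kernel_integral:
  fixes T e :: "'a \<Rightarrow> real"
  assumes [measurable]: "T \<in> borel_measurable M" "e \<in> borel_measurable M"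
    and e: "\<And>\<omega>. \<omega> \<in> space M \<Longrightarrow> \<bar>e \<omega>\<bar> \<le> 1" and \<sigma>: "\<sigma> \<ge> 0" and \<epsilon>: "\<epsilon> > 0"
    and F: "\<And>s. (\<integral>\<omega>. iexp (s * T \<omega>) * of_real (e \<omega>) \<partial>M)
      = of_real \<kappa> * exp (of_real (- \<sigma> * s\<^sup>2) + \<i> * of_real (\<beta> * s))"
  shows "expectation (\<lambda>\<omega>. exp (- (T \<omega> - x)\<^sup>2 / (4 * \<epsilon>)) * e \<omega>)
    = \<kappa> * sqrt (\<epsilon> / (\<sigma> + \<epsilon>)) * exp (- (\<beta> - x)\<^sup>2 / (4 * (\<sigma> + \<epsilon>)))"
proof -
  let ?N = std_normal_distribution
  interpret N: real_distribution ?N by (rule real_dist_normal_dist)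
  interpret NM: pair_prob_space M ?N ..
  \<comment> \<open>With this scale the normal characteristic function at c (t - x) is exactly the
    kernel.\<close>
  define c where "c = 1 / sqrt (2 * \<epsilon>)"
  have c2: "c\<^sup>2 = 1 / (2 * \<epsilon>)" using \<epsilon> by (simp add: c_def power_divide)
  have kernel: "complex_of_real (exp (- (t - x)\<^sup>2 / (4 * \<epsilon>))) = (\<integral>z. iexp (c * (t - x) * z) \<partial>?N)" for t
  proof -
    have "- ((c * (t - x))\<^sup>2) / 2 = - (t - x)\<^sup>2 / (4 * \<epsilon>)"
      by (simp add: power_mult_distrib c2)
    then show ?thesis
      using fun_cong[OF char_std_normal_distribution, of "c * (t - x)"] by (simp add: char_def)
  qed
  let ?k = "\<lambda>\<omega> z. iexp (c * (T \<omega> - x) * z) * complex_of_real (e \<omega>)"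
  have "(\<integral>\<omega>. complex_of_real (exp (- (T \<omega> - x)\<^sup>2 / (4 * \<epsilon>)) * e \<omega>) \<partial>M)
      = (\<integral>\<omega>. (\<integral>z. ?k \<omega> z \<partial>?N) \<partial>M)"
    unfolding of_real_mult kernel by simp
  also have "\<dots> = (\<integral>z. (\<integral>\<omega>. ?k \<omega> z \<partial>M) \<partial>?N)"
  proof (rule NM.Fubini_integral[symmetric])
    show "integrable (M \<Otimes>\<^sub>M ?N) (\<lambda>(\<omega>, z). ?k \<omega> z)"
      by (rule NM.P.integrable_const_bound[of _ 1])
        (use e in \<open>auto simp: norm_mult space_pair_measure intro!: AE_I2\<close>)
  qed
  also have "\<dots> = (\<integral>z. of_real \<kappa> * exp (of_real (- (\<sigma> * c\<^sup>2) * z\<^sup>2) + \<i> * of_real ((\<beta> - x) * c * z)) \<partial>?N)"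
  proof (rule Bochner_Integration.integral_cong[OF refl])
    fix z
    have "?k \<omega> z = iexp (- c * x * z) * (iexp ((c * z) * T \<omega>) * of_real (e \<omega>))" for \<omega>
      by (simp add: exp_add[symmetric] algebra_simps)
    then have "(\<integral>\<omega>. ?k \<omega> z \<partial>M) = iexp (- c * x * z) * (\<integral>\<omega>. iexp ((c * z) * T \<omega>) * of_real (e \<omega>) \<partial>M)"
      by (simp only: integral_mult_right_zero)
    also have "\<dots> = of_real \<kappa> * (iexp (- c * x * z) * exp (of_real (- \<sigma> * (c * z)\<^sup>2) + \<i> * of_real (\<beta> * (c * z))))"
      unfolding F by (simp only: mult_ac)
    also have "iexp (- c * x * z) * exp (of_real (- \<sigma> * (c * z)\<^sup>2) + \<i> * of_real (\<beta> * (c * z)))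
      = exp (of_real (- (\<sigma> * c\<^sup>2) * z\<^sup>2) + \<i> * of_real ((\<beta> - x) * c * z))"
      by (simp add: exp_add[symmetric] algebra_simps power_mult_distrib)
    finally show "(\<integral>\<omega>. ?k \<omega> z \<partial>M) = of_real \<kappa> * exp (of_real (- (\<sigma> * c\<^sup>2) * z\<^sup>2) + \<i> * of_real ((\<beta> - x) * c * z))" .
  qed
  also have "\<dots> = of_real \<kappa> * complex_of_real (exp (- ((\<beta> - x) * c)\<^sup>2 / (2 * (1 + 2 * (\<sigma> * c\<^sup>2)))) / sqrt (1 + 2 * (\<sigma> * c\<^sup>2)))"
    using \<sigma> by (subst gaussian_char_integral[symmetric]) auto
  also have "1 + 2 * (\<sigma> * c\<^sup>2) = (\<sigma> + \<epsilon>) / \<epsilon>" using \<epsilon> by (simp add: c2 field_simps)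
  also have "- ((\<beta> - x) * c)\<^sup>2 / (2 * ((\<sigma> + \<epsilon>) / \<epsilon>)) = - (\<beta> - x)\<^sup>2 / (4 * (\<sigma> + \<epsilon>))"
    using \<epsilon> \<sigma> by (simp only: power_mult_distrib c2) (simp add: field_simps)
  also have "of_real \<kappa> * complex_of_real (exp (- (\<beta> - x)\<^sup>2 / (4 * (\<sigma> + \<epsilon>))) / sqrt ((\<sigma> + \<epsilon>) / \<epsilon>))
    = complex_of_real (\<kappa> * sqrt (\<epsilon> / (\<sigma> + \<epsilon>)) * exp (- (\<beta> - x)\<^sup>2 / (4 * (\<sigma> + \<epsilon>))))"
    using \<epsilon> \<sigma> by (simp add: real_sqrt_divide)
  finally show ?thesis unfolding integral_complex_of_real of_real_eq_iff .
qed

text \<open>For \<open>e\<close> the sign of the Z(2) coordinate, the second transform belongs to a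
  signed measure dominated by the law of \<open>T\<close>. Integrating one positive kernel against
  both turns this domination into an inequality between explicit Gaussians.\<close>

lemma (in prob_space) gaussian_domination:
  fixes T e :: "'a \<Rightarrow> real"
  assumes [measurable]: "T \<in> borel_measurable M" "e \<in> borel_measurable M"
    and e: "\<And>\<omega>. \<omega> \<in> space M \<Longrightarrow> \<bar>e \<omega>\<bar> \<le> 1" and \<sigma>: "\<sigma> \<ge> 0" "\<sigma>' \<ge> 0" and \<epsilon>: "\<epsilon> > 0"
    and F: "\<And>s. (\<integral>\<omega>. iexp (s * T \<omega>) \<partial>M) = exp (of_real (- \<sigma> * s\<^sup>2) + \<i> * of_real (\<beta> * s))"
    and F': "\<And>s. (\<integral>\<omega>. iexp (s * T \<omega>) * of_real (e \<omega>) \<partial>M)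
      = of_real \<kappa> * exp (of_real (- \<sigma>' * s\<^sup>2) + \<i> * of_real (\<beta>' * s))"
  shows "\<bar>\<kappa>\<bar> * sqrt (\<sigma> + \<epsilon>) * exp (- (\<beta>' - x)\<^sup>2 / (4 * (\<sigma>' + \<epsilon>)))
    \<le> sqrt (\<sigma>' + \<epsilon>) * exp (- (\<beta> - x)\<^sup>2 / (4 * (\<sigma> + \<epsilon>)))"
proof -
  let ?h = "\<lambda>\<omega>. exp (- (T \<omega> - x)\<^sup>2 / (4 * \<epsilon>))"
  have "\<bar>expectation (\<lambda>\<omega>. ?h \<omega> * e \<omega>)\<bar> \<le> expectation (\<lambda>\<omega>. ?h \<omega> * 1)"
  proof (rule order_trans[OF integral_abs_bound])
    have i: "integrable M (\<lambda>\<omega>. ?h \<omega> * d \<omega>)"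
      if [measurable]: "d \<in> borel_measurable M" and "\<And>\<omega>. \<omega> \<in> space M \<Longrightarrow> \<bar>d \<omega>\<bar> \<le> 1" for d
      using that \<epsilon>
      by (intro integrable_const_bound[of _ 1]) (auto simp: abs_mult intro!: AE_I2 mult_le_one)
    show "expectation (\<lambda>\<omega>. \<bar>?h \<omega> * e \<omega>\<bar>) \<le> expectation (\<lambda>\<omega>. ?h \<omega> * 1)"
      using e by (intro integral_mono integrable_abs i) (auto simp: abs_mult)
  qed
  then have "\<bar>\<kappa>\<bar> * sqrt (\<epsilon> / (\<sigma>' + \<epsilon>)) * exp (- (\<beta>' - x)\<^sup>2 / (4 * (\<sigma>' + \<epsilon>)))
      \<le> sqrt (\<epsilon> / (\<sigma> + \<epsilon>)) * exp (- (\<beta> - x)\<^sup>2 / (4 * (\<sigma> + \<epsilon>)))"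
    using gaussian_kernel_integral[OF assms(1,2) e \<sigma>(2) \<epsilon> F', of x]
      gaussian_kernel_integral[OF assms(1), of "\<lambda>_. 1" \<sigma> \<epsilon> 1 \<beta> x] \<sigma> \<epsilon> F
    by (simp add: abs_mult)
  then show ?thesis using \<sigma> \<epsilon> by (simp add: real_sqrt_divide field_simps)
qed

section \<open>The a-adic integers\<close>

definition place :: "(nat \<Rightarrow> nat) \<Rightarrow> nat \<Rightarrow> nat" where
  "place a n = (\<Prod>i<n. a i)"

text \<open>The residue of x modulo \<open>place a n\<close>. These residues present the a-adic
  integers as the inverse limit of finite cyclic groups, and the group axioms are checked on
  them.\<close>

definition digit_sum :: "(nat \<Rightarrow> nat) \<Rightarrow> (nat \<Rightarrow> nat) \<Rightarrow> nat \<Rightarrow> nat" where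
  "digit_sum a x n = (\<Sum>k<n. x k * place a k)"

lemma place_0 [simp]: "place a 0 = 1" and place_Suc: "place a (Suc n) = place a n * a n"
  by (simp_all add: place_def)

lemma digit_sum_0 [simp]: "digit_sum a x 0 = 0"
  and digit_sum_Suc: "digit_sum a x (Suc n) = digit_sum a x n + x n * place a n"
  by (simp_all add: digit_sum_def)

text \<open>The only discrepancy is the carry leaving the first n digits, a multiple of
  \<open>place a n\<close>; hence truncation is additive modulo \<open>place a n\<close>.\<close>

lemma digit_sum_mult:
  "digit_sum a (x \<otimes>\<^bsub>adic_group a\<^esub> y) n + adic_carry a x y n * place a n = digit_sum a x n + digit_sum a y n"
proof (induction n)
  case (Suc n)
  define t where "t = x n + y n + adic_carry a x y n"
  have "t mod a n * place a n + t div a n * (a n * place a n) = (t mod a n + t div a n * a n) * place a n"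
    by (simp only: distrib_right mult.assoc)
  also have "\<dots> = x n * place a n + y n * place a n + adic_carry a x y n * place a n"
    unfolding mod_div_mult_eq by (simp only: t_def distrib_right)
  finally show ?case using Suc
    by (simp add: digit_sum_Suc place_Suc adic_group_def t_def[symmetric] mult.commute[of "a n"])
qed simp

locale adic =
  fixes a :: "nat \<Rightarrow> nat"
  assumes a_gt_1: "\<And>n. 1 < a n"
begin

abbreviation "N \<equiv> place a"
abbreviation "S \<equiv> digit_sum a"
abbreviation "\<Delta> \<equiv> adic_group a"

lemma a_pos [simp]: "0 < a n"
  using a_gt_1[of n] by simp

lemma N_pos [simp]: "0 < N n"
  by (induction n) (simp_all add: place_Suc)

lemma N_nonzero [simp]: "N n \<noteq> 0"
  using N_pos[of n] by simp

lemma N_dvd: "m \<le> n \<Longrightarrow> N m dvd N n"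
  by (induction n rule: nat_induct_at_least) (auto simp: place_Suc)

lemma mem_carrier: "x \<in> carrier \<Delta> \<longleftrightarrow> (\<forall>n. x n < a n)"
  by (simp add: adic_group_def)

lemma S_less: "x \<in> carrier \<Delta> \<Longrightarrow> S x n < N n"
proof (induction n)
  case (Suc n)
  then have "S x n < N n" "x n + 1 \<le> a n" by (auto simp: mem_carrier Suc_le_eq)
  then have "(x n + 1) * N n \<le> a n * N n" by (intro mult_right_mono) auto
  then show ?case using \<open>S x n < N n\<close> by (simp add: digit_sum_Suc place_Suc mult.commute)
qed simp

lemma S_mult_cong: "[int (S (x \<otimes>\<^bsub>\<Delta>\<^esub> y) n) = int (S x n) + int (S y n)] (mod int (N n))"
proof -
  have "int (S (x \<otimes>\<^bsub>\<Delta>\<^esub> y) n) - (int (S x n) + int (S y n)) = - int (adic_carry a x y n) * int (N n)"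
    using digit_sum_mult[where a = a and x = x and y = y and n = n, THEN arg_cong[where f = int]]
    by simp
  then show ?thesis by (simp only: cong_iff_dvd_diff dvd_triv_right)
qed

lemma S_one: "S \<one>\<^bsub>\<Delta>\<^esub> n = 0"
  by (simp add: digit_sum_def adic_group_def)

lemma S_mono_cong: "m \<le> n \<Longrightarrow> [int (S x n) = int (S x m)] (mod int (N m))"
proof (induction n rule: nat_induct_at_least)
  case (Suc n)
  have "int (N m) dvd int (x n * N n)" using N_dvd[OF Suc(1)] by simp
  then have "[int (x n * N n) = 0] (mod int (N m))" by (simp add: cong_0_iff)
  from cong_add[OF Suc(2) this] show ?case by (simp add: digit_sum_Suc)
qed simp

text \<open>Truncations are smaller than their modulus, so congruent ones are equal, and consecutive
  truncations determine the digits.\<close>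

lemma eqI_S:
  assumes "x \<in> carrier \<Delta>" "y \<in> carrier \<Delta>"
    and "\<And>n. [int (S x n) = int (S y n)] (mod int (N n))"
  shows "x = y"
proof
  fix n
  have eq: "S x n = S y n" for n
    using assms(3)[of n] S_less[OF assms(1), of n] S_less[OF assms(2), of n]
    by (simp add: cong_int_iff cong_less_modulus_unique_nat)
  show "x n = y n" using eq[of n] eq[of "Suc n"] by (simp add: digit_sum_Suc)
qed

text \<open>Completeness of the inverse limit: the least residues \<open>r n\<close> are compatible,
  and their successive quotients are the digits. It supplies inverses in the group, and later points
  of the solenoid with prescribed character values.\<close>

lemma S_surj:
  fixes R :: "nat \<Rightarrow> int"
  assumes R: "\<And>n. int (N n) dvd R (Suc n) - R n"
  shows "\<exists>x\<in>carrier \<Delta>. \<forall>n. [int (S x n) = R n] (mod int (N n))"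
proof -
  define r where "r n = nat (R n mod int (N n))" for n
  have r: "int (r n) = R n mod int (N n)" for n by (simp add: r_def)
  have r_less: "r n < N n" for n
  proof -
    have "int (r n) < int (N n)" unfolding r by (rule pos_mod_bound) simp
    then show ?thesis by simp
  qed
  have r_mod: "r (Suc n) mod N n = r n" for n
  proof -
    have "int (r (Suc n) mod N n) = R (Suc n) mod int (N (Suc n)) mod int (N n)"
      by (simp add: r zmod_int)
    also have "\<dots> = R (Suc n) mod int (N n)" by (rule mod_mod_cancel) (simp add: place_Suc)
    also have "\<dots> = R n mod int (N n)" using R[of n] by (simp add: mod_eq_dvd_iff)
    also have "\<dots> = int (r n)" by (simp add: r)
    finally show ?thesis by (simp only: of_nat_eq_iff)
  qed
  define x where "x n = r (Suc n) div N n" for n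
  have "x n < a n" for n
    using r_less[of "Suc n"] by (simp add: x_def place_Suc less_mult_imp_div_less mult.commute)
  then have "x \<in> carrier \<Delta>" by (simp add: mem_carrier)
  moreover have "S x n = r n" for n
  proof (induction n)
    case 0
    show ?case using r_less[of 0] by simp
  next
    case (Suc n)
    have "r (Suc n) mod N n + r (Suc n) div N n * N n = r (Suc n)" by (rule mod_div_mult_eq)
    then show ?case using r_mod[of n] Suc by (simp add: digit_sum_Suc x_def)
  qed
  then have "[int (S x n) = R n] (mod int (N n))" for n by (simp add: r cong_def)
  ultimately show ?thesis by blast
qed

lemma mult_closed: "x \<in> carrier \<Delta> \<Longrightarrow> y \<in> carrier \<Delta> \<Longrightarrow> x \<otimes>\<^bsub>\<Delta>\<^esub> y \<in> carrier \<Delta>"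
  using a_gt_1 by (simp add: mem_carrier) (simp add: adic_group_def)

lemma one_closed: "\<one>\<^bsub>\<Delta>\<^esub> \<in> carrier \<Delta>"
  using a_gt_1 by (simp add: adic_group_def)

sublocale \<Delta>: comm_group \<Delta>
proof (rule comm_groupI)
  fix x y z assume x: "x \<in> carrier \<Delta>" and y: "y \<in> carrier \<Delta>"
  show "x \<otimes>\<^bsub>\<Delta>\<^esub> y \<in> carrier \<Delta>" using x y by (rule mult_closed)
  show "x \<otimes>\<^bsub>\<Delta>\<^esub> y = y \<otimes>\<^bsub>\<Delta>\<^esub> x"
  proof (rule eqI_S)
    show "[int (S (x \<otimes>\<^bsub>\<Delta>\<^esub> y) n) = int (S (y \<otimes>\<^bsub>\<Delta>\<^esub> x) n)] (mod int (N n))" for n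
      by (rule cong_trans[OF S_mult_cong], subst add.commute, rule cong_sym[OF S_mult_cong])
  qed (use x y mult_closed in auto)
  assume z: "z \<in> carrier \<Delta>"
  show "x \<otimes>\<^bsub>\<Delta>\<^esub> y \<otimes>\<^bsub>\<Delta>\<^esub> z = x \<otimes>\<^bsub>\<Delta>\<^esub> (y \<otimes>\<^bsub>\<Delta>\<^esub> z)"
  proof (rule eqI_S)
    show "[int (S (x \<otimes>\<^bsub>\<Delta>\<^esub> y \<otimes>\<^bsub>\<Delta>\<^esub> z) n) = int (S (x \<otimes>\<^bsub>\<Delta>\<^esub> (y \<otimes>\<^bsub>\<Delta>\<^esub> z)) n)] (mod int (N n))" for n
    proof -
      have "[int (S (x \<otimes>\<^bsub>\<Delta>\<^esub> y \<otimes>\<^bsub>\<Delta>\<^esub> z) n) = int (S x n) + int (S y n) + int (S z n)] (mod int (N n))"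
        using cong_trans[OF S_mult_cong cong_add[OF S_mult_cong cong_refl]] .
      moreover have "[int (S (x \<otimes>\<^bsub>\<Delta>\<^esub> (y \<otimes>\<^bsub>\<Delta>\<^esub> z)) n) = int (S x n) + (int (S y n) + int (S z n))] (mod int (N n))"
        using cong_trans[OF S_mult_cong cong_add[OF cong_refl S_mult_cong]] .
      ultimately show ?thesis unfolding add.assoc by (rule cong_trans[OF _ cong_sym])
    qed
  qed (use x y z mult_closed in auto)
next
  show "\<one>\<^bsub>\<Delta>\<^esub> \<in> carrier \<Delta>" by (rule one_closed)
  fix x assume x: "x \<in> carrier \<Delta>"
  show "\<one>\<^bsub>\<Delta>\<^esub> \<otimes>\<^bsub>\<Delta>\<^esub> x = x"
  proof (rule eqI_S)
    show "[int (S (\<one>\<^bsub>\<Delta>\<^esub> \<otimes>\<^bsub>\<Delta>\<^esub> x) n) = int (S x n)] (mod int (N n))" for n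
      using S_mult_cong[of "\<one>\<^bsub>\<Delta>\<^esub>" x n] by (simp add: S_one)
  qed (use x one_closed mult_closed in auto)
  have "int (N n) dvd - int (S x (Suc n)) - - int (S x n)" for n
    by (simp add: digit_sum_Suc)
  from S_surj[where R = "\<lambda>n. - int (S x n)", OF this]
  obtain y where y: "y \<in> carrier \<Delta>" "\<And>n. [int (S y n) = - int (S x n)] (mod int (N n))"
    by auto
  have "y \<otimes>\<^bsub>\<Delta>\<^esub> x = \<one>\<^bsub>\<Delta>\<^esub>"
  proof (rule eqI_S)
    show "[int (S (y \<otimes>\<^bsub>\<Delta>\<^esub> x) n) = int (S \<one>\<^bsub>\<Delta>\<^esub> n)] (mod int (N n))" for n
      using cong_trans[OF S_mult_cong cong_add[OF y(2)[of n] cong_refl[of "int (S x n)"]]] by (simp add: S_one)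
  qed (use x y one_closed mult_closed in auto)
  then show "\<exists>y\<in>carrier \<Delta>. y \<otimes>\<^bsub>\<Delta>\<^esub> x = \<one>\<^bsub>\<Delta>\<^esub>" using y by blast
qed

lemma unit_closed: "adic_unit \<in> carrier \<Delta>"
  using a_gt_1 by (simp add: mem_carrier adic_unit_def)

lemma S_unit: "[int (S adic_unit n) = 1] (mod int (N n))"
proof -
  have "S adic_unit n = (if n = 0 then 0 else 1)"
    by (induction n) (auto simp: digit_sum_Suc adic_unit_def)
  then show ?thesis by (cases n) auto
qed

lemma S_inv: "x \<in> carrier \<Delta> \<Longrightarrow> [int (S (inv\<^bsub>\<Delta>\<^esub> x) n) = - int (S x n)] (mod int (N n))"
proof -
  assume "x \<in> carrier \<Delta>"
  then have "[int (S (inv\<^bsub>\<Delta>\<^esub> x) n) + int (S x n) = 0] (mod int (N n))"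
    using S_mult_cong[of "inv\<^bsub>\<Delta>\<^esub> x" x n] by (auto simp: S_one intro: cong_sym)
  then show ?thesis by (simp add: cong_iff_dvd_diff)
qed

lemma S_unit_pow: "[int (S (adic_unit [^]\<^bsub>\<Delta>\<^esub> (k::int)) n) = k] (mod int (N n))"
proof -
  have nat: "[int (S (adic_unit [^]\<^bsub>\<Delta>\<^esub> (k::nat)) n) = int k] (mod int (N n))" for k
  proof (induction k)
    case (Suc k)
    show ?case
      using cong_trans[OF S_mult_cong cong_add[OF Suc S_unit]] by (simp add: add.commute)
  qed (simp add: S_one)
  show ?thesis
  proof (cases k rule: int_cases2)
    case (nonneg m)
    then show ?thesis using nat by (simp add: int_pow_int)
  next
    case (nonpos m)
    have "[int (S (inv\<^bsub>\<Delta>\<^esub> (adic_unit [^]\<^bsub>\<Delta>\<^esub> m)) n) = - int m] (mod int (N n))"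
      using cong_trans[OF S_inv cong_minus_minus_iff[THEN iffD2, OF nat]] unit_closed by simp
    then show ?thesis using nonpos unit_closed by (simp add: \<Delta>.int_pow_neg_int)
  qed
qed

lemma unit_pow_eqI:
  assumes "x \<in> carrier \<Delta>" "\<And>n. [int (S x n) = k] (mod int (N n))"
  shows "x = adic_unit [^]\<^bsub>\<Delta>\<^esub> k"
proof (rule eqI_S)
  show "[int (S x n) = int (S (adic_unit [^]\<^bsub>\<Delta>\<^esub> k) n)] (mod int (N n))" for n
    by (rule cong_trans[OF assms(2) cong_sym[OF S_unit_pow]])
qed (use assms(1) unit_closed in auto)

end

section \<open>Characters of the solenoid\<close>

lemma cnj_mult_self: "norm z = 1 \<Longrightarrow> cnj z * z = 1"
  by (metis complex_norm_square mult.commute of_real_1 one_power2)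

lemma eq_cnjI: "w * z = 1 \<Longrightarrow> norm z = 1 \<Longrightarrow> w = cnj z"
  by (metis cnj_mult_self mult_cancel_right mult_zero_right zero_neq_one)

lemma cis_eq_1_iff_int: "cis x = 1 \<longleftrightarrow> (\<exists>k::int. x = of_int k * (2 * pi))"
proof
  assume "cis x = 1"
  then have "cos x = 1" by (simp add: complex_eq_iff)
  then show "\<exists>k::int. x = of_int k * (2 * pi)" by (auto simp: cos_one_2pi_int)
next
  assume "\<exists>k::int. x = of_int k * (2 * pi)"
  then obtain k :: int where "x = 2 * pi * of_int k" by (auto simp: mult.commute)
  then show "cis x = 1" by (simp only: cis_multiple_2pi Ints_of_int)
qed

context adic begin

abbreviation "\<Gamma> \<equiv> real_group \<times>\<times> adic_group a"
abbreviation "\<Sigma> \<equiv> solenoid a"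

definition cls :: "real \<times> (nat \<Rightarrow> nat) \<Rightarrow> solenoid_elt" where
  "cls p = solenoid_rel a #>\<^bsub>\<Gamma>\<^esub> p"

lemma real_group_simps [simp]:
  "carrier real_group = UNIV" "x \<otimes>\<^bsub>real_group\<^esub> y = x + y" "\<one>\<^bsub>real_group\<^esub> = 0"
  by (simp_all add: real_group_def)

lemma comm_group_real: "comm_group real_group"
  by (rule comm_groupI) (auto simp: algebra_simps intro: exI[of _ "- x" for x])

lemma inv_real_group [simp]: "inv\<^bsub>real_group\<^esub> x = - x"
  by (rule group.inv_equality) (use comm_group_real in \<open>auto simp: comm_group_def\<close>)

sublocale \<Gamma>: comm_group \<Gamma>
proof -
  interpret R: comm_group real_group by (rule comm_group_real)
  interpret group \<Gamma> by (rule DirProd_group[OF R.is_group \<Delta>.is_group])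
  show "comm_group \<Gamma>"
    by (rule group_comm_groupI) (auto simp: \<Delta>.m_comm)
qed

lemma solenoid_relI: "(of_int k, adic_unit [^]\<^bsub>\<Delta>\<^esub> k) \<in> solenoid_rel a"
  by (simp add: solenoid_rel_def)

lemma solenoid_relE:
  assumes "p \<in> solenoid_rel a"
  obtains k :: int where "p = (of_int k, adic_unit [^]\<^bsub>\<Delta>\<^esub> k)"
  using assms by (auto simp: solenoid_rel_def)

lemma subgroup_solenoid_rel: "subgroup (solenoid_rel a) \<Gamma>"
proof (rule \<Gamma>.subgroupI)
  show "solenoid_rel a \<subseteq> carrier \<Gamma>" using unit_closed by (auto simp: solenoid_rel_def)
  show "solenoid_rel a \<noteq> {}" by (simp add: solenoid_rel_def)
  fix p assume "p \<in> solenoid_rel a"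
  then obtain k where p: "p = (of_int k, adic_unit [^]\<^bsub>\<Delta>\<^esub> k)" by (rule solenoid_relE)
  interpret R: comm_group real_group by (rule comm_group_real)
  have "inv\<^bsub>\<Gamma>\<^esub> p = (of_int (- k), adic_unit [^]\<^bsub>\<Delta>\<^esub> (- k))"
    unfolding p using unit_closed
    by (subst inv_DirProd) (auto simp: \<Delta>.int_pow_neg R.is_group \<Delta>.is_group)
  then show "inv\<^bsub>\<Gamma>\<^esub> p \<in> solenoid_rel a" by (simp only: solenoid_relI)
  fix q assume "q \<in> solenoid_rel a"
  then obtain l where q: "q = (of_int l, adic_unit [^]\<^bsub>\<Delta>\<^esub> l)" by (rule solenoid_relE)
  have "p \<otimes>\<^bsub>\<Gamma>\<^esub> q = (of_int (k + l), adic_unit [^]\<^bsub>\<Delta>\<^esub> (k + l))"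
    unfolding p q using unit_closed by (simp add: \<Delta>.int_pow_mult)
  then show "p \<otimes>\<^bsub>\<Gamma>\<^esub> q \<in> solenoid_rel a" by (simp only: solenoid_relI)
qed

sublocale rel: normal "solenoid_rel a" \<Gamma>
  by (rule \<Gamma>.subgroup_imp_normal[OF subgroup_solenoid_rel])

sublocale \<Sigma>: comm_group \<Sigma>
  unfolding solenoid_def by (rule \<Gamma>.abelian_FactGroup[OF subgroup_solenoid_rel])

lemma carrier_solenoid: "carrier \<Sigma> = cls ` carrier \<Gamma>"
  by (simp add: solenoid_def carrier_FactGroup cls_def)

lemma cls_mult: "p \<in> carrier \<Gamma> \<Longrightarrow> q \<in> carrier \<Gamma> \<Longrightarrow> cls p \<otimes>\<^bsub>\<Sigma>\<^esub> cls q = cls (p \<otimes>\<^bsub>\<Gamma>\<^esub> q)"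
  unfolding solenoid_def cls_def by (simp only: mult_FactGroup) (rule rel.rcos_sum)

lemma one_solenoid: "\<one>\<^bsub>\<Sigma>\<^esub> = solenoid_rel a"
  by (simp add: solenoid_def)

lemma cls_rel: "p \<in> solenoid_rel a \<Longrightarrow> cls p = \<one>\<^bsub>\<Sigma>\<^esub>"
  unfolding cls_def one_solenoid
  by (rule \<Gamma>.coset_join2[OF subsetD[OF rel.subset] rel.subgroup_axioms])

lemma mem_cls:
  assumes "(t', x') \<in> cls (t, x)"
  obtains k :: int where "t' = of_int k + t" "x' = adic_unit [^]\<^bsub>\<Delta>\<^esub> k \<otimes>\<^bsub>\<Delta>\<^esub> x"
  using assms by (auto simp: cls_def r_coset_def elim!: solenoid_relE)

lemma self_mem_cls: "p \<in> carrier \<Gamma> \<Longrightarrow> p \<in> cls p"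
  unfolding cls_def by (rule \<Gamma>.rcos_self[OF _ rel.subgroup_axioms])

abbreviation "H \<equiv> H_group a"
abbreviation "chi \<equiv> solenoid_char a"

lemma H_iff: "b \<in> H \<longleftrightarrow> (\<exists>(m::int) n. b = of_int m / real (N (Suc n)))"
  by (auto simp: H_group_def place_def lessThan_Suc_atMost)

lemma H_repr:
  assumes "b \<in> H"
  shows "\<exists>n0. \<forall>n\<ge>n0. \<exists>m::int. b = of_int m / real (N (Suc n))"
proof -
  obtain m :: int and n0 where b: "b = of_int m / real (N (Suc n0))" using assms H_iff by blast
  show ?thesis
  proof (intro exI[of _ n0] allI impI)
    fix n assume "n0 \<le> n"
    then obtain d where d: "N (Suc n) = N (Suc n0) * d" using N_dvd[of "Suc n0" "Suc n"] by auto
    then have "d \<noteq> 0" using N_nonzero[of "Suc n"] by (intro notI) simp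
    then have "b = of_int (m * int d) / real (N (Suc n))"
      unfolding b d by simp
    then show "\<exists>m::int. b = of_int m / real (N (Suc n))" by blast
  qed
qed

lemma H_common:
  assumes "b \<in> H" "c \<in> H"
  obtains n and m k :: int where "b = of_int m / real (N (Suc n))" "c = of_int k / real (N (Suc n))"
proof -
  obtain n0 where n0: "\<And>n. n \<ge> n0 \<Longrightarrow> \<exists>m::int. b = of_int m / real (N (Suc n))" using H_repr[OF assms(1)] by auto
  obtain n1 where n1: "\<And>n. n \<ge> n1 \<Longrightarrow> \<exists>m::int. c = of_int m / real (N (Suc n))" using H_repr[OF assms(2)] by auto
  show thesis using n0[of "max n0 n1"] n1[of "max n0 n1"] that by auto
qed

lemma H_intI: "of_int m / real (N (Suc n)) \<in> H"
  using H_iff by blast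

lemma one_H: "1 \<in> H"
  using H_intI[of "int (N (Suc 0))" 0] by simp

lemma H_add: "b \<in> H \<Longrightarrow> c \<in> H \<Longrightarrow> b + c \<in> H"
  by (erule (1) H_common) (metis H_intI add_divide_distrib of_int_add)

lemma H_uminus: "b \<in> H \<Longrightarrow> - b \<in> H"
  unfolding H_iff by (metis minus_divide_left of_int_minus)

lemma H_rats: "H \<subseteq> \<rat>"
  by (auto simp: H_iff)

lemma of_int_H_mult: "b \<in> H \<Longrightarrow> of_int k * b \<in> H"
  unfolding H_iff by (metis of_int_mult times_divide_eq_right)

text \<open>A character with denominator \<open>N n\<close> sees integers only modulo
  \<open>N n\<close>.\<close>

lemma cis_cong:
  assumes "[k = l] (mod int (N n))"
  shows "cis (2 * pi * (of_int m / real (N n)) * (t + of_int k)) = cis (2 * pi * (of_int m / real (N n)) * (t + of_int l))"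
proof -
  obtain d where d: "k = l + int (N n) * d" using assms by (metis cong_iff_lin cong_sym)
  have "2 * pi * (of_int m / real (N n)) * (t + of_int k)
      = 2 * pi * (of_int m / real (N n)) * (t + of_int l) + 2 * pi * of_int (m * d)"
    by (simp add: d field_simps)
  then show ?thesis by (simp only: cis_mult[symmetric] cis_multiple_2pi Ints_of_int mult_1_right)
qed

lemma cis_level:
  assumes "b = of_int m / real (N (Suc n))" "n \<le> j"
  shows "cis (2 * pi * b * (t - real (S x (Suc n)))) = cis (2 * pi * b * (t - real (S x (Suc j))))"
proof -
  have "[- int (S x (Suc n)) = - int (S x (Suc j))] (mod int (N (Suc n)))"
    using S_mono_cong[of "Suc n" "Suc j" x] assms(2) by (simp add: cong_minus_minus_iff cong_sym)
  from cis_cong[OF this, of m t] show ?thesis by (simp add: assms(1))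
qed

lemma chi_cls:
  assumes x: "x \<in> carrier \<Delta>" and b: "b = of_int m / real (N (Suc n))"
  shows "chi b (cls (t, x)) = cis (2 * pi * b * (t - real (S x (Suc n))))"
proof -
  have sum: "(\<Sum>k\<le>n. x k * (\<Prod>i<k. a i)) = S x (Suc n)" and prod: "(\<Prod>i\<le>n. a i) = N (Suc n)" for n x
    by (simp_all add: digit_sum_def place_def lessThan_Suc_atMost)
  show ?thesis unfolding solenoid_char_def sum prod
  proof (rule the_equality)
    show "\<exists>t' x' m' n'. (t', x') \<in> cls (t, x) \<and> b = of_int m' / real (N (Suc n')) \<and>
        cis (2 * pi * b * (t - real (S x (Suc n)))) = cis (2 * pi * b * (t' - real (S x' (Suc n'))))"
      using self_mem_cls[of "(t, x)"] x b by (intro exI[of _ t] exI[of _ x] exI[of _ m] exI[of _ n]) auto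
  next
    fix c
    assume "\<exists>t' x' m' n'. (t', x') \<in> cls (t, x) \<and> b = of_int m' / real (N (Suc n')) \<and>
        c = cis (2 * pi * b * (t' - real (S x' (Suc n'))))"
    then obtain t' x' m' n' where mem: "(t', x') \<in> cls (t, x)" and b': "b = of_int m' / real (N (Suc n'))"
      and c: "c = cis (2 * pi * b * (t' - real (S x' (Suc n'))))" by blast
    from mem obtain k :: int where t': "t' = of_int k + t" and x': "x' = adic_unit [^]\<^bsub>\<Delta>\<^esub> k \<otimes>\<^bsub>\<Delta>\<^esub> x"
      by (rule mem_cls)
    \<comment> \<open>At the common level j both fractions have the same denominator, and the
      integer k added to t cancels against the k added to the truncation.\<close>
    define j where "j = max n n'"
    have "b \<in> H" unfolding b by (rule H_intI)
    obtain d where d: "N (Suc j) = N (Suc n) * d" using N_dvd[of "Suc n" "Suc j"] by (auto simp: j_def)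
    then have "d \<noteq> 0" using N_nonzero[of "Suc j"] by (intro notI) simp
    then have bj: "b = of_int (m * int d) / real (N (Suc j))" unfolding b d by simp
    have "[int (S x' (Suc j)) = k + int (S x (Suc j))] (mod int (N (Suc j)))"
      unfolding x' by (rule cong_trans[OF S_mult_cong cong_add[OF S_unit_pow cong_refl]])
    then have "[k - int (S x' (Suc j)) = k - (k + int (S x (Suc j)))] (mod int (N (Suc j)))"
      by (rule cong_diff[OF cong_refl])
    then have "[k - int (S x' (Suc j)) = - int (S x (Suc j))] (mod int (N (Suc j)))" by simp
    from cis_cong[OF this, of "m * int d" t]
    have "cis (2 * pi * b * (t' - real (S x' (Suc j)))) = cis (2 * pi * b * (t - real (S x (Suc j))))"
      unfolding t' bj[symmetric] by (simp add: algebra_simps)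
    then show "c = cis (2 * pi * b * (t - real (S x (Suc n))))"
      using cis_level[OF b, of j t x] cis_level[OF b', of j t' x'] by (simp add: c j_def)
  qed
qed

lemma norm_chi: "b \<in> H \<Longrightarrow> g \<in> carrier \<Sigma> \<Longrightarrow> norm (chi b g) = 1"
  unfolding H_iff carrier_solenoid by (auto simp: chi_cls simp del: of_nat_Suc)

lemma chi_add: 
  assumes "b \<in> H" "c \<in> H" "g \<in> carrier \<Sigma>"
  shows "chi (b + c) g = chi b g * chi c g"
proof -
  obtain n and m k :: int where b: "b = of_int m / real (N (Suc n))" and c: "c = of_int k / real (N (Suc n))"
    using assms(1,2) by (rule H_common)
  then have bc: "b + c = of_int (m + k) / real (N (Suc n))" by (simp add: add_divide_distrib)
  obtain t x where g: "g = cls (t, x)" "x \<in> carrier \<Delta>" using assms(3) by (auto simp: carrier_solenoid)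
  show ?thesis
    unfolding g chi_cls[OF g(2) b] chi_cls[OF g(2) c] chi_cls[OF g(2) bc] cis_mult
    by (simp add: algebra_simps)
qed

lemma chi_mult:
  assumes "b \<in> H" "g \<in> carrier \<Sigma>" "h \<in> carrier \<Sigma>"
  shows "chi b (g \<otimes>\<^bsub>\<Sigma>\<^esub> h) = chi b g * chi b h"
proof -
  obtain n and m :: int where b: "b = of_int m / real (N (Suc n))" using assms(1) H_iff by blast
  obtain t x where g: "g = cls (t, x)" "x \<in> carrier \<Delta>" using assms(2) by (auto simp: carrier_solenoid)
  obtain s y where h: "h = cls (s, y)" "y \<in> carrier \<Delta>" using assms(3) by (auto simp: carrier_solenoid)
  have gh: "g \<otimes>\<^bsub>\<Sigma>\<^esub> h = cls (t + s, x \<otimes>\<^bsub>\<Delta>\<^esub> y)" using g h by (simp add: cls_mult)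
  have "[- int (S (x \<otimes>\<^bsub>\<Delta>\<^esub> y) (Suc n)) = - (int (S x (Suc n)) + int (S y (Suc n)))] (mod int (N (Suc n)))"
    using S_mult_cong by (simp only: cong_minus_minus_iff)
  from cis_cong[OF this, of m "t + s"]
  show ?thesis
    unfolding gh chi_cls[OF \<Delta>.m_closed[OF g(2) h(2)] b] unfolding g(1) h(1) chi_cls[OF g(2) b] chi_cls[OF h(2) b] cis_mult b[symmetric]
    by (simp add: algebra_simps)
qed

lemma chi_real: "b \<in> H \<Longrightarrow> chi b (cls (t, \<one>\<^bsub>\<Delta>\<^esub>)) = cis (2 * pi * b * t)"
  unfolding H_iff by (auto simp: chi_cls S_one simp del: of_nat_Suc)

lemma chi_0: "g \<in> carrier \<Sigma> \<Longrightarrow> chi 0 g = 1"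
proof -
  assume g: "g \<in> carrier \<Sigma>"
  have H0: "0 \<in> H" using H_intI[of 0 0] by simp
  show ?thesis using chi_add[OF H0 H0 g] norm_chi[OF H0 g] by auto
qed

lemma chi_one: "b \<in> H \<Longrightarrow> chi b \<one>\<^bsub>\<Sigma>\<^esub> = 1"
  using chi_mult[of b "\<one>\<^bsub>\<Sigma>\<^esub>" "\<one>\<^bsub>\<Sigma>\<^esub>"] norm_chi[of b "\<one>\<^bsub>\<Sigma>\<^esub>"] by auto

lemma chi_uminus: "b \<in> H \<Longrightarrow> g \<in> carrier \<Sigma> \<Longrightarrow> chi (- b) g = cnj (chi b g)"
  by (rule eq_cnjI) (simp_all add: chi_add[symmetric] H_uminus chi_0 norm_chi)

lemma chi_inv: "b \<in> H \<Longrightarrow> g \<in> carrier \<Sigma> \<Longrightarrow> chi b (inv\<^bsub>\<Sigma>\<^esub> g) = cnj (chi b g)"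
  by (rule eq_cnjI) (simp_all add: chi_mult[symmetric] chi_one norm_chi)

lemma chi_nat_pow: "b \<in> H \<Longrightarrow> g \<in> carrier \<Sigma> \<Longrightarrow> chi b (g [^]\<^bsub>\<Sigma>\<^esub> (n::nat)) = chi (of_nat n * b) g"
proof (induction n)
  case (Suc n)
  have "of_nat n * b \<in> H" using of_int_H_mult[OF Suc(2), of "int n"] by simp
  then show ?case using Suc by (simp add: chi_mult chi_add algebra_simps)
qed (simp add: chi_0 chi_one)

lemma chi_int_pow: 
  assumes "b \<in> H" "g \<in> carrier \<Sigma>"
  shows "chi b (g [^]\<^bsub>\<Sigma>\<^esub> (k::int)) = chi (of_int k * b) g"
proof (cases k rule: int_cases2)
  case (nonneg n)
  then show ?thesis using chi_nat_pow[OF assms] by (simp add: int_pow_int)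
next
  case (nonpos n)
  have "of_nat n * b \<in> H" using of_int_H_mult[OF assms(1), of "int n"] by simp
  then show ?thesis
    using nonpos assms by (simp add: \<Sigma>.int_pow_neg_int chi_inv chi_nat_pow chi_uminus)
qed

text \<open>The hypothesis at n says that t differs from the truncation of x by a multiple of
  \<open>N (Suc n)\<close>. So t is an integer congruent to every truncation, and (t, x) lies in the
  subgroup that is factored out.\<close>

lemma chi_eq_1_imp_one:
  assumes g: "g \<in> carrier \<Sigma>" and chi: "\<And>n. chi (1 / real (N (Suc n))) g = 1"
  shows "g = \<one>\<^bsub>\<Sigma>\<^esub>"
proof -
  obtain t x where g': "g = cls (t, x)" "x \<in> carrier \<Delta>" using g by (auto simp: carrier_solenoid)
  have "\<exists>k::int. t - real (S x (Suc n)) = of_int k * real (N (Suc n))" for n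
  proof -
    have "cis (2 * pi * (1 / real (N (Suc n))) * (t - real (S x (Suc n)))) = 1"
      using chi[of n] chi_cls[OF g'(2), of "1 / real (N (Suc n))" 1 n t] by (simp add: g')
    then obtain k :: int where "2 * pi * (1 / real (N (Suc n))) * (t - real (S x (Suc n))) = of_int k * (2 * pi)"
      by (auto simp: cis_eq_1_iff_int)
    then have "2 * pi * ((1 / real (N (Suc n))) * (t - real (S x (Suc n)))) = 2 * pi * of_int k"
      by (simp only: mult_ac)
    then have "(1 / real (N (Suc n))) * (t - real (S x (Suc n))) = of_int k"
      by (rule mult_left_cancel[THEN iffD1, rotated]) simp
    then have "t - real (S x (Suc n)) = of_int k * real (N (Suc n))" by (simp add: field_simps)
    then show ?thesis by blast
  qed
  then obtain k :: "nat \<Rightarrow> int" where k: "\<And>n. t - real (S x (Suc n)) = of_int (k n) * real (N (Suc n))" by metis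
  define T where "T = int (S x (Suc 0)) + k 0 * int (N (Suc 0))"
  have T: "t = of_int T" using k[of 0] by (simp add: T_def)
  have "[int (S x n) = T] (mod int (N n))" for n
  proof (cases n)
    case (Suc j)
    have "real_of_int (T - int (S x (Suc j))) = real_of_int (k j * int (N (Suc j)))"
      using k[of j] T by simp
    then have "T - int (S x (Suc j)) = k j * int (N (Suc j))" by (simp only: of_int_eq_iff)
    then show ?thesis unfolding Suc by (metis cong_iff_dvd_diff cong_sym dvd_triv_right)
  qed simp
  then have "x = adic_unit [^]\<^bsub>\<Delta>\<^esub> T" by (rule unit_pow_eqI[OF g'(2)])
  then show ?thesis using cls_rel[OF solenoid_relI[of T]] by (simp add: g' T)
qed

lemma chi_separates:
  assumes "g \<in> carrier \<Sigma>" "h \<in> carrier \<Sigma>" "\<And>n. chi (1 / real (N (Suc n))) g = chi (1 / real (N (Suc n))) h"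
  shows "g = h"
proof -
  have "g \<otimes>\<^bsub>\<Sigma>\<^esub> inv\<^bsub>\<Sigma>\<^esub> h = \<one>\<^bsub>\<Sigma>\<^esub>"
  proof (rule chi_eq_1_imp_one)
    fix n
    have n: "1 / real (N (Suc n)) \<in> H" using H_intI[of 1 n] by simp
    show "chi (1 / real (N (Suc n))) (g \<otimes>\<^bsub>\<Sigma>\<^esub> inv\<^bsub>\<Sigma>\<^esub> h) = 1"
      using assms cnj_mult_self[OF norm_chi[OF n assms(2)]]
      by (simp add: chi_mult[OF n] chi_inv[OF n] mult.commute)
  qed (use assms in auto)
  then show ?thesis using assms by (metis \<Sigma>.inv_closed \<Sigma>.inv_equality \<Sigma>.inv_inv)
qed

text \<open>The solenoid is the inverse limit of circles under the maps \<open>z \<mapsto> z ^ a n\<close>; this lifts a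
  compatible sequence of angles.\<close>

lemma chi_realize:
  fixes \<theta> :: "nat \<Rightarrow> real"
  assumes \<theta>: "\<And>n. real (a (Suc n)) * \<theta> (Suc n) - \<theta> n \<in> \<int>"
  obtains g where "g \<in> carrier \<Sigma>" "\<And>n. chi (1 / real (N (Suc n))) g = cis (2 * pi * \<theta> n)"
proof -
  define t where "t = real (N (Suc 0)) * \<theta> 0"
  \<comment> \<open>The shifted index attaches \<open>R n\<close> to the modulus \<open>N n\<close>;
    the default at n = 0, where \<open>N 0 = 1\<close>, makes \<open>R 0 = 0\<close>.\<close>
  have "\<exists>R::int. t - real (N n) * (if n = 0 then t else \<theta> (n - 1)) = of_int R" for n
  proof (induction n)
    case (Suc n)
    show ?case
    proof (cases n)
      case 0
      then show ?thesis by (intro exI[of _ 0]) (simp add: t_def)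
    next
      case (Suc j)
      obtain R :: int where R: "t - real (N (Suc j)) * \<theta> j = of_int R" using Suc.IH Suc by auto
      obtain d :: int where d: "real (a (Suc j)) * \<theta> (Suc j) - \<theta> j = of_int d" using \<theta>[of j] by (auto elim: Ints_cases)
      have "real (N (Suc (Suc j))) * \<theta> (Suc j) = real (N (Suc j)) * (real (a (Suc j)) * \<theta> (Suc j))"
        by (simp only: place_Suc[of a "Suc j"] of_nat_mult mult.assoc)
      also have "real (a (Suc j)) * \<theta> (Suc j) = \<theta> j + of_int d" using d by simp
      finally have "t - real (N (Suc (Suc j))) * \<theta> (Suc j) = of_int (R - int (N (Suc j)) * d)"
        using R by (simp add: distrib_left)
      then show ?thesis unfolding Suc by (intro exI[of _ "R - int (N (Suc j)) * d"]) simp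
    qed
  qed simp
  then obtain R :: "nat \<Rightarrow> int" where R: "\<And>n. t - real (N n) * (if n = 0 then t else \<theta> (n - 1)) = of_int (R n)" by metis
  have R': "t - real (N (Suc n)) * \<theta> n = of_int (R (Suc n))" for n using R[of "Suc n"] by simp
  have "int (N n) dvd R (Suc n) - R n" for n
  proof (cases n)
    case (Suc j)
    obtain d :: int where d: "real (a (Suc j)) * \<theta> (Suc j) - \<theta> j = of_int d" using \<theta>[of j] by (auto elim: Ints_cases)
    have "real (N (Suc (Suc j))) * \<theta> (Suc j) = real (N (Suc j)) * (real (a (Suc j)) * \<theta> (Suc j))"
      by (simp only: place_Suc[of a "Suc j"] of_nat_mult mult.assoc)
    also have "real (a (Suc j)) * \<theta> (Suc j) = \<theta> j + of_int d" using d by simp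
    finally have "real_of_int (R (Suc (Suc j)) - R (Suc j)) = real_of_int (- (int (N (Suc j)) * d))"
      unfolding of_int_diff R'[symmetric] by (simp add: distrib_left)
    then have "R (Suc (Suc j)) - R (Suc j) = - (int (N (Suc j)) * d)" by (simp only: of_int_eq_iff)
    then show ?thesis unfolding Suc by simp
  qed simp
  from S_surj[OF this] obtain x where x: "x \<in> carrier \<Delta>" "\<And>n. [int (S x n) = R n] (mod int (N n))" by blast
  have "chi (1 / real (N (Suc n))) (cls (t, x)) = cis (2 * pi * \<theta> n)" for n
  proof -
    have "[- int (S x (Suc n)) = - R (Suc n)] (mod int (N (Suc n)))"
      using x(2) by (simp only: cong_minus_minus_iff)
    from cis_cong[OF this, of 1 t]
    have "chi (1 / real (N (Suc n))) (cls (t, x)) = cis (2 * pi * (1 / real (N (Suc n))) * (t - of_int (R (Suc n))))"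
      using chi_cls[OF x(1), of "1 / real (N (Suc n))" 1 n t] by simp
    also have "t - of_int (R (Suc n)) = real (N (Suc n)) * \<theta> n" using R'[of n] by simp
    finally show ?thesis by (simp add: mult.assoc)
  qed
  moreover have "cls (t, x) \<in> carrier \<Sigma>" using x(1) by (simp add: carrier_solenoid)
  ultimately show thesis using that by blast
qed

end

section \<open>Topology and Borel sets\<close>

lemma space_borel_of [simp]: "space (borel_of T) = topspace T"
  by (simp add: borel_of_def space_measure_of_conv)

lemma sets_borel_of: "sets (borel_of T) = sigma_sets (topspace T) {U. openin T U}"
  unfolding borel_of_def by (rule sets_measure_of) (auto dest: openin_subset)

lemma openin_imp_sets_borel_of: "openin T U \<Longrightarrow> U \<in> sets (borel_of T)"
  by (simp add: sets_borel_of sigma_sets.Basic)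

lemma closedin_imp_sets_borel_of: "closedin T U \<Longrightarrow> U \<in> sets (borel_of T)"
proof -
  assume "closedin T U"
  then have eq: "topspace T - (topspace T - U) = U" and "openin T (topspace T - U)"
    by (auto simp: closedin_def)
  then have "space (borel_of T) - (topspace T - U) \<in> sets (borel_of T)"
    by (intro sets.compl_sets openin_imp_sets_borel_of)
  then show ?thesis by (simp only: space_borel_of eq)
qed

lemma measurable_borel_ofI:
  assumes "\<And>U. openin T U \<Longrightarrow> f -` U \<inter> space M \<in> sets M" "f \<in> space M \<rightarrow> topspace T"
  shows "f \<in> measurable M (borel_of T)"
  unfolding borel_of_def
  by (rule measurable_measure_of) (use assms in \<open>auto dest: openin_subset\<close>)

lemma continuous_map_imp_measurable_borel_of:
  assumes "continuous_map T euclidean f"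
  shows "f \<in> borel_measurable (borel_of T)"
proof (rule borel_measurableI)
  fix U :: "'b set" assume "open U"
  then have "openin T {x \<in> topspace T. f x \<in> U}"
    using assms by (simp add: continuous_map)
  moreover have "{x \<in> topspace T. f x \<in> U} = f -` U \<inter> space (borel_of T)" by auto
  ultimately show "f -` U \<inter> space (borel_of T) \<in> sets (borel_of T)"
    using openin_imp_sets_borel_of by metis
qed

context adic begin

lemma topspace_adic: "topspace (adic_top a) = carrier \<Delta>"
  by (auto simp: adic_top_def mem_carrier PiE_iff)

lemma quotient_map_cls: "quotient_map (prod_topology euclideanreal (adic_top a)) (solenoid_top a) cls"
proof -
  have "cls = (\<lambda>x. solenoid_rel a #>\<^bsub>\<Gamma>\<^esub> x)" by (rule ext) (rule cls_def)
  then show ?thesis unfolding solenoid_top_def by (metis quotient_map_quotient_topology)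
qed

lemma topspace_solenoid: "topspace (solenoid_top a) = carrier \<Sigma>"
  using quotient_imp_surjective_map[OF quotient_map_cls]
  by (simp add: topspace_adic carrier_solenoid)

lemma continuous_map_digit_sum: "continuous_map (adic_top a) euclideanreal (\<lambda>x. real (S x n))"
proof -
  have "continuous_map (adic_top a) euclideanreal (\<lambda>x. real (x k))" for k
  proof -
    have "continuous_map (adic_top a) (discrete_topology {..<a k}) (\<lambda>x. x k)"
      unfolding adic_top_def by (rule continuous_map_product_projection) simp
    from continuous_map_compose[OF this, of euclideanreal real] show ?thesis by (simp add: o_def)
  qed
  then show ?thesis
    unfolding digit_sum_def of_nat_sum of_nat_mult
    by (intro continuous_map_sum continuous_map_real_mult continuous_map_const[THEN iffD2]) auto
qed

lemma continuous_map_chi: 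
  assumes b: "b \<in> H"
  shows "continuous_map (solenoid_top a) euclidean (chi b)"
proof -
  obtain n and m :: int where b: "b = of_int m / real (N (Suc n))" using b H_iff by blast
  let ?T = "prod_topology euclideanreal (adic_top a)"
  have "continuous_map ?T euclideanreal (real \<circ> (\<lambda>x. S x (Suc n)) \<circ> snd)"
    by (rule continuous_map_compose[OF continuous_map_snd]) (use continuous_map_digit_sum in \<open>simp add: o_def\<close>)
  then have "continuous_map ?T euclideanreal (\<lambda>p. 2 * pi * b * (fst p - real (S (snd p) (Suc n))))"
    by (intro continuous_map_real_mult continuous_map_diff continuous_map_fst continuous_map_const[THEN iffD2])
      (auto simp: o_def)
  moreover have "continuous_map euclideanreal euclidean cis"
    by (simp add: continuous_map_iff_continuous2 continuous_on_cis)
  ultimately have "continuous_map ?T euclidean (cis \<circ> (\<lambda>p. 2 * pi * b * (fst p - real (S (snd p) (Suc n)))))"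
    by (rule continuous_map_compose)
  then have "continuous_map ?T euclidean (chi b \<circ> cls)"
    by (rule continuous_map_eq) (auto simp: topspace_adic chi_cls[OF _ b])
  then show ?thesis by (simp only: continuous_compose_quotient_map_eq[OF quotient_map_cls])
qed

text \<open>Removing the integer part of t along the subgroup leaves a representative with t in the
  unit interval, and the digit space is compact.\<close>

lemma compact_solenoid: "compact_space (solenoid_top a)"
proof -
  let ?T = "prod_topology euclideanreal (adic_top a)"
  have "compact_space (adic_top a)"
    unfolding adic_top_def by (rule compact_space_product_topology[THEN iffD2]) (simp add: compact_space_discrete_topology)
  then have "compactin ?T ({0..1} \<times> topspace (adic_top a))"
    by (simp add: compactin_Times compact_space_def compactin_euclidean_iff)
  then have "compactin (solenoid_top a) (cls ` ({0..1} \<times> topspace (adic_top a)))"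
    by (rule image_compactin[OF _ quotient_imp_continuous_map[OF quotient_map_cls]])
  moreover have "cls ` ({0..1} \<times> topspace (adic_top a)) = carrier \<Sigma>"
  proof
    show "carrier \<Sigma> \<subseteq> cls ` ({0..1} \<times> topspace (adic_top a))"
    proof
      fix g assume "g \<in> carrier \<Sigma>"
      then obtain t x where g: "g = cls (t, x)" "x \<in> carrier \<Delta>" by (auto simp: carrier_solenoid)
      define k where "k = - \<lfloor>t\<rfloor>"
      let ?r = "(real_of_int k, adic_unit [^]\<^bsub>\<Delta>\<^esub> k)"
      have "g = cls ?r \<otimes>\<^bsub>\<Sigma>\<^esub> cls (t, x)"
        using g cls_rel[OF solenoid_relI[of k]] by (simp add: carrier_solenoid)
      also have "\<dots> = cls (of_int k + t, adic_unit [^]\<^bsub>\<Delta>\<^esub> k \<otimes>\<^bsub>\<Delta>\<^esub> x)"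
        using g(2) unit_closed by (subst cls_mult) auto
      finally have "g = cls (of_int k + t, adic_unit [^]\<^bsub>\<Delta>\<^esub> k \<otimes>\<^bsub>\<Delta>\<^esub> x)" .
      moreover have "of_int k + t \<in> {0..1}" unfolding k_def using floor_correct[of t] by simp linarith
      ultimately show "g \<in> cls ` ({0..1} \<times> topspace (adic_top a))"
        using g(2) unit_closed by (auto simp: topspace_adic intro!: image_eqI)
    qed
  qed (auto simp: carrier_solenoid topspace_adic)
  ultimately show ?thesis by (simp add: compact_space_def topspace_solenoid)
qed

section \<open>The compact group X and measurability of maps into it\<close>

abbreviation "X \<equiv> X_group a"
abbreviation "XT \<equiv> X_top a"

lemma topspace_X: "topspace XT = carrier X"
  by (simp add: X_top_def X_group_def topspace_solenoid circle_top_def circle_group_def)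

lemma carrier_X: "carrier X = carrier \<Sigma> \<times> sphere 0 1"
  by (simp add: X_group_def circle_group_def)

lemma compact_X: "compact_space XT"
  unfolding X_top_def circle_top_def
  by (simp add: compact_space_prod_topology compact_solenoid compact_space_subtopology compactin_euclidean_iff)

lemma continuous_map_chi_fst: "b \<in> H \<Longrightarrow> continuous_map XT euclidean (\<lambda>x. chi b (fst x))"
  unfolding X_top_def using continuous_map_compose[OF continuous_map_fst continuous_map_chi]
  by (simp add: o_def)

lemma continuous_map_snd_X: "continuous_map XT euclidean snd"
proof -
  have "continuous_map circle_top euclidean id"
    by (simp add: circle_top_def continuous_map_from_subtopology)
  then show ?thesis
    unfolding X_top_def using continuous_map_compose[OF continuous_map_snd, of circle_top euclidean id] by simp
qed

text \<open>Countably many characters that separate the points of X and embed it into a countable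
  product, whose Borel sets are tested coordinate by coordinate.\<close>

definition coord :: "X_elt \<Rightarrow> nat \<Rightarrow> complex" where
  "coord x n = (case n of 0 \<Rightarrow> snd x | Suc j \<Rightarrow> chi (1 / real (N (Suc j))) (fst x))"

lemma inv_N_H: "1 / real (N (Suc n)) \<in> H"
  using H_intI[of 1 n] by simp

lemma coord_inj:
  assumes "x \<in> carrier X" "y \<in> carrier X" "coord x = coord y"
  shows "x = y"
proof -
  have "snd x = snd y" using fun_cong[OF assms(3), of 0] by (simp add: coord_def)
  moreover have "fst x = fst y"
  proof (rule chi_separates)
    show "chi (1 / real (N (Suc n))) (fst x) = chi (1 / real (N (Suc n))) (fst y)" for n
      using fun_cong[OF assms(3), of "Suc n"] by (simp add: coord_def)
  qed (use assms in \<open>auto simp: carrier_X\<close>)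
  ultimately show ?thesis by (rule prod_eqI[rotated])
qed

lemma continuous_map_coord: "continuous_map XT euclidean coord"
proof -
  have "continuous_map XT euclidean (\<lambda>x. coord x n)" for n
    by (cases n) (simp_all add: coord_def continuous_map_snd_X continuous_map_chi_fst[OF inv_N_H] del: of_nat_Suc)
  then show ?thesis
    by (simp add: continuous_map_componentwise_UNIV flip: euclidean_product_topology)
qed

text \<open>\<open>coord\<close> is injective, continuous and, by compactness, closed, so every open
  set of X is the preimage of an open set of the product. In particular multiplication becomes
  measurable for the product of the Borel algebras, where continuity alone would speak of the Borel
  sets of the product topology.\<close>

lemma measurable_XI:
  assumes f: "\<And>\<omega>. \<omega> \<in> space P \<Longrightarrow> f \<omega> \<in> carrier X"
    and snd: "(\<lambda>\<omega>. snd (f \<omega>)) \<in> borel_measurable P"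
    and fst: "\<And>n. (\<lambda>\<omega>. chi (1 / real (N (Suc n))) (fst (f \<omega>))) \<in> borel_measurable P"
  shows "f \<in> measurable P (borel_of XT)"
proof (rule measurable_borel_ofI)
  have "(\<lambda>\<omega>. coord (f \<omega>) n) \<in> borel_measurable P" for n
    by (cases n) (use snd fst in \<open>simp_all add: coord_def del: of_nat_Suc\<close>)
  then have meas: "(\<lambda>\<omega>. coord (f \<omega>)) \<in> borel_measurable P"
    by (rule measurable_coordinatewise_then_product)
  fix U assume U: "openin XT U"
  let ?K = "coord ` (topspace XT - U)"
  have "closed_map XT euclidean coord"
    by (rule T1_Spaces.continuous_imp_closed_map[OF continuous_map_coord compact_X Hausdorff_space_euclidean])
  moreover have "closedin XT (topspace XT - U)" using U by (intro closedin_diff closedin_topspace)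
  ultimately have "closed ?K" unfolding closed_map_def closed_closedin by blast
  then have "(\<lambda>\<omega>. coord (f \<omega>)) -` (- ?K) \<inter> space P \<in> sets P"
    by (intro measurable_sets[OF meas]) auto
  moreover have "(\<lambda>\<omega>. coord (f \<omega>)) -` (- ?K) \<inter> space P = f -` U \<inter> space P"
    using f coord_inj openin_subset[OF U] by (auto simp: topspace_X image_iff) blast
  ultimately show "f -` U \<inter> space P \<in> sets P" by simp
qed (use f in \<open>auto simp: topspace_X\<close>)

lemma closedin_singleton_X: "x \<in> carrier X \<Longrightarrow> closedin XT {x}"
proof -
  assume x: "x \<in> carrier X"
  have "closedin XT {y \<in> topspace XT. coord y \<in> {coord x}}"
    by (rule closedin_continuous_map_preimage[OF continuous_map_coord]) simp
  moreover have "{y \<in> topspace XT. coord y \<in> {coord x}} = {x}"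
    using x coord_inj[OF _ x] unfolding topspace_X by blast
  ultimately show ?thesis by simp
qed

section \<open>Divisibility and torsion\<close>

lemma chi_power: "b \<in> H \<Longrightarrow> g \<in> carrier \<Sigma> \<Longrightarrow> chi b (g [^]\<^bsub>\<Sigma>\<^esub> (n::nat)) = chi b g ^ n"
  by (induction n) (auto simp: chi_one chi_mult)

lemma chi_powi: 
  assumes "b \<in> H" "g \<in> carrier \<Sigma>"
  shows "chi b g powi k = chi (of_int k * b) g"
proof (cases k rule: int_cases2)
  case (nonneg n)
  then show ?thesis using chi_power[OF assms] chi_nat_pow[OF assms] by simp
next
  case (nonpos n)
  have "of_nat n * b \<in> H" using of_int_H_mult[OF assms(1), of "int n"] by simp
  then have "chi (of_int k * b) g = cnj (chi b g ^ n)"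
    using nonpos assms chi_uminus chi_power[OF assms] chi_nat_pow[OF assms] by simp
  moreover have "inverse (chi b g) = cnj (chi b g)"
    using cnj_mult_self[OF norm_chi[OF assms]] by (metis inverse_unique mult.commute)
  ultimately show ?thesis using nonpos by (simp add: power_int_minus flip: power_inverse)
qed

text \<open>If b / l is not in H, then l divides no \<open>a i\<close> beyond the level n0 of b, so
  these factors are invertible modulo l. Residues \<open>c n\<close> compatible modulo l and equal
  to 1 at n0 can then be chosen, and the angles \<open>c n\<close> / l define an element of order
  l.\<close>

lemma prime_torsion_free_imp_divisible:
  assumes l: "prime l" and tf: "\<And>g. g \<in> carrier \<Sigma> \<Longrightarrow> g [^]\<^bsub>\<Sigma>\<^esub> (l::nat) = \<one>\<^bsub>\<Sigma>\<^esub> \<Longrightarrow> g = \<one>\<^bsub>\<Sigma>\<^esub>"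
    and b: "b \<in> H"
  shows "b / real l \<in> H"
proof (rule ccontr)
  assume nH: "b / real l \<notin> H"
  have l2: "l \<ge> 2" using l by (rule prime_ge_2_nat)
  obtain m :: int and n0 where b': "b = of_int m / real (N (Suc n0))" using b H_iff by blast
  have ndvd: "\<not> l dvd a i" if i: "i > n0" for i
  proof
    assume "l dvd a i"
    then obtain e where e: "a i = l * e" by (elim dvdE)
    have "Suc n0 \<le> i" using i by simp
    from N_dvd[OF this] obtain d where d: "N i = N (Suc n0) * d" by (elim dvdE)
    have Ni: "N (Suc i) = N (Suc n0) * d * (l * e)" by (simp only: place_Suc[of a i] d e)
    then have "d \<noteq> 0" "e \<noteq> 0" using N_nonzero[of "Suc i"] by (metis mult_0 mult_0_right)+
    then have "b / real l = of_int (m * int d * int e) / real (N (Suc i))"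
      unfolding b' Ni by simp
    then show False using nH H_intI by metis
  qed
  \<comment> \<open>Below n0 the recursion is solved by multiplication; above n0 by inverses modulo
    l, which are powers with exponent l - 2 by Fermat.\<close>
  define c where "c n = (\<Prod>i\<in>{n<..n0}. a i) * (\<Prod>i\<in>{n0<..n}. a i ^ (l - 2))" for n
  have c0: "c n0 = 1" by (simp add: c_def)
  have c: "[a (Suc n) * c (Suc n) = c n] (mod l)" for n
  proof (cases "n < n0")
    case True
    then have "{n<..n0} = insert (Suc n) {Suc n<..n0}" "{n0<..n} = {}" "{n0<..Suc n} = {}" by auto
    then show ?thesis by (simp add: c_def)
  next
    case False
    then have s: "{n<..n0} = {}" "{Suc n<..n0} = {}" "{n0<..Suc n} = insert (Suc n) {n0<..n}" by auto
    have "a (Suc n) * a (Suc n) ^ (l - 2) = a (Suc n) ^ (l - 1)"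
      using l2 by (metis Suc_diff_le diff_Suc_Suc numeral_2_eq_2 One_nat_def power_Suc)
    then have "a (Suc n) * c (Suc n) = a (Suc n) ^ (l - 1) * c n"
      by (simp add: c_def s mult.assoc[symmetric])
    moreover have "[a (Suc n) ^ (l - 1) * c n = 1 * c n] (mod l)"
      using False by (intro cong_mult fermat_theorem[OF l] ndvd cong_refl) simp
    ultimately show ?thesis by simp
  qed
  obtain g where g: "g \<in> carrier \<Sigma>" "\<And>n. chi (1 / real (N (Suc n))) g = cis (2 * pi * (real (c n) / real l))"
  proof (rule chi_realize)
    fix n
    have "[int (a (Suc n) * c (Suc n)) = int (c n)] (mod int l)" using c[of n] by (simp only: cong_int_iff)
    then obtain d where "int (a (Suc n) * c (Suc n)) = int (c n) + int l * d" by (metis cong_iff_lin cong_sym)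
    then have "real_of_int (int (a (Suc n) * c (Suc n))) = real_of_int (int (c n) + int l * d)" by (simp only:)
    then have "real (a (Suc n)) * real (c (Suc n)) = real (c n) + real l * of_int d" by simp
    then have "real (a (Suc n)) * (real (c (Suc n)) / real l) - real (c n) / real l = of_int d"
      using l2 by (simp add: field_simps)
    then show "real (a (Suc n)) * (real (c (Suc n)) / real l) - real (c n) / real l \<in> \<int>"
      by (metis Ints_of_int)
  qed (rule that)
  have "g [^]\<^bsub>\<Sigma>\<^esub> l = \<one>\<^bsub>\<Sigma>\<^esub>"
  proof (rule chi_eq_1_imp_one)
    fix n
    have "chi (1 / real (N (Suc n))) (g [^]\<^bsub>\<Sigma>\<^esub> l) = cis (2 * pi * (real (c n) / real l)) ^ l"
      by (simp only: chi_power[OF inv_N_H g(1)] g(2))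
    also have "\<dots> = cis (real l * (2 * pi * (real (c n) / real l)))" by (rule Complex.DeMoivre)
    also have "real l * (2 * pi * (real (c n) / real l)) = 2 * pi * real (c n)" using l2 by simp
    finally show "chi (1 / real (N (Suc n))) (g [^]\<^bsub>\<Sigma>\<^esub> l) = 1" by (simp only: cis_multiple_2pi Ints_of_nat)
  qed (use g in simp)
  then have "g = \<one>\<^bsub>\<Sigma>\<^esub>" using tf g(1) by blast
  then have "cis (2 * pi * (1 / real l)) = 1"
    using g(2)[of n0] c0 chi_one[OF inv_N_H, of n0] by simp
  then obtain k :: int where "2 * pi * (1 / real l) = of_int k * (2 * pi)" unfolding cis_eq_1_iff_int ..
  then have "2 * pi * (1 / real l) = 2 * pi * of_int k" by (simp only: mult.commute)
  then have "1 / real l = of_int k" by (rule mult_left_cancel[THEN iffD1, rotated]) simp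
  then have "of_int 1 = real_of_int (k * int l)" using l2 by (simp add: field_simps)
  then have "1 = k * int l" by (simp only: of_int_eq_iff)
  then have "int l dvd 1" by (metis dvd_triv_right)
  then show False using l2 by simp
qed

lemma torsion_free_imp_divisible:
  assumes "n > 0" and "\<And>g. g \<in> carrier \<Sigma> \<Longrightarrow> g [^]\<^bsub>\<Sigma>\<^esub> (n::nat) = \<one>\<^bsub>\<Sigma>\<^esub> \<Longrightarrow> g = \<one>\<^bsub>\<Sigma>\<^esub>" and "b \<in> H"
  shows "b / real n \<in> H"
  using assms
proof (induction n arbitrary: b rule: less_induct)
  case (less n)
  show ?case
  proof (cases "n = 1")
    case False
    then obtain l where l: "prime l" "l dvd n" by (metis prime_factor_nat)
    then obtain k where k: "n = l * k" by (elim dvdE)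
    have "k > 0" "k < n" using less.prems(1) k prime_gt_1_nat[OF l(1)] by auto
    have "g = \<one>\<^bsub>\<Sigma>\<^esub>" if "g \<in> carrier \<Sigma>" "g [^]\<^bsub>\<Sigma>\<^esub> l = \<one>\<^bsub>\<Sigma>\<^esub>" for g
      by (rule less.prems(2)) (use that in \<open>auto simp: k \<Sigma>.nat_pow_pow[symmetric]\<close>)
    then have "b / real l \<in> H" using prime_torsion_free_imp_divisible[OF l(1)] less.prems(3) by blast
    moreover have "g = \<one>\<^bsub>\<Sigma>\<^esub>" if "g \<in> carrier \<Sigma>" "g [^]\<^bsub>\<Sigma>\<^esub> k = \<one>\<^bsub>\<Sigma>\<^esub>" for g
      by (rule less.prems(2)) (use that in \<open>auto simp: k mult.commute[of l] \<Sigma>.nat_pow_pow[symmetric]\<close>)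
    ultimately have "b / real l / real k \<in> H"
      using less.IH[OF \<open>k < n\<close> \<open>k > 0\<close>] by blast
    then show ?thesis by (simp add: k)
  qed (use less.prems in simp)
qed

lemma torsion_free_imp_divisible_int:
  assumes "k \<noteq> 0" and "\<And>g. g \<in> carrier \<Sigma> \<Longrightarrow> g [^]\<^bsub>\<Sigma>\<^esub> (k::int) = \<one>\<^bsub>\<Sigma>\<^esub> \<Longrightarrow> g = \<one>\<^bsub>\<Sigma>\<^esub>" and "b \<in> H"
  shows "b / of_int k \<in> H"
proof -
  have *: "b / real (nat \<bar>k\<bar>) \<in> H"
  proof (rule torsion_free_imp_divisible)
    fix g assume g: "g \<in> carrier \<Sigma>" "g [^]\<^bsub>\<Sigma>\<^esub> nat \<bar>k\<bar> = \<one>\<^bsub>\<Sigma>\<^esub>"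
    have "g [^]\<^bsub>\<Sigma>\<^esub> k = \<one>\<^bsub>\<Sigma>\<^esub>"
    proof (cases "k \<ge> 0")
      case True
      then show ?thesis using g(2) int_pow_int[of \<Sigma> g "nat \<bar>k\<bar>"] by simp
    next
      case False
      then show ?thesis using g \<Sigma>.int_pow_neg_int[OF g(1), of "nat \<bar>k\<bar>"] by simp
    qed
    then show "g = \<one>\<^bsub>\<Sigma>\<^esub>" using assms(2) g(1) by blast
  qed (use assms in auto)
  show ?thesis
  proof (cases "k \<ge> 0")
    case False
    then show ?thesis using H_uminus[OF *] by simp
  qed (use * in simp)
qed

section \<open>The group structure of X and its pairing with the dual group\<close>

lemma comm_group_circle: "comm_group circle_group"
proof (rule comm_groupI)
  fix z assume "z \<in> carrier circle_group"
  then have "cnj z \<in> carrier circle_group" "cnj z * z = 1" by (auto simp: circle_group_def cnj_mult_self)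
  then show "\<exists>w\<in>carrier circle_group. w \<otimes>\<^bsub>circle_group\<^esub> z = \<one>\<^bsub>circle_group\<^esub>"
    by (auto simp: circle_group_def)
qed (auto simp: circle_group_def norm_mult)

sublocale X: comm_group X
proof -
  interpret C: comm_group circle_group by (rule comm_group_circle)
  interpret group X unfolding X_group_def by (rule DirProd_group[OF \<Sigma>.is_group C.is_group])
  show "comm_group X"
    by (rule group_comm_groupI) (auto simp: X_group_def \<Sigma>.m_comm C.m_comm)
qed

lemma mult_X: "x \<otimes>\<^bsub>X\<^esub> y = (fst x \<otimes>\<^bsub>\<Sigma>\<^esub> fst y, snd x * snd y)"
  by (simp add: X_group_def mult_DirProd' circle_group_def)

lemma one_X: "\<one>\<^bsub>X\<^esub> = (\<one>\<^bsub>\<Sigma>\<^esub>, 1)"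
  by (simp add: X_group_def circle_group_def)

definition pair :: "real \<times> int \<Rightarrow> X_elt \<Rightarrow> complex" where
  "pair u x = chi (fst u) (fst x) * snd x powi snd u"

abbreviation "Y \<equiv> H \<times> (UNIV :: int set)"

lemma norm_pair: "u \<in> Y \<Longrightarrow> x \<in> carrier X \<Longrightarrow> norm (pair u x) = 1"
  by (auto simp: pair_def carrier_X norm_mult norm_chi norm_power_int)

lemma pair_add: "u \<in> Y \<Longrightarrow> v \<in> Y \<Longrightarrow> x \<in> carrier X \<Longrightarrow> pair (u + v) x = pair u x * pair v x"
  by (subgoal_tac "snd x \<noteq> 0") (auto simp: pair_def carrier_X chi_add power_int_add)

lemma pair_mult: "u \<in> Y \<Longrightarrow> x \<in> carrier X \<Longrightarrow> y \<in> carrier X \<Longrightarrow> pair u (x \<otimes>\<^bsub>X\<^esub> y) = pair u x * pair u y"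
  by (auto simp: pair_def mult_X carrier_X chi_mult power_int_mult_distrib)

lemma pair_0: "x \<in> carrier X \<Longrightarrow> pair 0 x = 1"
  by (auto simp: pair_def carrier_X chi_0)

lemma pair_one: "u \<in> Y \<Longrightarrow> pair u \<one>\<^bsub>X\<^esub> = 1"
  by (auto simp: pair_def one_X chi_one)

lemma pair_uminus: "u \<in> Y \<Longrightarrow> x \<in> carrier X \<Longrightarrow> pair (- u) x = cnj (pair u x)"
proof (rule eq_cnjI)
  assume u: "u \<in> Y" and x: "x \<in> carrier X"
  have "- u \<in> Y" using u H_uminus by auto
  from pair_add[OF this u x] show "pair (- u) x * pair u x = 1" using pair_0[OF x] by simp
qed (rule norm_pair)

lemma pair_inv: "u \<in> Y \<Longrightarrow> x \<in> carrier X \<Longrightarrow> pair u (inv\<^bsub>X\<^esub> x) = cnj (pair u x)"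
proof (rule eq_cnjI)
  assume u: "u \<in> Y" and x: "x \<in> carrier X"
  show "pair u (inv\<^bsub>X\<^esub> x) * pair u x = 1"
    using pair_mult[OF u X.inv_closed[OF x] x] pair_one[OF u] x by simp
qed (rule norm_pair)

lemma continuous_map_pair: "u \<in> Y \<Longrightarrow> continuous_map XT euclidean (pair u)"
proof -
  assume u: "u \<in> Y"
  have "continuous_on (sphere 0 1) (\<lambda>z::complex. z powi snd u)"
    by (intro continuous_intros) auto
  then have "continuous_map circle_top euclidean (\<lambda>z. z powi snd u)"
    by (simp add: circle_top_def)
  from continuous_map_compose[OF continuous_map_snd this, of "solenoid_top a"]
  have "continuous_map XT euclidean (\<lambda>x. snd x powi snd u)" by (simp add: o_def X_top_def)
  moreover have "continuous_map XT euclidean (\<lambda>x. chi (fst u) (fst x))"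
    using u by (intro continuous_map_chi_fst) auto
  ultimately have "continuous_map XT euclidean (\<lambda>x. chi (fst u) (fst x) * snd x powi snd u)"
    by (simp add: continuous_map_atin tendsto_mult)
  then show ?thesis by (simp add: pair_def[abs_def])
qed

lemma pair_in_characters: "u \<in> Y \<Longrightarrow> pair u \<in> characters X XT"
  using norm_pair pair_mult continuous_map_pair
  by (auto simp: characters_def hom_def circle_group_def circle_top_def continuous_map_in_subtopology topspace_X)

lemma pair_measurable [measurable]: "u \<in> Y \<Longrightarrow> pair u \<in> borel_measurable (borel_of XT)"
  by (intro continuous_map_imp_measurable_borel_of continuous_map_pair)

lemma measurable_XI_pair:
  assumes c: "\<And>\<omega>. \<omega> \<in> space P \<Longrightarrow> h \<omega> \<in> carrier X"
    and m: "\<And>w. w \<in> Y \<Longrightarrow> (\<lambda>\<omega>. pair w (h \<omega>)) \<in> borel_measurable P"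
  shows "h \<in> measurable P (borel_of XT)"
proof (rule measurable_XI[OF c])
  have "0 \<in> H" using H_add[OF one_H H_uminus[OF one_H]] by simp
  then have "(\<lambda>\<omega>. pair (0, 1) (h \<omega>)) \<in> borel_measurable P" by (intro m) auto
  moreover have "pair (0, 1) (h \<omega>) = snd (h \<omega>)" if "\<omega> \<in> space P" for \<omega>
    using c[OF that] by (auto simp: pair_def carrier_X chi_0)
  ultimately show "(\<lambda>\<omega>. snd (h \<omega>)) \<in> borel_measurable P" by (simp cong: measurable_cong)
  fix n
  show "(\<lambda>\<omega>. chi (1 / real (N (Suc n))) (fst (h \<omega>))) \<in> borel_measurable P"
    using m[of "(1 / real (N (Suc n)), 0)"] inv_N_H[of n] by (simp add: pair_def del: of_nat_Suc)
qed

end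

section \<open>The functional equation of the characteristic functions\<close>

locale heyde_data = adic +
  fixes A :: "solenoid_elt \<Rightarrow> solenoid_elt" and b r :: real
  assumes no_order_2: "\<And>g. g \<in> carrier (solenoid a) \<Longrightarrow> group.ord (solenoid a) g \<noteq> 2"
    and b_H: "b \<in> H_group a"
    and kernel_trivial: "kernel (solenoid a) (solenoid a) (\<lambda>g. g \<otimes>\<^bsub>solenoid a\<^esub> A g) = {\<one>\<^bsub>solenoid a\<^esub>}"
    and A_r: "aut_number a A r"
begin

lemma square_eq_one: "g \<in> carrier \<Sigma> \<Longrightarrow> g [^]\<^bsub>\<Sigma>\<^esub> (2::nat) = \<one>\<^bsub>\<Sigma>\<^esub> \<Longrightarrow> g = \<one>\<^bsub>\<Sigma>\<^esub>"
proof -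
  assume g: "g \<in> carrier \<Sigma>" "g [^]\<^bsub>\<Sigma>\<^esub> (2::nat) = \<one>\<^bsub>\<Sigma>\<^esub>"
  then have "\<Sigma>.ord g dvd 2" by (simp add: \<Sigma>.pow_eq_id)
  moreover have "\<Sigma>.ord g \<noteq> 2" using no_order_2 g by blast
  ultimately have "\<Sigma>.ord g = 1" using primes_dvd_imp_eq two_is_prime_nat
    by (metis prime_nat_iff)
  then show ?thesis using \<Sigma>.ord_eq_1[OF g(1)] by simp
qed

text \<open>The group-theoretic part of \<open>aut_number\<close>, with p and q exposed: the locale
  fixes only their quotient r.\<close>

definition fraction :: "int \<Rightarrow> int \<Rightarrow> bool" where
  "fraction p q \<longleftrightarrow> p \<noteq> 0 \<and> q \<noteq> 0 \<and> r = of_int p / of_int q \<and>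
     (\<lambda>g. g [^]\<^bsub>\<Sigma>\<^esub> p) \<in> iso \<Sigma> \<Sigma> \<and> (\<lambda>g. g [^]\<^bsub>\<Sigma>\<^esub> q) \<in> iso \<Sigma> \<Sigma> \<and>
     (\<forall>g\<in>carrier \<Sigma>. A g = inv_into (carrier \<Sigma>) (\<lambda>h. h [^]\<^bsub>\<Sigma>\<^esub> q) g [^]\<^bsub>\<Sigma>\<^esub> p)"

lemma fraction_exists: obtains p q where "fraction p q"
  using A_r that unfolding aut_number_def top_auts_def fraction_def by auto

text \<open>If p + q annihilates g, then I + a annihilates the q-th power of g, because a maps it to
  the p-th power. So a trivial kernel excludes (p + q)-torsion.\<close>

lemma fractionD:
  assumes "fraction p q"
  shows fraction_nonzero: "p \<noteq> 0" "q \<noteq> 0" "p + q \<noteq> 0" and fraction_eq: "r = of_int p / of_int q"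
    and fraction_torsion_free:
      "\<And>k g. k \<in> {p, q, p + q} \<Longrightarrow> g \<in> carrier \<Sigma> \<Longrightarrow> g [^]\<^bsub>\<Sigma>\<^esub> k = \<one>\<^bsub>\<Sigma>\<^esub> \<Longrightarrow> g = \<one>\<^bsub>\<Sigma>\<^esub>"
    and fraction_A: "\<And>h. h \<in> carrier \<Sigma> \<Longrightarrow> A (h [^]\<^bsub>\<Sigma>\<^esub> q) = h [^]\<^bsub>\<Sigma>\<^esub> p"
    and fraction_surj: "\<And>g. g \<in> carrier \<Sigma> \<Longrightarrow> \<exists>h\<in>carrier \<Sigma>. g = h [^]\<^bsub>\<Sigma>\<^esub> q"
proof -
  have pq: "p \<noteq> 0" "q \<noteq> 0" "r = of_int p / of_int q"
    and P: "(\<lambda>g. g [^]\<^bsub>\<Sigma>\<^esub> p) \<in> iso \<Sigma> \<Sigma>" and Q: "(\<lambda>g. g [^]\<^bsub>\<Sigma>\<^esub> q) \<in> iso \<Sigma> \<Sigma>"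
    and A: "\<And>g. g \<in> carrier \<Sigma> \<Longrightarrow> A g = inv_into (carrier \<Sigma>) (\<lambda>h. h [^]\<^bsub>\<Sigma>\<^esub> q) g [^]\<^bsub>\<Sigma>\<^esub> p"
    using assms by (auto simp: fraction_def)
  have inj: "inj_on (\<lambda>g. g [^]\<^bsub>\<Sigma>\<^esub> p) (carrier \<Sigma>)" "inj_on (\<lambda>g. g [^]\<^bsub>\<Sigma>\<^esub> q) (carrier \<Sigma>)"
    and surj: "(\<lambda>g. g [^]\<^bsub>\<Sigma>\<^esub> q) ` carrier \<Sigma> = carrier \<Sigma>"
    using P Q by (auto simp: iso_def bij_betw_def)
  have Aq: "A (h [^]\<^bsub>\<Sigma>\<^esub> q) = h [^]\<^bsub>\<Sigma>\<^esub> p" if "h \<in> carrier \<Sigma>" for h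
    using A[of "h [^]\<^bsub>\<Sigma>\<^esub> q"] inv_into_f_f[OF inj(2) that] that by simp
  have p: "g = \<one>\<^bsub>\<Sigma>\<^esub>" if "g \<in> carrier \<Sigma>" "g [^]\<^bsub>\<Sigma>\<^esub> p = \<one>\<^bsub>\<Sigma>\<^esub>" for g
    using inj_onD[OF inj(1), of g "\<one>\<^bsub>\<Sigma>\<^esub>"] that by simp
  have q: "g = \<one>\<^bsub>\<Sigma>\<^esub>" if "g \<in> carrier \<Sigma>" "g [^]\<^bsub>\<Sigma>\<^esub> q = \<one>\<^bsub>\<Sigma>\<^esub>" for g
    using inj_onD[OF inj(2), of g "\<one>\<^bsub>\<Sigma>\<^esub>"] that by simp
  have pq1: "g = \<one>\<^bsub>\<Sigma>\<^esub>" if g: "g \<in> carrier \<Sigma>" "g [^]\<^bsub>\<Sigma>\<^esub> (p + q) = \<one>\<^bsub>\<Sigma>\<^esub>" for g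
  proof -
    have "g [^]\<^bsub>\<Sigma>\<^esub> q \<otimes>\<^bsub>\<Sigma>\<^esub> A (g [^]\<^bsub>\<Sigma>\<^esub> q) = \<one>\<^bsub>\<Sigma>\<^esub>"
      using g by (simp add: Aq \<Sigma>.int_pow_mult[symmetric] add.commute)
    then have "g [^]\<^bsub>\<Sigma>\<^esub> q \<in> kernel \<Sigma> \<Sigma> (\<lambda>g. g \<otimes>\<^bsub>\<Sigma>\<^esub> A g)"
      using g by (simp add: kernel_def)
    then have "g [^]\<^bsub>\<Sigma>\<^esub> q = \<one>\<^bsub>\<Sigma>\<^esub>" unfolding kernel_trivial by simp
    then show ?thesis by (rule q[OF g(1)])
  qed
  have pq0: "p + q \<noteq> 0"
  proof
    assume "p + q = 0"
    \<comment> \<open>If p + q were 0, every element would be trivial, but the character 1 takes the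
      value -1 at this one.\<close>
    let ?g = "cls (1 / 2, \<one>\<^bsub>\<Delta>\<^esub>)"
    have g: "?g \<in> carrier \<Sigma>" by (simp add: carrier_solenoid)
    then have "?g = \<one>\<^bsub>\<Sigma>\<^esub>" using pq1[OF g] \<open>p + q = 0\<close> by simp
    then show False using chi_real[OF one_H, of "1 / 2"] chi_one[OF one_H] by simp
  qed
  show "\<exists>h\<in>carrier \<Sigma>. g = h [^]\<^bsub>\<Sigma>\<^esub> q" if "g \<in> carrier \<Sigma>" for g
  proof -
    have "g \<in> (\<lambda>g. g [^]\<^bsub>\<Sigma>\<^esub> q) ` carrier \<Sigma>" unfolding surj by (rule that)
    then show ?thesis by (rule imageE) (rule bexI)
  qed
  show "g = \<one>\<^bsub>\<Sigma>\<^esub>" if "k \<in> {p, q, p + q}" "g \<in> carrier \<Sigma>" "g [^]\<^bsub>\<Sigma>\<^esub> k = \<one>\<^bsub>\<Sigma>\<^esub>" for k g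
  proof -
    consider "k = p" | "k = q" | "k = p + q" using \<open>k \<in> {p, q, p + q}\<close> by blast
    then show ?thesis
      by cases (use that(2,3) p[OF that(2)] q[OF that(2)] pq1[OF that(2)] in \<open>simp_all only:\<close>)
  qed
  show "p \<noteq> 0" "q \<noteq> 0" "p + q \<noteq> 0" "r = of_int p / of_int q" by fact+
  show "A (h [^]\<^bsub>\<Sigma>\<^esub> q) = h [^]\<^bsub>\<Sigma>\<^esub> p" if "h \<in> carrier \<Sigma>" for h
    using that by (rule Aq)
qed

text \<open>By duality, H is divisible by k when the solenoid has no k-torsion. The values k = 2, q,
  p, p + q give closure under halving, under multiplication and division by r, and under division by
  1 + r.\<close>

sublocale H: heyde_group H r
proof -
  obtain p q where f: "fraction p q" by (rule fraction_exists)
  note pq = fraction_nonzero[OF f] fraction_eq[OF f] and tf = fraction_torsion_free[OF f]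
  have div: "x / of_int k \<in> H" if "k \<in> {p, q, p + q}" "x \<in> H" for k x
  proof (rule torsion_free_imp_divisible_int[OF _ _ that(2)])
    show "k \<noteq> 0" using that(1) pq by auto
  qed (erule (1) tf[OF that(1)])
  show "heyde_group H r"
  proof (rule heyde_group.intro)
    fix x assume x: "x \<in> H"
    have "x / real 2 \<in> H"
      by (rule torsion_free_imp_divisible[OF _ _ x]) (simp, erule (1) square_eq_one)
    then show "x / 2 \<in> H" by simp
    show "r * x \<in> H" using of_int_H_mult[OF div[of q x], of p] x by (simp add: pq)
    show "x / r \<in> H" using of_int_H_mult[OF div[of p x], of q] x by (simp add: pq mult.commute)
    have "1 + r = of_int (p + q) / of_int q" using pq by (simp add: field_simps)
    then show "x / (1 + r) \<in> H"
      using of_int_H_mult[OF div[of "p + q" x], of q] x by (simp add: mult.commute)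
  next
    have "1 + r = of_int (p + q) / of_int q" using pq by (simp add: field_simps)
    then show "1 + r \<noteq> 0" using pq by (simp del: of_int_add)
    show "r \<noteq> 0" using pq by simp
  qed (fact one_H H_add H_uminus H_rats)+
qed

lemma A_closed: "g \<in> carrier \<Sigma> \<Longrightarrow> A g \<in> carrier \<Sigma>"
proof -
  assume g: "g \<in> carrier \<Sigma>"
  obtain p q where f: "fraction p q" by (rule fraction_exists)
  obtain h where "h \<in> carrier \<Sigma>" "g = h [^]\<^bsub>\<Sigma>\<^esub> q" using fraction_surj[OF f g] by blast
  then show ?thesis using fraction_A[OF f] by simp
qed

lemma chi_A:
  assumes "s \<in> H" "g \<in> carrier \<Sigma>"
  shows "chi s (A g) = chi (r * s) g"
proof -
  obtain p q where f: "fraction p q" by (rule fraction_exists)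
  note pq = fraction_nonzero[OF f] fraction_eq[OF f] and A = fraction_A[OF f]
  obtain h where h: "h \<in> carrier \<Sigma>" "g = h [^]\<^bsub>\<Sigma>\<^esub> q" using fraction_surj[OF f assms(2)] by blast
  have "chi (r * s) g = chi (of_int q * (r * s)) h"
    unfolding h(2) by (rule chi_int_pow[OF H.mult_r[OF assms(1)] h(1)])
  also have "of_int q * (r * s) = of_int p * s" using pq by simp
  also have "chi (of_int p * s) h = chi s (A g)"
    unfolding h(2) A[OF h(1)] by (rule chi_int_pow[OF assms(1) h(1), symmetric])
  finally show ?thesis by simp
qed

text \<open>The adjoint of the automorphism on the dual group.\<close>

definition eps :: "real \<times> int \<Rightarrow> real \<times> int" where
  "eps u = (r * fst u + b * of_int (snd u), snd u)"

lemma eps_Y: "u \<in> Y \<Longrightarrow> eps u \<in> Y"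
  using of_int_H_mult[OF b_H] by (auto simp: eps_def mult.commute[of b] intro!: H_add H.mult_r)

lemma eps_add: "eps (u + v) = eps u + eps v"
  by (simp add: eps_def prod_eq_iff algebra_simps)

abbreviation "\<alpha> \<equiv> matrix_aut a A b"

lemma alpha_closed: "x \<in> carrier X \<Longrightarrow> \<alpha> x \<in> carrier X"
  using b_H by (auto simp: matrix_aut_def carrier_X A_closed norm_mult norm_chi)

lemma pair_alpha:
  assumes u: "u \<in> Y" and x: "x \<in> carrier X"
  shows "pair u (\<alpha> x) = pair (eps u) x"
proof -
  obtain s n where u': "u = (s, n)" "s \<in> H" using u by auto
  obtain g z where x': "x = (g, z)" "g \<in> carrier \<Sigma>" using x by (auto simp: carrier_X)
  have "of_int n * b \<in> H" by (rule of_int_H_mult[OF b_H])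
  then show ?thesis
    using u'(2) x'(2) by (simp add: u' x' matrix_aut_def pair_def eps_def chi_A power_int_mult_distrib
      chi_powi b_H chi_add H.mult_r mult.commute[of b])
qed

text \<open>Both joint laws are integrated against the character (u, v) of X x X. Collecting the
  factors of each variable gives u + v and u + eps v; inverting L2 reverses the sign of v.
  Independence splits both integrals.\<close>

lemma char_fun_heyde:
  assumes P: "prob_space P"
    and \<xi>1: "\<xi>1 \<in> measurable P (borel_of XT)" and \<xi>2: "\<xi>2 \<in> measurable P (borel_of XT)"
    and indep: "prob_space.indep_var P (borel_of XT) \<xi>1 (borel_of XT) \<xi>2"
    and sym: "cond_symmetric X XT P (\<lambda>\<omega>. \<xi>1 \<omega> \<otimes>\<^bsub>X\<^esub> \<alpha> (\<xi>2 \<omega>)) (\<lambda>\<omega>. \<xi>1 \<omega> \<otimes>\<^bsub>X\<^esub> \<xi>2 \<omega>)"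
    and u: "u \<in> Y" and v: "v \<in> Y"
  defines "f \<equiv> \<lambda>u. char_fun (distr P (borel_of XT) \<xi>1) (pair u)"
    and "g \<equiv> \<lambda>u. char_fun (distr P (borel_of XT) \<xi>2) (pair u)"
  shows "f (u + v) * g (u + eps v) = f (u - v) * g (u - eps v)"
proof -
  interpret prob_space P by (rule P)
  note [measurable] = \<xi>1 \<xi>2
  have car: "\<xi>1 \<omega> \<in> carrier X" "\<xi>2 \<omega> \<in> carrier X" if "\<omega> \<in> space P" for \<omega>
    using measurable_space[OF \<xi>1 that] measurable_space[OF \<xi>2 that] by (auto simp: topspace_X)
  have pm: "(\<lambda>\<omega>. pair w (\<xi>1 \<omega>)) \<in> borel_measurable P" "(\<lambda>\<omega>. pair w (\<xi>2 \<omega>)) \<in> borel_measurable P" if "w \<in> Y" for w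
    using pair_measurable[OF that] by measurable
  let ?T1 = "\<lambda>\<omega>. \<xi>1 \<omega> \<otimes>\<^bsub>X\<^esub> \<xi>2 \<omega>" and ?T2 = "\<lambda>\<omega>. \<xi>1 \<omega> \<otimes>\<^bsub>X\<^esub> \<alpha> (\<xi>2 \<omega>)"
  have T1: "pair w (?T1 \<omega>) = pair w (\<xi>1 \<omega>) * pair w (\<xi>2 \<omega>)"
    and T2: "pair w (?T2 \<omega>) = pair w (\<xi>1 \<omega>) * pair (eps w) (\<xi>2 \<omega>)"
    and T2': "pair w (inv\<^bsub>X\<^esub> ?T2 \<omega>) = pair (- w) (\<xi>1 \<omega>) * pair (- eps w) (\<xi>2 \<omega>)"
    if "w \<in> Y" "\<omega> \<in> space P" for w \<omega>
    using that car[OF that(2)] eps_Y[OF that(1)]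
    by (simp_all add: pair_mult pair_alpha alpha_closed pair_inv pair_uminus del: mem_Times_iff)
  have cT: "?T1 \<omega> \<in> carrier X" "?T2 \<omega> \<in> carrier X" "inv\<^bsub>X\<^esub> ?T2 \<omega> \<in> carrier X" if "\<omega> \<in> space P" for \<omega>
    using car[OF that] alpha_closed by auto
  have neg: "- w \<in> Y" if "w \<in> Y" for w using that H_uminus by auto
  have plus: "w + w' \<in> Y" if "w \<in> Y" "w' \<in> Y" for w w' using that H_add by auto
  have mT1: "?T1 \<in> measurable P (borel_of XT)"
    by (rule measurable_XI_pair[OF cT(1)]) (use T1 pm in \<open>simp_all cong: measurable_cong\<close>)
  have mT2: "?T2 \<in> measurable P (borel_of XT)"
    by (rule measurable_XI_pair[OF cT(2)]) (use T2 pm eps_Y in \<open>simp_all cong: measurable_cong del: mem_Times_iff\<close>)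
  have mT2': "(\<lambda>\<omega>. inv\<^bsub>X\<^esub> ?T2 \<omega>) \<in> measurable P (borel_of XT)"
    by (rule measurable_XI_pair[OF cT(3)]) (use T2' pm eps_Y neg in \<open>simp_all cong: measurable_cong del: mem_Times_iff\<close>)
  let ?h = "\<lambda>(x, y). pair u x * pair v y"
  have mh: "?h \<in> borel_measurable (borel_of XT \<Otimes>\<^sub>M borel_of XT)"
    using pair_measurable[OF u] pair_measurable[OF v] by measurable
  have "(\<integral>\<omega>. ?h (?T1 \<omega>, ?T2 \<omega>) \<partial>P) = (\<integral>z. ?h z \<partial>distr P (borel_of XT \<Otimes>\<^sub>M borel_of XT) (\<lambda>\<omega>. (?T1 \<omega>, ?T2 \<omega>)))"
    by (rule integral_distr[symmetric, OF _ mh]) (use mT1 mT2 in measurable)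
  also have "\<dots> = (\<integral>z. ?h z \<partial>distr P (borel_of XT \<Otimes>\<^sub>M borel_of XT) (\<lambda>\<omega>. (?T1 \<omega>, inv\<^bsub>X\<^esub> ?T2 \<omega>)))"
    using sym by (simp add: cond_symmetric_def)
  also have "\<dots> = (\<integral>\<omega>. ?h (?T1 \<omega>, inv\<^bsub>X\<^esub> ?T2 \<omega>) \<partial>P)"
    by (rule integral_distr[OF _ mh]) (use mT1 mT2' in measurable)
  finally have eq: "(\<integral>\<omega>. ?h (?T1 \<omega>, ?T2 \<omega>) \<partial>P) = (\<integral>\<omega>. ?h (?T1 \<omega>, inv\<^bsub>X\<^esub> ?T2 \<omega>) \<partial>P)" .
  have prod: "(\<integral>\<omega>. pair w (\<xi>1 \<omega>) * pair w' (\<xi>2 \<omega>) \<partial>P) = f w * g w'" if w: "w \<in> Y" and w': "w' \<in> Y" for w w'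
  proof -
    have "indep_var borel (pair w \<circ> \<xi>1) borel (pair w' \<circ> \<xi>2)"
      by (rule indep_var_compose[OF indep pair_measurable[OF w] pair_measurable[OF w']])
    moreover have "integrable P (pair w \<circ> \<xi>1)" "integrable P (pair w' \<circ> \<xi>2)"
      using pm(1)[OF w] pm(2)[OF w'] norm_pair[OF w car(1)] norm_pair[OF w' car(2)]
      by (auto intro!: integrable_const_bound[of _ 1] AE_I2 simp: o_def simp del: mem_Times_iff)
    ultimately have "(\<integral>\<omega>. (pair w \<circ> \<xi>1) \<omega> * (pair w' \<circ> \<xi>2) \<omega> \<partial>P) = (\<integral>\<omega>. (pair w \<circ> \<xi>1) \<omega> \<partial>P) * (\<integral>\<omega>. (pair w' \<circ> \<xi>2) \<omega> \<partial>P)"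
      by (rule indep_var_lebesgue_integral)
    then show ?thesis
      unfolding f_def g_def char_fun_def
      by (simp add: integral_distr[OF \<xi>1 pair_measurable[OF w]] integral_distr[OF \<xi>2 pair_measurable[OF w']])
  qed
  have "f (u + v) * g (u + eps v) = (\<integral>\<omega>. ?h (?T1 \<omega>, ?T2 \<omega>) \<partial>P)"
    unfolding prod[symmetric, OF plus[OF u v] plus[OF u eps_Y[OF v]]]
    by (rule Bochner_Integration.integral_cong[OF refl])
      (simp add: T1[OF u] T2[OF v] pair_add[OF u v car(1)] pair_add[OF u eps_Y[OF v] car(2)])
  also have "\<dots> = f (u + - v) * g (u + - eps v)"
    unfolding eq prod[symmetric, OF plus[OF u neg[OF v]] plus[OF u neg[OF eps_Y[OF v]]]]
    by (rule Bochner_Integration.integral_cong[OF refl])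
      (simp add: T1[OF u] T2'[OF v] pair_add[OF u neg[OF v] car(1)] pair_add[OF u neg[OF eps_Y[OF v]] car(2)] del: add_uminus_conv_diff)
  finally show ?thesis by simp
qed

section \<open>Growth of the moduli on the even part of the dual group\<close>

text \<open>\<open>weight\<close> below is the linear form with \<open>weight (eps u) = r * weight u\<close>.  For \<open>r = 1\<close>, where
  \<open>slope = 0\<close> by division by zero, it only occurs multiplied by \<open>0\<close>.\<close>

definition slope :: real where
  "slope = b / (r - 1)"

definition weight :: "real \<times> int \<Rightarrow> real" where
  "weight u = fst u + slope * of_int (snd u)"

lemma weight_add: "weight (u + v) = weight u + weight v"
  by (simp add: weight_def algebra_simps)

lemma weight_eps: "r \<noteq> 1 \<Longrightarrow> weight (eps u) = r * weight u"
proof -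
  assume "r \<noteq> 1"
  then have "b + b / (r - 1) = r * (b / (r - 1))" by (simp add: field_simps)
  then have "(b + b / (r - 1)) * of_int (snd u) = r * (b / (r - 1)) * of_int (snd u)" by (simp only:)
  then show ?thesis by (simp add: weight_def slope_def eps_def algebra_simps)
qed

text \<open>An element with even second coordinate is 2v with v in Y. The difference v - eps v lies
  in H x {0}, where the forms are known, and it is (1 - r) times the weight of v. For the second
  function the variable v is replaced by t with eps t = v, so that the doubled argument falls on
  \<open>\<psi>\<close>.\<close>

lemma modulus_even:
  fixes f g :: "real \<times> int \<Rightarrow> complex"
  assumes f: "f 0 = 1" "\<And>u. u \<in> Y \<Longrightarrow> f (- u) = cnj (f u)" "\<And>u. u \<in> Y \<Longrightarrow> norm (f u) \<le> 1" "\<And>u. u \<in> Y \<Longrightarrow> f u \<noteq> 0"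
    and g: "g 0 = 1" "\<And>u. u \<in> Y \<Longrightarrow> g (- u) = cnj (g u)" "\<And>u. u \<in> Y \<Longrightarrow> norm (g u) \<le> 1" "\<And>u. u \<in> Y \<Longrightarrow> g u \<noteq> 0"
    and eq: "\<And>u v. u \<in> Y \<Longrightarrow> v \<in> Y \<Longrightarrow> f (u + v) * g (u + eps v) = f (u - v) * g (u - eps v)"
  shows "\<exists>C\<ge>0. (r > 0 \<longrightarrow> C = 0) \<and> (\<forall>u\<in>Y. even (snd u) \<longrightarrow>
    exp (- C * (weight u)\<^sup>2) \<le> norm (f u) \<and> exp (- C * (weight u)\<^sup>2) \<le> norm (g u))"
proof -
  define \<phi> where "\<phi> u = - ln (norm (f u))" for u
  define \<psi> where "\<psi> u = - ln (norm (g u))" for u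
  have plus: "u + v \<in> Y" and minus: "u - v \<in> Y" if "u \<in> Y" "v \<in> Y" for u v
    using that H_add H.diff by auto
  have \<phi>: "\<phi> 0 = 0" "\<And>u. u \<in> Y \<Longrightarrow> 0 \<le> \<phi> u" and \<psi>: "\<psi> 0 = 0" "\<And>u. u \<in> Y \<Longrightarrow> 0 \<le> \<psi> u"
    using f(1,3,4) g(1,3,4) by (simp_all add: \<phi>_def \<psi>_def)
  have even: "\<phi> (- u) = \<phi> u" "\<psi> (- u) = \<psi> u" if "u \<in> Y" for u
    unfolding \<phi>_def \<psi>_def f(2)[OF that] g(2)[OF that] by simp_all
  have log_eq: "\<phi> (u + v) + \<psi> (u + eps v) = \<phi> (u - v) + \<psi> (u - eps v)" if u: "u \<in> Y" and v: "v \<in> Y" for u v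
  proof -
    have "ln (norm (f (u + v) * g (u + eps v))) = ln (norm (f (u - v) * g (u - eps v)))"
      by (simp only: eq[OF u v])
    then show ?thesis
      using f(4)[OF plus[OF u v]] g(4)[OF plus[OF u eps_Y[OF v]]] f(4)[OF minus[OF u v]] g(4)[OF minus[OF u eps_Y[OF v]]]
      by (simp add: norm_mult ln_mult \<phi>_def \<psi>_def)
  qed
  have H0: "(s, 0) \<in> Y" if "s \<in> H" for s using that by simp
  have eps0: "eps (s, 0) = (r * s, 0)" for s by (simp add: eps_def)
  have line: "\<phi> (s + t, 0) + \<psi> (s + r * t, 0) = \<phi> (s - t, 0) + \<psi> (s - r * t, 0)" if "s \<in> H" "t \<in> H" for s t
    using log_eq[OF H0[OF that(1)] H0[OF that(2)]] by (simp add: eps0)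
  have z: "(0, 0) = (0 :: real \<times> int)" by (simp add: prod_eq_iff)
  have nonneg0: "0 \<le> \<phi> (s, 0)" "0 \<le> \<psi> (s, 0)" "\<phi> (- s, 0) = \<phi> (s, 0)" "\<psi> (- s, 0) = \<psi> (s, 0)" if "s \<in> H" for s
    using \<phi>(2)[OF H0[OF that]] \<psi>(2)[OF H0[OF that]] even[OF H0[OF that]] by simp_all
  obtain \<sigma> \<sigma>' where \<sigma>: "\<sigma> \<ge> 0" "\<sigma>' \<ge> 0" "r > 0 \<Longrightarrow> \<sigma> = 0 \<and> \<sigma>' = 0"
      "\<And>h. h \<in> H \<Longrightarrow> \<phi> (h, 0) = \<sigma> * h\<^sup>2" "\<And>h. h \<in> H \<Longrightarrow> \<psi> (h, 0) = \<sigma>' * h\<^sup>2"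
  proof (cases "r = 1")
    case True
    \<comment> \<open>For r = 1 and both variables h / 2 the right side is the value at 0, so two
      nonnegative numbers add up to 0.\<close>
    have "\<phi> (h, 0) = 0 \<and> \<psi> (h, 0) = 0" if "h \<in> H" for h
      using line[OF H.half[OF that] H.half[OF that]] nonneg0[OF that] \<phi>(1) \<psi>(1) True by (simp add: z)
    then show thesis using that[of 0 0] by simp
  next
    case False
    show thesis
    proof (rule H.quadratic_solution[OF False, of "\<lambda>s. \<phi> (s, 0)" "\<lambda>s. \<psi> (s, 0)"])
      show "\<phi> (0, 0) = 0" "\<psi> (0, 0) = 0" using \<phi>(1) \<psi>(1) by (simp_all add: z)
      fix s assume s: "s \<in> H"
      show "\<phi> (- s, 0) = \<phi> (s, 0)" "\<psi> (- s, 0) = \<psi> (s, 0)" "0 \<le> \<phi> (s, 0)" "0 \<le> \<psi> (s, 0)"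
        by (rule nonneg0[OF s])+
      fix t assume "t \<in> H"
      with s show "\<phi> (s + t, 0) + \<psi> (s + r * t, 0) = \<phi> (s - t, 0) + \<psi> (s - r * t, 0)" by (rule line)
    next
      fix \<sigma> \<sigma>' assume s: "\<sigma> \<ge> 0" "\<sigma>' \<ge> 0" "\<sigma> = - r * \<sigma>'"
        and eqs: "\<And>h. h \<in> H \<Longrightarrow> \<phi> (h, 0) = \<sigma> * h\<^sup>2" "\<And>h. h \<in> H \<Longrightarrow> \<psi> (h, 0) = \<sigma>' * h\<^sup>2"
      have "\<sigma> = 0 \<and> \<sigma>' = 0" if "r > 0"
      proof -
        have "0 \<le> r * \<sigma>'" using that s(2) by simp
        then have "\<sigma> = 0" "r * \<sigma>' = 0" using s(1,3) by linarith+
        then show ?thesis using that by simp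
      qed
      then show thesis by (rule that[OF s(1,2) _ eqs])
    qed
  qed
  \<comment> \<open>The two entries are the coefficients in the bounds for \<open>\<phi>\<close> and
    \<open>\<psi>\<close> below, where the weights are weight u / 2 and weight u / (2r).\<close>
  define C where "C = max (\<sigma>' * ((1 - r) / 2)\<^sup>2) (\<sigma> * ((1 - r) / (2 * r))\<^sup>2)"
  have C0: "C \<ge> 0" unfolding C_def using \<sigma>(2) by (simp add: le_max_iff_disj)
  have diff: "v - eps v = ((1 - r) * weight v, 0) \<and> (1 - r) * weight v \<in> H" if "v \<in> Y" "r \<noteq> 1" for v
  proof -
    have "(1 - r) * weight v = (1 - r) * fst v + (1 - r) * (b / (r - 1)) * of_int (snd v)"
      by (simp only: weight_def slope_def distrib_left mult.assoc)
    also have "(1 - r) * (b / (r - 1)) = - b" using that(2) by (simp add: field_simps)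
    finally have "v - eps v = ((1 - r) * weight v, 0)"
      by (simp add: eps_def prod_eq_iff algebra_simps)
    then show ?thesis using minus[OF that(1) eps_Y[OF that(1)]] by simp
  qed
  have diff1: "v - eps v = (- b * of_int (snd v), 0)" if "r = 1" for v
    unfolding eps_def using that by (simp add: prod_eq_iff)
  have half: "\<exists>v\<in>Y. u = v + v \<and> weight v = weight u / 2" if "u \<in> Y" "even (snd u)" for u
  proof -
    define s n where "s = fst u" and "n = snd u"
    then have u: "u = (s, n)" "even n" "s / 2 \<in> H" using that H.half by auto
    from \<open>even n\<close> obtain k where k: "n = 2 * k" by (rule evenE)
    then show ?thesis by (intro bexI[of _ "(s / 2, k)"]) (use u(3) in \<open>auto simp: u(1) k weight_def\<close>)
  qed
  have zero_diff: "\<phi> (v - eps v) = 0 \<and> \<psi> (v - eps v) = 0" if "v \<in> Y" "r = 1" for v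
  proof -
    have "- b * of_int (snd v) \<in> H" using H_uminus[OF of_int_H_mult[OF b_H, of "snd v"]] by (simp add: mult.commute)
    then show ?thesis using \<sigma>(3) \<sigma>(4,5)[of "- b * of_int (snd v)"] that(2) unfolding diff1[OF that(2)] by simp
  qed
  have boundf: "\<phi> u \<le> C * (weight u)\<^sup>2" if u: "u \<in> Y" "even (snd u)" for u
  proof -
    obtain v where v: "v \<in> Y" "u = v + v" "weight v = weight u / 2" using half[OF u] by blast
    have "\<phi> u \<le> \<psi> (v - eps v)"
      using log_eq[OF v(1) v(1)] \<psi>(2)[OF plus[OF v(1) eps_Y[OF v(1)]]] \<phi>(1) by (simp add: v(2))
    also have "\<dots> \<le> C * (weight u)\<^sup>2"
    proof (cases "r = 1")
      case False
      then have "\<psi> (v - eps v) = \<sigma>' * ((1 - r) * weight v)\<^sup>2" using diff[OF v(1) False] \<sigma>(5) by simp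
      also have "\<dots> = \<sigma>' * ((1 - r) / 2)\<^sup>2 * (weight u)\<^sup>2" by (simp add: v(3) power_mult_distrib power_divide)
      also have "\<dots> \<le> C * (weight u)\<^sup>2" by (intro mult_right_mono) (auto simp: C_def)
      finally show ?thesis .
    qed (use zero_diff v C0 in simp)
    finally show ?thesis .
  qed
  have boundg: "\<psi> u \<le> C * (weight u)\<^sup>2" if u: "u \<in> Y" "even (snd u)" for u
  proof -
    obtain v where v: "v \<in> Y" "u = v + v" "weight v = weight u / 2" using half[OF u] by blast
    obtain s n where sn: "v = (s, n)" "s \<in> H" using v(1) by auto
    define t where "t = ((s - b * of_int n) / r, n)"
    have t: "t \<in> Y" using H.div_r[OF H.diff[OF sn(2) of_int_H_mult[OF b_H, of n]]] by (simp add: t_def mult.commute)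
    have et: "eps t = v" using H.r0 by (simp add: t_def sn eps_def)
    have "\<psi> u \<le> \<phi> (eps t - t)"
      using log_eq[OF v(1) t] \<phi>(2)[OF plus[OF v(1) t]] \<psi>(1) by (simp add: et v(2))
    also have "\<phi> (eps t - t) = \<phi> (t - eps t)"
      using even(1)[OF minus[OF t eps_Y[OF t]]] by simp
    also have "\<dots> \<le> C * (weight u)\<^sup>2"
    proof (cases "r = 1")
      case False
      have wt: "weight t = weight u / (2 * r)"
        using weight_eps[OF False, of t] H.r0 unfolding et v(3) by (simp add: field_simps)
      have "\<phi> (t - eps t) = \<sigma> * ((1 - r) * weight t)\<^sup>2" using diff[OF t False] \<sigma>(4) by simp
      also have "\<dots> = \<sigma> * ((1 - r) / (2 * r))\<^sup>2 * (weight u)\<^sup>2" by (simp add: wt power_mult_distrib power_divide)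
      also have "\<dots> \<le> C * (weight u)\<^sup>2" by (intro mult_right_mono) (auto simp: C_def)
      finally show ?thesis .
    qed (use zero_diff t C0 in simp)
    finally show ?thesis .
  qed
  show ?thesis
  proof (intro exI[of _ C] conjI ballI impI C0)
    show "C = 0" if "r > 0" using \<sigma>(3)[OF that] by (simp add: C_def)
    fix u assume u: "u \<in> Y" "even (snd u)"
    have "exp (- \<phi> u) = norm (f u)" "exp (- \<psi> u) = norm (g u)"
      using f(4)[OF u(1)] g(4)[OF u(1)] by (simp_all add: \<phi>_def \<psi>_def)
    then show "exp (- C * (weight u)\<^sup>2) \<le> norm (f u)" "exp (- C * (weight u)\<^sup>2) \<le> norm (g u)"
      using boundf[OF u] boundg[OF u] by (metis exp_le_cancel_iff minus_mult_left neg_le_iff_le)+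
  qed
qed

end

section \<open>Almost sure concentration on a subgroup\<close>

context adic begin

definition cf :: "X_elt measure \<Rightarrow> real \<times> int \<Rightarrow> complex" where
  "cf \<mu> u = char_fun \<mu> (pair u)"

end

locale X_prob = adic + prob_space \<mu> for \<mu> :: "X_elt measure" +
  assumes sets_\<mu>: "sets \<mu> = sets (borel_of (X_top a))"
begin

lemma space_\<mu>: "space \<mu> = carrier X"
  using sets_eq_imp_space_eq[OF sets_\<mu>] by (simp add: topspace_X)

lemma pair_meas [measurable]: "u \<in> Y \<Longrightarrow> pair u \<in> borel_measurable \<mu>"
  using pair_measurable by (simp add: measurable_cong_sets[OF sets_\<mu> refl])

lemma cf_0: "cf \<mu> 0 = 1"
proof -
  have "cf \<mu> 0 = (\<integral>x. 1 \<partial>\<mu>)"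
    unfolding cf_def char_fun_def by (rule Bochner_Integration.integral_cong) (auto simp: pair_0 space_\<mu>)
  then show ?thesis by (simp add: prob_space)
qed

lemma cf_uminus: "u \<in> Y \<Longrightarrow> cf \<mu> (- u) = cnj (cf \<mu> u)"
proof -
  assume u: "u \<in> Y"
  have "cf \<mu> (- u) = (\<integral>x. cnj (pair u x) \<partial>\<mu>)"
    unfolding cf_def char_fun_def by (rule Bochner_Integration.integral_cong) (auto simp: pair_uminus[OF u] space_\<mu>)
  then show ?thesis by (simp add: cf_def char_fun_def)
qed

lemma norm_cf_le: "u \<in> Y \<Longrightarrow> norm (cf \<mu> u) \<le> 1"
proof -
  assume u: "u \<in> Y"
  have "norm (cf \<mu> u) \<le> (\<integral>x. norm (pair u x) \<partial>\<mu>)"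
    unfolding cf_def char_fun_def by (rule integral_norm_bound)
  also have "\<dots> = (\<integral>x. 1 \<partial>\<mu>)"
    by (rule Bochner_Integration.integral_cong) (auto simp: norm_pair[OF u] space_\<mu>)
  finally show ?thesis by (simp add: prob_space)
qed

lemma norm_one_minus_sq: "norm z = 1 \<Longrightarrow> (norm (1 - z))\<^sup>2 = 2 - 2 * Re z"
proof -
  assume "norm z = 1"
  then have "(Re z)\<^sup>2 + (Im z)\<^sup>2 = 1" using cmod_power2[of z] by simp
  then show ?thesis unfolding cmod_power2 by (simp add: power2_eq_square algebra_simps)
qed

text \<open>The mean of |1 - q k|^2 is 2 (1 - |cf (u k)|^2). Summability makes the series of these
  squares finite almost surely, so its terms tend to 0. Symmetrizing removes the unknown shift: only
  the modulus of the characteristic function enters.\<close>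

lemma symmetrized_converges:
  assumes u: "\<And>k. u k \<in> Y" and sm: "summable (\<lambda>k. 1 - (norm (cf \<mu> (u k)))\<^sup>2)"
  shows "AE z in \<mu> \<Otimes>\<^sub>M \<mu>. (\<lambda>k. pair (u k) (snd z \<otimes>\<^bsub>X\<^esub> inv\<^bsub>X\<^esub> fst z)) \<longlonglongrightarrow> 1"
proof -
  interpret PP: pair_prob_space \<mu> \<mu> ..
  define q where "q k z = pair (u k) (snd z) * cnj (pair (u k) (fst z))" for k z
  define F where "F k z = (norm (1 - q k z))\<^sup>2" for k z
  have car: "fst z \<in> carrier X" "snd z \<in> carrier X" if "z \<in> space (\<mu> \<Otimes>\<^sub>M \<mu>)" for z
    using that by (auto simp: space_pair_measure space_\<mu>)
  have qn: "norm (q k z) = 1" if "z \<in> space (\<mu> \<Otimes>\<^sub>M \<mu>)" for k z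
    using norm_pair[OF u car(1)[OF that]] norm_pair[OF u car(2)[OF that]] by (simp add: q_def norm_mult)
  have [measurable]: "cnj \<in> borel_measurable borel"
    by (intro borel_measurable_continuous_onI continuous_intros)
  have qm [measurable]: "q k \<in> borel_measurable (\<mu> \<Otimes>\<^sub>M \<mu>)" for k
    unfolding q_def[abs_def] using pair_meas[OF u] by measurable
  have Fm [measurable]: "F k \<in> borel_measurable (\<mu> \<Otimes>\<^sub>M \<mu>)" for k
    unfolding F_def[abs_def] by measurable
  have iq: "integrable (\<mu> \<Otimes>\<^sub>M \<mu>) (q k)" for k
    by (rule PP.P.integrable_const_bound[of _ 1]) (auto simp: qn)
  have Iq: "(\<integral>z. q k z \<partial>(\<mu> \<Otimes>\<^sub>M \<mu>)) = of_real ((norm (cf \<mu> (u k)))\<^sup>2)" for k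
  proof -
    have "(\<integral>z. q k z \<partial>(\<mu> \<Otimes>\<^sub>M \<mu>)) = (\<integral>x. (\<integral>y. q k (x, y) \<partial>\<mu>) \<partial>\<mu>)"
      using PP.integral_fst'[OF iq] by simp
    also have "\<dots> = (\<integral>x. cf \<mu> (u k) * cnj (pair (u k) x) \<partial>\<mu>)"
      by (simp add: q_def cf_def char_fun_def)
    also have "\<dots> = cf \<mu> (u k) * cnj (cf \<mu> (u k))"
      by (simp add: cf_def char_fun_def)
    finally show ?thesis by (simp only: complex_norm_square)
  qed
  have IF: "(\<integral>\<^sup>+z. ennreal (F k z) \<partial>(\<mu> \<Otimes>\<^sub>M \<mu>)) = ennreal (2 * (1 - (norm (cf \<mu> (u k)))\<^sup>2))" for k
  proof -
    have iF: "integrable (\<mu> \<Otimes>\<^sub>M \<mu>) (\<lambda>z. 2 - 2 * Re (q k z))" using iq by simp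
    have eq: "F k z = 2 - 2 * Re (q k z)" if "z \<in> space (\<mu> \<Otimes>\<^sub>M \<mu>)" for z
      unfolding F_def by (rule norm_one_minus_sq[OF qn[OF that]])
    have "(\<integral>\<^sup>+z. ennreal (F k z) \<partial>(\<mu> \<Otimes>\<^sub>M \<mu>)) = (\<integral>\<^sup>+z. ennreal (2 - 2 * Re (q k z)) \<partial>(\<mu> \<Otimes>\<^sub>M \<mu>))"
      by (rule nn_integral_cong) (simp add: eq)
    also have "\<dots> = ennreal (\<integral>z. 2 - 2 * Re (q k z) \<partial>(\<mu> \<Otimes>\<^sub>M \<mu>))"
    proof (rule nn_integral_eq_integral[OF iF], rule AE_I2)
      fix z assume "z \<in> space (\<mu> \<Otimes>\<^sub>M \<mu>)"
      then show "0 \<le> 2 - 2 * Re (q k z)" using qn[of z k] complex_Re_le_cmod[of "q k z"] by simp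
    qed
    also have "(\<integral>z. 2 - 2 * Re (q k z) \<partial>(\<mu> \<Otimes>\<^sub>M \<mu>)) = 2 - 2 * Re (\<integral>z. q k z \<partial>(\<mu> \<Otimes>\<^sub>M \<mu>))"
      using iq by (simp add: PP.P.prob_space)
    also have "\<dots> = 2 * (1 - (norm (cf \<mu> (u k)))\<^sup>2)" unfolding Iq by simp
    finally show ?thesis .
  qed
  have "(\<integral>\<^sup>+z. (\<Sum>k. ennreal (F k z)) \<partial>(\<mu> \<Otimes>\<^sub>M \<mu>)) = (\<Sum>k. ennreal (2 * (1 - (norm (cf \<mu> (u k)))\<^sup>2)))"
    unfolding IF[symmetric] by (rule nn_integral_suminf) simp
  also have "\<dots> = ennreal (\<Sum>k. 2 * (1 - (norm (cf \<mu> (u k)))\<^sup>2))"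
    using norm_cf_le[OF u] sm by (intro suminf_ennreal2 summable_mult) (auto simp: power_le_one)
  finally have "(\<integral>\<^sup>+z. (\<Sum>k. ennreal (F k z)) \<partial>(\<mu> \<Otimes>\<^sub>M \<mu>)) \<noteq> \<infinity>" by simp
  then have "AE z in \<mu> \<Otimes>\<^sub>M \<mu>. (\<Sum>k. ennreal (F k z)) \<noteq> \<infinity>"
    by (intro nn_integral_PInf_AE) auto
  then show ?thesis using AE_space
  proof eventually_elim
    case (elim z)
    have "summable (\<lambda>k. F k z)"
      by (rule summable_suminf_not_top) (use elim(1) in \<open>auto simp: F_def\<close>)
    from tendsto_real_sqrt[OF summable_LIMSEQ_zero[OF this]]
    have "(\<lambda>k. norm (1 - q k z)) \<longlonglongrightarrow> 0" by (simp add: F_def)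
    from tendsto_diff[OF tendsto_const tendsto_norm_zero_cancel[OF this], of 1]
    have "(\<lambda>k. q k z) \<longlonglongrightarrow> 1" by simp
    moreover have "pair (u k) (snd z \<otimes>\<^bsub>X\<^esub> inv\<^bsub>X\<^esub> fst z) = q k z" for k
      unfolding q_def pair_mult[OF u car(2)[OF elim(2)] X.inv_closed[OF car(1)[OF elim(2)]]]
        pair_inv[OF u car(1)[OF elim(2)]] ..
    ultimately show ?case by simp
  qed
qed

text \<open>Fubini turns almost sure convergence for the symmetrization \<open>\<mu> * \<mu>'\<close> into almost sure
  convergence for one shift of \<open>\<mu>\<close>.\<close>

lemma concentration:
  fixes u :: "'j::countable \<Rightarrow> nat \<Rightarrow> real \<times> int"
  assumes u: "\<And>j k. u j k \<in> Y" and sm: "\<And>j. summable (\<lambda>k. 1 - (norm (cf \<mu> (u j k)))\<^sup>2)"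
  obtains x0 where "x0 \<in> carrier X"
    "AE x in \<mu>. \<forall>j. (\<lambda>k. pair (u j k) (x \<otimes>\<^bsub>X\<^esub> inv\<^bsub>X\<^esub> x0)) \<longlonglongrightarrow> 1"
proof -
  interpret PP: pair_prob_space \<mu> \<mu> ..
  have "AE z in \<mu> \<Otimes>\<^sub>M \<mu>. \<forall>j. (\<lambda>k. pair (u j k) (snd z \<otimes>\<^bsub>X\<^esub> inv\<^bsub>X\<^esub> fst z)) \<longlonglongrightarrow> 1"
    by (rule AE_all_countable[THEN iffD2]) (intro allI symmetrized_converges u sm)
  from PP.AE_pair[OF this]
  have "AE x0 in \<mu>. AE x in \<mu>. \<forall>j. (\<lambda>k. pair (u j k) (x \<otimes>\<^bsub>X\<^esub> inv\<^bsub>X\<^esub> x0)) \<longlonglongrightarrow> 1" by simp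
  then have "AE x0 in \<mu>. x0 \<in> carrier X \<and> (AE x in \<mu>. \<forall>j. (\<lambda>k. pair (u j k) (x \<otimes>\<^bsub>X\<^esub> inv\<^bsub>X\<^esub> x0)) \<longlonglongrightarrow> 1)"
    using AE_space by eventually_elim (simp add: space_\<mu>)
  then have "\<exists>x0. x0 \<in> carrier X \<and> (AE x in \<mu>. \<forall>j. (\<lambda>k. pair (u j k) (x \<otimes>\<^bsub>X\<^esub> inv\<^bsub>X\<^esub> x0)) \<longlonglongrightarrow> 1)"
    by (rule eventually_happens'[OF ae_filter_bot])
  then show thesis using that by blast
qed

text \<open>The estimate 1 - exp (- 2 C w^2) \<le> 2 C w^2 turns geometric decay of the weights into
  summability.\<close>

lemma summable_of_gaussian_bound:
  assumes u: "\<And>k. u k \<in> Y" and C: "C \<ge> 0"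
    and lower: "\<And>k. exp (- C * (w k)\<^sup>2) \<le> norm (cf \<mu> (u k))" and w: "\<And>k. \<bar>w k\<bar> \<le> c / 2 ^ k"
  shows "summable (\<lambda>k. 1 - (norm (cf \<mu> (u k)))\<^sup>2)"
proof (rule summable_comparison_test')
  show "summable (\<lambda>k. 2 * C * c\<^sup>2 * (1 / 4) ^ k)"
    by (intro summable_mult summable_geometric) simp
  fix k :: nat
  have "(w k)\<^sup>2 \<le> (c / 2 ^ k)\<^sup>2" using w[of k] by (intro power2_le_iff_abs_le[THEN iffD2]) auto
  also have "\<dots> = c\<^sup>2 * (1 / 4) ^ k"
    by (simp add: power_divide power2_eq_square flip: power_mult_distrib)
  finally have wk: "2 * C * (w k)\<^sup>2 \<le> 2 * C * c\<^sup>2 * (1 / 4) ^ k"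
    using C by (simp add: mult_left_mono mult.assoc)
  have "1 - 2 * C * (w k)\<^sup>2 \<le> exp (- C * (w k)\<^sup>2) * exp (- C * (w k)\<^sup>2)"
    using exp_ge_add_one_self[of "- 2 * C * (w k)\<^sup>2"] by (simp add: mult.assoc flip: exp_add)
  also have "\<dots> \<le> norm (cf \<mu> (u k)) * norm (cf \<mu> (u k))"
    using lower by (intro mult_mono) auto
  finally have "1 - (norm (cf \<mu> (u k)))\<^sup>2 \<le> 2 * C * (w k)\<^sup>2" by (simp add: power2_eq_square)
  moreover have "(norm (cf \<mu> (u k)))\<^sup>2 \<le> 1" using norm_cf_le[OF u] by (simp add: power_le_one)
  ultimately show "norm (1 - (norm (cf \<mu> (u k)))\<^sup>2) \<le> 2 * C * c\<^sup>2 * (1 / 4) ^ k" using wk by simp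
qed

end

section \<open>Embedding the real line with a point of order two\<close>

lemma dyadic_cis_eq_1:
  assumes "\<And>k. cis (x / 2 ^ k) = 1"
  shows "x = 0"
proof (rule ccontr)
  assume "x \<noteq> 0"
  obtain k where "(1 / 2 :: real) ^ k < 1 / \<bar>x\<bar>"
    using real_arch_pow_inv[of "1 / \<bar>x\<bar>" "1/2"] \<open>x \<noteq> 0\<close> by auto
  then have less: "\<bar>x / 2 ^ k\<bar> < 1" using \<open>x \<noteq> 0\<close> by (simp add: field_simps)
  obtain n :: int where n: "x / 2 ^ k = of_int n * (2 * pi)"
    using assms[of k] unfolding cis_eq_1_iff_int ..
  have "n \<noteq> 0" using n \<open>x \<noteq> 0\<close> by auto
  then have "1 * 1 \<le> \<bar>of_int n\<bar> * (2 * pi)" using pi_gt3 by (intro mult_mono) auto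
  then show False using less unfolding n by (simp add: abs_mult)
qed

text \<open>Convergence to 1 makes every late term the square root with positive real part of its
  predecessor, so its angle is halved. The finitely many earlier terms follow by squaring.\<close>

lemma dyadic_angle:
  fixes z :: "nat \<Rightarrow> complex"
  assumes norm: "\<And>k. norm (z k) = 1" and square: "\<And>k. (z (Suc k))\<^sup>2 = z k" and lim: "z \<longlonglongrightarrow> 1"
  obtains t where "\<And>k. z k = cis (t / 2 ^ k)"
proof -
  have "(\<lambda>k. Re (z k)) \<longlonglongrightarrow> 1" using tendsto_Re[OF lim] by simp
  then have "\<forall>\<^sub>F k in sequentially. Re (z k) > 0" by (rule order_tendstoD) simp
  then obtain K where K: "\<And>k. k \<ge> K \<Longrightarrow> Re (z k) > 0" by (auto simp: eventually_sequentially)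
  define \<theta> where "\<theta> = Im (Ln (z K))"
  have zK0: "z K \<noteq> 0" using norm[of K] by auto
  have zK: "z K = cis \<theta>"
  proof -
    have "Re (Ln (z K)) = 0" using zK0 norm[of K] by simp
    then have "Ln (z K) = \<i> * of_real \<theta>" by (simp add: complex_eq_iff \<theta>_def)
    then show ?thesis using exp_Ln[OF zK0] by (simp add: cis_conv_exp)
  qed
  have \<theta>: "\<bar>\<theta>\<bar> < pi / 2" unfolding \<theta>_def using Re_Ln_pos_lt[OF zK0] K[of K] by simp
  have up: "z (K + i) = cis (\<theta> / 2 ^ i)" for i
  proof (induction i)
    case (Suc i)
    let ?w = "cis (\<theta> / 2 ^ Suc i)"
    have "?w\<^sup>2 = cis (\<theta> / 2 ^ i)" by (simp add: power2_eq_square cis_mult)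
    then have "(z (K + Suc i))\<^sup>2 = ?w\<^sup>2" using square[of "K + i"] Suc by simp
    then consider "z (K + Suc i) = ?w" | "z (K + Suc i) = - ?w" by (auto simp: power2_eq_iff)
    then show ?case
    proof cases
      \<comment> \<open>The opposite root would have negative real part.\<close>
      case 2
      have "1 \<le> (2::real) ^ Suc i" by (rule one_le_power) simp
      from mult_left_mono[OF this, of "\<bar>\<theta>\<bar>"] have "\<bar>\<theta> / 2 ^ Suc i\<bar> \<le> \<bar>\<theta>\<bar>"
        by (simp add: abs_divide divide_le_eq)
      then have "0 < cos (\<theta> / 2 ^ Suc i)" using \<theta> by (intro cos_gt_zero_pi) linarith+
      then show ?thesis using K[of "K + Suc i"] unfolding 2 by simp
    qed
  qed (simp add: zK)
  define t where "t = \<theta> * 2 ^ K"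
  have down: "j \<le> K \<Longrightarrow> z (K - j) = cis (t / 2 ^ (K - j))" for j
  proof (induction j)
    case (Suc j)
    have eq: "K - j = Suc (K - Suc j)" using Suc(2) by simp
    have "z (K - Suc j) = (cis (t / 2 ^ Suc (K - Suc j)))\<^sup>2"
      using Suc square[of "K - Suc j"] unfolding eq by simp
    also have "\<dots> = cis (t / 2 ^ (K - Suc j))" by (simp add: power2_eq_square cis_mult)
    finally show ?case .
  qed (simp add: zK t_def)
  have "z k = cis (t / 2 ^ k)" for k
  proof (cases "k \<le> K")
    case True
    then show ?thesis using down[of "K - k"] by simp
  next
    case False
    then have "t / 2 ^ k = \<theta> / 2 ^ (k - K)"
      by (simp add: t_def field_simps flip: power_add)
    then show ?thesis using up[of "k - K"] False by simp
  qed
  then show thesis by (rule that)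
qed

text \<open>Recovers t from the character values at 1 / 2 ^ k as a pointwise limit, which keeps the
  recovery measurable.\<close>

lemma power2_times_sin_tendsto:
  fixes t :: real
  shows "(\<lambda>k. 2 ^ k * sin (t / 2 ^ k)) \<longlonglongrightarrow> t"
proof (cases "t = 0")
  case False
  have "((\<lambda>h. sin h / h) \<longlongrightarrow> 1) (at (0::real))"
    using DERIV_sin[of "0::real"] by (simp add: has_field_derivative_iff)
  moreover have "filterlim (\<lambda>k. t / 2 ^ k) (at 0) sequentially"
  proof (rule filterlim_atI)
    have "(\<lambda>k. (1 / 2 :: real) ^ k) \<longlonglongrightarrow> 0" by (rule LIMSEQ_power_zero) simp
    from tendsto_mult[OF tendsto_const[of t] this] show "(\<lambda>k. t / 2 ^ k) \<longlonglongrightarrow> 0"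
      by (simp add: power_divide)
  qed (use False in simp)
  ultimately have "(\<lambda>k. sin (t / 2 ^ k) / (t / 2 ^ k)) \<longlonglongrightarrow> 1" by (rule filterlim_compose)
  from tendsto_mult[OF tendsto_const[of t] this] show ?thesis
    using False by (simp add: mult.commute)
qed simp

section \<open>Maps into and out of R x Z(2), and shifts on X\<close>

lemma continuous_map_imp_measurable:
  assumes "continuous_map T T' f"
  shows "f \<in> measurable (borel_of T) (borel_of T')"
proof (rule measurable_borel_ofI)
  fix U assume "openin T' U"
  then have "openin T {x \<in> topspace T. f x \<in> U}" using assms by (simp add: continuous_map)
  moreover have "{x \<in> topspace T. f x \<in> U} = f -` U \<inter> space (borel_of T)" by auto
  ultimately show "f -` U \<inter> space (borel_of T) \<in> sets (borel_of T)"
    using openin_imp_sets_borel_of by metis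
qed (use assms in \<open>simp add: continuous_map_def\<close>)

lemma carrier_RZ2: "carrier RZ2_group = UNIV \<times> {0, 1}"
  by (auto simp: RZ2_group_def real_group_def integer_mod_group_def)

lemma topspace_RZ2: "topspace RZ2_top = UNIV \<times> {0, 1}"
  by (auto simp: RZ2_top_def integer_mod_group_def)

lemma mult_RZ2: "p \<otimes>\<^bsub>RZ2_group\<^esub> q = (fst p + fst q, (snd p + snd q) mod 2)"
  by (simp add: RZ2_group_def mult_DirProd' real_group_def)

lemma RZ2_char_cis: "k \<in> {0, 1} \<Longrightarrow> l \<in> {0, 1} \<Longrightarrow> RZ2_char s l (t, k) = cis (t * s) * (if k = 1 \<and> l = 1 then - 1 else 1)"
  by (auto simp: RZ2_char_def cis_conv_exp mult.assoc)

lemma continuous_map_into_circle: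
  "continuous_map T circle_top f \<longleftrightarrow> continuous_map T euclidean f \<and> f \<in> topspace T \<rightarrow> sphere 0 1"
  by (simp add: circle_top_def continuous_map_in_subtopology image_subset_iff_funcset)

lemma continuous_map_RZ2_snd:
  "continuous_map RZ2_top euclidean (\<lambda>p. h (snd p))"
proof -
  have "continuous_map (discrete_topology (carrier (integer_mod_group 2))) euclidean h" by simp
  from continuous_map_compose[OF continuous_map_snd this] show ?thesis
    unfolding RZ2_top_def by (simp add: o_def)
qed

lemma continuous_map_RZ2_fst: "continuous_map RZ2_top euclideanreal fst"
  unfolding RZ2_top_def by (rule continuous_map_fst)

lemma continuous_map_RZ2_mult_cis:
  "continuous_map RZ2_top euclidean (\<lambda>p. cis (c * fst p) * h (snd p))"
proof -
  have "continuous_map euclideanreal euclidean (\<lambda>t. cis (c * t))"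
    by (simp add: continuous_intros)
  from continuous_map_compose[OF continuous_map_RZ2_fst this]
  have "continuous_map RZ2_top euclidean (\<lambda>p. cis (c * fst p))" by (simp add: o_def)
  with continuous_map_RZ2_snd[of h] show ?thesis by (simp add: continuous_map_atin tendsto_mult)
qed

lemma measurable_RZ2I:
  assumes t: "t \<in> borel_measurable M" and k: "k \<in> measurable M (count_space UNIV)"
    and k01: "\<And>x. x \<in> space M \<Longrightarrow> k x \<in> {0, 1}"
  shows "(\<lambda>x. (t x, k x)) \<in> measurable M (borel_of RZ2_top)"
proof (rule measurable_borel_ofI)
  fix U assume U: "openin RZ2_top U"
  have sec: "open {s. (s, j) \<in> U}" if "j \<in> {0, 1}" for j
  proof -
    have "continuous_map euclideanreal RZ2_top (\<lambda>s. (s, j))"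
      unfolding RZ2_top_def using that
      by (intro continuous_map_pairedI) (auto simp: integer_mod_group_def)
    then have "openin euclideanreal {s \<in> topspace euclideanreal. (s, j) \<in> U}"
      using U by (simp only: continuous_map)
    then show ?thesis by simp
  qed
  have "(\<lambda>x. (t x, k x)) -` U \<inter> space M
      = (\<Union>j\<in>{0, 1}. (t -` {s. (s, j) \<in> U} \<inter> space M) \<inter> (k -` {j} \<inter> space M))"
  proof (rule Set.set_eqI)
    show "x \<in> (\<lambda>x. (t x, k x)) -` U \<inter> space M \<longleftrightarrow>
      x \<in> (\<Union>j\<in>{0, 1}. (t -` {s. (s, j) \<in> U} \<inter> space M) \<inter> (k -` {j} \<inter> space M))" for x
      by (cases "x \<in> space M") (use k01[of x] in auto)
  qed
  also have "\<dots> \<in> sets M"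
  proof (intro sets.finite_UN)
    fix j :: int assume "j \<in> {0, 1}"
    then show "(t -` {s. (s, j) \<in> U} \<inter> space M) \<inter> (k -` {j} \<inter> space M) \<in> sets M"
      by (intro sets.Int measurable_sets[OF t] measurable_sets[OF k]) (simp_all add: sec)
  qed simp
  finally show "(\<lambda>x. (t x, k x)) -` U \<inter> space M \<in> sets M" .
qed (use k01 in \<open>auto simp: topspace_RZ2\<close>)

context adic begin

lemma measurable_mult_right:
  assumes x: "x \<in> carrier X"
  shows "(\<lambda>y. y \<otimes>\<^bsub>X\<^esub> x) \<in> measurable (borel_of XT) (borel_of XT)"
proof (rule measurable_XI_pair)
  fix w assume w: "w \<in> Y"
  have "(\<lambda>y. pair w y * pair w x) \<in> borel_measurable (borel_of XT)"
    using pair_measurable[OF w] by simp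
  moreover have eq: "pair w (y \<otimes>\<^bsub>X\<^esub> x) = pair w y * pair w x" if "y \<in> space (borel_of XT)" for y
    using that x by (intro pair_mult[OF w]) (auto simp: topspace_X)
  ultimately show "(\<lambda>y. pair w (y \<otimes>\<^bsub>X\<^esub> x)) \<in> borel_measurable (borel_of XT)"
    by (simp only: measurable_cong[OF eq])
qed (use x in \<open>auto simp: topspace_X\<close>)

lemma group_shift_eq_distr:
  assumes \<nu>: "prob_space \<nu>" "sets \<nu> = sets (borel_of XT)" and x: "x \<in> carrier X"
  shows "group_shift X XT \<nu> x = distr \<nu> (borel_of XT) (\<lambda>y. y \<otimes>\<^bsub>X\<^esub> x)"
proof (rule measure_eqI)
  interpret \<nu>: prob_space \<nu> by (rule \<nu>)
  let ?R = "return (borel_of XT) x"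
  interpret R: prob_space ?R by (rule prob_space_return) (simp add: topspace_X x)
  have sp: "space \<nu> = carrier X" using sets_eq_imp_space_eq[OF \<nu>(2)] by (simp add: topspace_X)
  let ?m = "\<lambda>(y, z). y \<otimes>\<^bsub>X\<^esub> z"
  have m: "?m \<in> measurable (\<nu> \<Otimes>\<^sub>M ?R) (borel_of XT)"
  proof (rule measurable_XI_pair)
    fix w assume w: "w \<in> Y"
    have eq: "pair w (?m p) = pair w (fst p) * pair w (snd p)" if "p \<in> space (\<nu> \<Otimes>\<^sub>M ?R)" for p
      using that pair_mult[OF w] by (auto simp: space_pair_measure sp topspace_X)
    have [measurable]: "pair w \<in> borel_measurable \<nu>" "pair w \<in> borel_measurable ?R"
      using pair_measurable[OF w] by (simp_all add: measurable_cong_sets[OF \<nu>(2) refl])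
    have "(\<lambda>p. pair w (fst p) * pair w (snd p)) \<in> borel_measurable (\<nu> \<Otimes>\<^sub>M ?R)" by measurable
    then show "(\<lambda>p. pair w (?m p)) \<in> borel_measurable (\<nu> \<Otimes>\<^sub>M ?R)"
      by (simp only: measurable_cong[OF eq])
  qed (auto simp: space_pair_measure sp topspace_X)
  have mx: "(\<lambda>y. y \<otimes>\<^bsub>X\<^esub> x) \<in> measurable \<nu> (borel_of XT)"
    using measurable_mult_right[OF x] by (simp add: measurable_cong_sets[OF \<nu>(2) refl])
  fix B assume "B \<in> sets (group_shift X XT \<nu> x)"
  then have B: "B \<in> sets (borel_of XT)" by (simp add: group_shift_def group_conv_def)
  let ?Q = "?m -` B \<inter> space (\<nu> \<Otimes>\<^sub>M ?R)"
  have Q: "?Q \<in> sets (\<nu> \<Otimes>\<^sub>M ?R)" by (rule measurable_sets[OF m B])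
  have "emeasure (group_shift X XT \<nu> x) B = emeasure (\<nu> \<Otimes>\<^sub>M ?R) ?Q"
    unfolding group_shift_def group_conv_def by (rule emeasure_distr[OF m B])
  also have "\<dots> = (\<integral>\<^sup>+y. emeasure ?R (Pair y -` ?Q) \<partial>\<nu>)"
    by (rule R.emeasure_pair_measure_alt[OF Q])
  also have "\<dots> = (\<integral>\<^sup>+y. indicator ((\<lambda>y. y \<otimes>\<^bsub>X\<^esub> x) -` B \<inter> space \<nu>) y \<partial>\<nu>)"
  proof (rule nn_integral_cong)
    fix y assume y: "y \<in> space \<nu>"
    have "emeasure ?R (Pair y -` ?Q) = indicator (Pair y -` ?Q) x"
      using sets_Pair1[OF Q, of y] by (intro emeasure_return) simp
    also have "\<dots> = indicator ((\<lambda>y. y \<otimes>\<^bsub>X\<^esub> x) -` B \<inter> space \<nu>) y"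
      using y x by (auto simp: indicator_def space_pair_measure topspace_X)
    finally show "emeasure ?R (Pair y -` ?Q) = indicator ((\<lambda>y. y \<otimes>\<^bsub>X\<^esub> x) -` B \<inter> space \<nu>) y" .
  qed
  also have "\<dots> = emeasure \<nu> ((\<lambda>y. y \<otimes>\<^bsub>X\<^esub> x) -` B \<inter> space \<nu>)"
    by (rule nn_integral_indicator[OF measurable_sets[OF mx B]])
  also have "\<dots> = emeasure (distr \<nu> (borel_of XT) (\<lambda>y. y \<otimes>\<^bsub>X\<^esub> x)) B"
    by (rule emeasure_distr[OF mx B, symmetric])
  finally show "emeasure (group_shift X XT \<nu> x) B = emeasure (distr \<nu> (borel_of XT) (\<lambda>y. y \<otimes>\<^bsub>X\<^esub> x)) B" .
qed (simp add: group_shift_def group_conv_def)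

end

context heyde_data begin

text \<open>The angle slope * t makes a character u restricted to this curve depend only on
  \<open>weight u\<close> and the parity of its second coordinate. The factor 1 / (2 \<pi>) matches
  the normalization exp (2 \<pi> i b t) of the solenoid with exp (i t s) on the line.\<close>

definition phi :: "real \<times> int \<Rightarrow> X_elt" where
  "phi p = (cls (fst p / (2 * pi), \<one>\<^bsub>\<Delta>\<^esub>), cis (slope * fst p) * (if snd p = 1 then - 1 else 1))"

lemma phi_closed: "phi p \<in> carrier X"
  by (simp add: phi_def carrier_X carrier_solenoid norm_mult)

lemma pair_phi:
  assumes u: "u \<in> Y" and p: "p \<in> carrier RZ2_group"
  shows "pair u (phi p) = RZ2_char (weight u) (snd u mod 2) p"
proof -
  obtain s n where u': "u = (s, n)" "s \<in> H" using u by auto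
  obtain t k where p': "p = (t, k)" "k \<in> {0, 1}" using p by (auto simp: carrier_RZ2)
  have sgn: "(if k = 1 then - 1 else 1 :: complex) powi n = (if k = 1 \<and> n mod 2 = 1 then - 1 else 1)"
    by (cases "even n") (auto simp: power_int_minus_left odd_iff_mod_2_eq_one)
  have "n mod 2 \<in> {0, 1}" by auto
  then have "RZ2_char (weight u) (snd u mod 2) p = cis (t * (s + slope * of_int n)) * (if k = 1 \<and> n mod 2 = 1 then - 1 else 1)"
    using p'(2) by (simp only: p' u' snd_conv RZ2_char_cis weight_def fst_conv)
  moreover have "pair u (phi p) = cis (2 * pi * s * (t / (2 * pi))) * (cis (slope * t) * (if k = 1 then - 1 else 1)) powi n"
    using u'(2) by (simp only: pair_def phi_def p' u' fst_conv snd_conv chi_real)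
  moreover have "\<dots> = cis (t * s) * (cis (of_int n * (slope * t)) * (if k = 1 \<and> n mod 2 = 1 then - 1 else 1))"
    unfolding power_int_mult_distrib sgn cis_power_int by (simp add: mult.commute)
  moreover have "cis (t * (s + slope * of_int n)) = cis (t * s) * cis (of_int n * (slope * t))"
    unfolding cis_mult by (simp add: algebra_simps)
  ultimately show ?thesis by (simp only: mult.assoc)
qed

lemma continuous_map_phi: "continuous_map RZ2_top XT phi"
proof -
  have "continuous_map euclideanreal (prod_topology euclideanreal (adic_top a)) (\<lambda>t. (t / (2 * pi), \<one>\<^bsub>\<Delta>\<^esub>))"
  proof (rule continuous_map_pairedI)
    have "continuous_on UNIV (\<lambda>t::real. t / (2 * pi))" by (intro continuous_intros) simp
    then show "continuous_map euclideanreal euclideanreal (\<lambda>t. t / (2 * pi))" by simp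
  qed (simp add: topspace_adic)
  from continuous_map_compose[OF this quotient_imp_continuous_map[OF quotient_map_cls]]
  have "continuous_map euclideanreal (solenoid_top a) (\<lambda>t. cls (t / (2 * pi), \<one>\<^bsub>\<Delta>\<^esub>))" by (simp add: o_def)
  from continuous_map_compose[OF continuous_map_RZ2_fst this]
  have "continuous_map RZ2_top (solenoid_top a) (\<lambda>p. cls (fst p / (2 * pi), \<one>\<^bsub>\<Delta>\<^esub>))" by (simp add: o_def)
  moreover have "continuous_map RZ2_top circle_top (\<lambda>p. cis (slope * fst p) * (if snd p = 1 then - 1 else 1))"
    unfolding continuous_map_into_circle using continuous_map_RZ2_mult_cis by (auto simp: norm_mult)
  ultimately show ?thesis unfolding X_top_def phi_def[abs_def] by (rule continuous_map_pairedI)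
qed

lemma phi_hom: "phi \<in> hom RZ2_group X"
proof (rule homI)
  fix p q assume p: "p \<in> carrier RZ2_group" and q: "q \<in> carrier RZ2_group"
  have "cls (fst p / (2 * pi), \<one>\<^bsub>\<Delta>\<^esub>) \<otimes>\<^bsub>\<Sigma>\<^esub> cls (fst q / (2 * pi), \<one>\<^bsub>\<Delta>\<^esub>) = cls ((fst p + fst q) / (2 * pi), \<one>\<^bsub>\<Delta>\<^esub>)"
    by (subst cls_mult) (simp_all add: add_divide_distrib)
  then show "phi (p \<otimes>\<^bsub>RZ2_group\<^esub> q) = phi p \<otimes>\<^bsub>X\<^esub> phi q"
    using p q by (auto simp: mult_X mult_RZ2 phi_def carrier_RZ2 distrib_left cis_mult)
qed (rule phi_closed)

text \<open>The line does not close up because all 1 / 2 ^ k belong to H and together determine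
  t.\<close>

lemma phi_inj: "inj_on phi (carrier RZ2_group)"
proof (rule inj_onI)
  fix p q assume p: "p \<in> carrier RZ2_group" and q: "q \<in> carrier RZ2_group" and eq: "phi p = phi q"
  have "cis ((fst p - fst q) / 2 ^ k) = 1" for k
  proof -
    have H: "1 / 2 ^ k \<in> H" by (rule H.div_power2[OF one_H])
    have "chi (1 / 2 ^ k) (fst (phi p)) = chi (1 / 2 ^ k) (fst (phi q))" using eq by simp
    then have "cis (fst p / 2 ^ k) = cis (fst q / 2 ^ k)" by (simp add: phi_def chi_real[OF H])
    then show ?thesis by (simp add: diff_divide_distrib flip: cis_divide)
  qed
  then have "fst p - fst q = 0" by (rule dyadic_cis_eq_1)
  then have "fst p = fst q" by simp
  moreover have "snd p = snd q"
    using eq p q \<open>fst p = fst q\<close> by (auto simp: phi_def carrier_RZ2 split: if_splits)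
  ultimately show "p = q" by (rule prod_eqI)
qed

lemma phi_mon: "phi \<in> mon RZ2_group X"
  using phi_hom phi_inj by (simp add: mon_def)

end

lemma RZ2_char_measurable: "RZ2_char s l \<in> borel_measurable (borel_of RZ2_top)"
proof -
  have eq: "RZ2_char s l = (\<lambda>p. cis (s * fst p) * (- 1) ^ nat (snd p * l))"
    by (auto simp: RZ2_char_def cis_conv_exp mult_ac)
  show ?thesis unfolding eq
    by (rule continuous_map_imp_measurable_borel_of[OF continuous_map_RZ2_mult_cis[of s "\<lambda>k. (- 1) ^ nat (k * l)"]])
qed

section \<open>A Borel left inverse of the embedding and concentration on its image\<close>

context heyde_data begin

text \<open>The real coordinate on the image of \<open>phi\<close>. Where the sequence diverges,
  \<open>lim\<close> returns some value that does no harm: the inverse is applied only to points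
  that almost surely lie in the image.\<close>

definition angle :: "X_elt \<Rightarrow> real" where
  "angle y = lim (\<lambda>k. 2 ^ k * Im (chi (1 / 2 ^ k) (fst y)))"

text \<open>On the image of \<open>phi\<close> the product under \<open>Re\<close> is 1 or -1.
  Testing its sign gives a Borel map on all of X whose second coordinate is always 0 or 1, so
  measures can be transported without discussing the image as a set.\<close>

definition psi :: "X_elt \<Rightarrow> real \<times> int" where
  "psi y = (angle y, if Re (snd y * cis (- (slope * angle y))) > 0 then 0 else 1)"

lemma psi_phi:
  assumes p: "p \<in> carrier RZ2_group"
  shows "psi (phi p) = p"
proof -
  have "chi (1 / 2 ^ k) (fst (phi p)) = cis (fst p / 2 ^ k)" for k
    unfolding phi_def fst_conv chi_real[OF H.div_power2[OF one_H]] by simp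
  then have T: "angle (phi p) = fst p"
    unfolding angle_def using power2_times_sin_tendsto[of "fst p"] by (simp add: limI)
  have "snd (phi p) * cis (- (slope * fst p)) = (if snd p = 1 then - 1 else 1)"
    by (simp add: phi_def cis_mult)
  then show ?thesis using p unfolding psi_def T by (auto simp: carrier_RZ2)
qed

lemma angle_measurable: "angle \<in> borel_measurable (borel_of XT)"
proof -
  have "pair (1 / 2 ^ k, 0) \<in> borel_measurable (borel_of XT)" for k
    by (rule pair_measurable) (simp add: H.div_power2[OF one_H])
  then have "(\<lambda>y. chi (1 / 2 ^ k) (fst y)) \<in> borel_measurable (borel_of XT)" for k
    by (simp add: pair_def[abs_def])
  then show ?thesis
    unfolding angle_def[abs_def] by (intro borel_measurable_lim_metric) simp
qed

lemma psi_measurable: "psi \<in> measurable (borel_of XT) (borel_of RZ2_top)"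
  unfolding psi_def[abs_def]
proof (rule measurable_RZ2I)
  note [measurable] = angle_measurable
  have [measurable]: "snd \<in> borel_measurable (borel_of XT)"
    by (rule continuous_map_imp_measurable_borel_of[OF continuous_map_snd_X])
  have [measurable]: "cis \<in> borel_measurable borel"
    by (intro borel_measurable_continuous_onI continuous_intros)
  show "(\<lambda>y. if Re (snd y * cis (- (slope * angle y))) > 0 then 0 else 1 :: int) \<in> measurable (borel_of XT) (count_space UNIV)"
    by measurable
qed (use angle_measurable in auto)

text \<open>Each h whose dyadic fractions converge to 1 gets an angle from
  \<open>dyadic_angle\<close>. Comparing h = 1 with the generators 1 / N shows that all angles come
  from one real t, so the solenoid coordinate lies on the line. As s k tends to - 2 slope, the
  characters (s k, 2) determine the square of the circle coordinate, and two signs remain.\<close>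

lemma image_phi:
  assumes y: "y \<in> carrier X" and s: "\<And>k. s k \<in> H" and w: "(\<lambda>k. weight (s k, 2)) \<longlonglongrightarrow> 0"
    and lim0: "(\<lambda>k. pair (s k, 2) y) \<longlonglongrightarrow> 1"
    and lim1: "(\<lambda>k. pair (1 / 2 ^ k, 0) y) \<longlonglongrightarrow> 1"
    and lim2: "\<And>j. (\<lambda>k. pair (1 / real (N (Suc j)) / 2 ^ k, 0) y) \<longlonglongrightarrow> 1"
  obtains p where "p \<in> carrier RZ2_group" "phi p = y"
proof -
  obtain g z where y': "y = (g, z)" "g \<in> carrier \<Sigma>" "norm z = 1" using y by (auto simp: carrier_X)
  have ang: "\<exists>t. \<forall>k. chi (h / 2 ^ k) g = cis (t / 2 ^ k)"
    if h: "h \<in> H" and lim: "(\<lambda>k. pair (h / 2 ^ k, 0) y) \<longlonglongrightarrow> 1" for h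
  proof -
    note hk = H.div_power2[OF h]
    obtain t where "\<And>k. chi (h / 2 ^ k) g = cis (t / 2 ^ k)"
    proof (rule dyadic_angle[of "\<lambda>k. chi (h / 2 ^ k) g"])
      show "norm (chi (h / 2 ^ k) g) = 1" for k by (rule norm_chi[OF hk y'(2)])
      show "(chi (h / 2 ^ Suc k) g)\<^sup>2 = chi (h / 2 ^ k) g" for k
        using chi_add[OF hk hk y'(2), of "Suc k" "Suc k"] by (simp add: power2_eq_square)
      show "(\<lambda>k. chi (h / 2 ^ k) g) \<longlonglongrightarrow> 1" using lim by (simp add: pair_def y')
    qed (rule that)
    then show ?thesis by blast
  qed
  obtain t where t: "\<And>k. chi (1 / 2 ^ k) g = cis (t / 2 ^ k)" using ang[OF one_H] lim1 by auto
  have chiN: "chi (1 / real (N (Suc j))) g = cis (1 / real (N (Suc j)) * t)" for j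
  proof -
    let ?n = "N (Suc j)"
    obtain t' where t': "\<And>k. chi (1 / real ?n / 2 ^ k) g = cis (t' / 2 ^ k)"
      using ang[OF inv_N_H lim2] by blast
    have "cis ((real ?n * t' - t) / 2 ^ k) = 1" for k
    proof -
      have "cis (real ?n * (t' / 2 ^ k)) = chi (1 / real ?n / 2 ^ k) g ^ ?n"
        unfolding t' by (rule Complex.DeMoivre[symmetric])
      also have "\<dots> = chi (of_nat ?n * (1 / real ?n / 2 ^ k)) g"
        using chi_power chi_nat_pow H.div_power2[OF inv_N_H] y'(2) by metis
      also have "of_nat ?n * (1 / real ?n / 2 ^ k) = 1 / 2 ^ k" by simp
      finally have "cis (real ?n * (t' / 2 ^ k)) = cis (t / 2 ^ k)" unfolding t .
      then show ?thesis by (simp add: diff_divide_distrib flip: cis_divide)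
    qed
    then have "real ?n * t' - t = 0" by (rule dyadic_cis_eq_1)
    then have "t' = 1 / real ?n * t" by (simp add: field_simps)
    then show ?thesis using t'[of 0] by simp
  qed
  let ?g = "cls (t / (2 * pi), \<one>\<^bsub>\<Delta>\<^esub>)"
  have g: "g = ?g"
  proof (rule chi_separates[OF y'(2)])
    show "chi (1 / real (N (Suc n))) g = chi (1 / real (N (Suc n))) ?g" for n
      unfolding chiN chi_real[OF inv_N_H] by simp
  qed (simp add: carrier_solenoid)
  have chis: "chi h g = cis (h * t)" if "h \<in> H" for h
    unfolding g chi_real[OF that] by simp
  have "(\<lambda>k. cis (s k * t) * z\<^sup>2) \<longlonglongrightarrow> 1"
    using lim0 by (simp add: pair_def y' chis s)
  moreover have "(\<lambda>k. cis (s k * t)) \<longlonglongrightarrow> cis (- (2 * slope * t))"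
  proof -
    have "(\<lambda>k. weight (s k, 2) - 2 * slope) \<longlonglongrightarrow> 0 - 2 * slope" by (intro tendsto_intros w)
    then have "s \<longlonglongrightarrow> - (2 * slope)" by (simp add: weight_def)
    then have lim: "(\<lambda>k. s k * t) \<longlonglongrightarrow> - (2 * slope * t)"
      using tendsto_mult_right[of s "- (2 * slope)" sequentially t] by simp
    have "isCont cis x" for x
      using continuous_on_cis[OF continuous_on_id, of UNIV] by (simp add: continuous_on_eq_continuous_at)
    from isCont_tendsto_compose[OF this lim] show ?thesis .
  qed
  then have "(\<lambda>k. cis (s k * t) * z\<^sup>2) \<longlonglongrightarrow> cis (- (2 * slope * t)) * z\<^sup>2"
    by (rule tendsto_mult[OF _ tendsto_const])
  ultimately have "cis (- (2 * slope * t)) * z\<^sup>2 = 1" by (metis LIMSEQ_unique)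
  moreover have "(cis (- (slope * t)))\<^sup>2 = cis (- (2 * slope * t))"
    by (simp add: power2_eq_square cis_mult mult_ac)
  ultimately have "(cis (- (slope * t)) * z)\<^sup>2 = 1" unfolding power_mult_distrib by simp
  then consider "cis (- (slope * t)) * z = 1" | "cis (- (slope * t)) * z = - 1" by (auto simp: power2_eq_1_iff)
  then show thesis
  proof cases
    case 1
    then have "cis (slope * t) * (cis (- (slope * t)) * z) = cis (slope * t)" by simp
    then have "z = cis (slope * t)" by (simp add: cis_mult flip: mult.assoc)
    then show thesis by (intro that[of "(t, 0)"]) (auto simp: phi_def y' g carrier_RZ2)
  next
    case 2
    then have "cis (slope * t) * (cis (- (slope * t)) * z) = - cis (slope * t)" by simp
    then have "z = - cis (slope * t)" by (simp add: cis_mult flip: mult.assoc)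
    then show thesis by (intro that[of "(t, 1)"]) (auto simp: phi_def y' g carrier_RZ2)
  qed
qed

text \<open>The lower bound applies to countably many sequences of characters whose weights are at
  most 2^(-k), so a single shift makes all of them converge to 1 almost surely.
  \<open>image_phi\<close> then locates the shifted law, and \<open>psi\<close> carries it to R x
  Z(2).\<close>

lemma representation:
  assumes \<mu>: "X_prob a \<mu>" and C: "C \<ge> 0"
    and lower: "\<And>u. u \<in> Y \<Longrightarrow> even (snd u) \<Longrightarrow> exp (- C * (weight u)\<^sup>2) \<le> norm (cf \<mu> u)"
  obtains x0 M where "x0 \<in> carrier X" "prob_space M" "sets M = sets (borel_of RZ2_top)"
    "\<mu> = group_shift X XT (distr M (borel_of XT) phi) x0"
    "\<And>u. u \<in> Y \<Longrightarrow> cf \<mu> u = pair u x0 * char_fun M (RZ2_char (weight u) (snd u mod 2))"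
proof -
  interpret X_prob a \<mu> by (rule \<mu>)
  have "\<exists>s. s \<in> H \<and> \<bar>s + 2 * slope\<bar> < 1 / 2 ^ k" for k
    using H.dense_multiples[of 1 "1 / 2 ^ k" "- 2 * slope"] one_H by (auto simp: add.commute)
  then obtain s where s: "\<And>k. s k \<in> H" "\<And>k. \<bar>s k + 2 * slope\<bar> < 1 / 2 ^ k" by metis
  define h where "h j = (if j = 0 then 1 else 1 / real (N j))" for j
  have hH: "h j \<in> H" for j using one_H inv_N_H[of "j - 1"] by (cases j) (simp_all add: h_def del: of_nat_Suc)
  have h1: "\<bar>h j\<bar> \<le> 1" for j
  proof -
    have "1 \<le> N j" using N_pos[of j] by linarith
    then show ?thesis by (auto simp: h_def)
  qed
  \<comment> \<open>Row 0 is the family with second coordinate 2, row 1 the dyadic fractions of 1,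
    and row j + 2 those of \<open>1 / N (Suc j)\<close>: the three hypotheses of
    \<open>image_phi\<close>.\<close>
  define u where "u j k = (if j = 0 then (s k, 2) else (h (j - 1) / 2 ^ k, 0 :: int))" for j k :: nat
  have uY: "u j k \<in> Y" for j k using s hH H.div_power2 by (simp add: u_def)
  have wu: "\<bar>weight (u j k)\<bar> \<le> 1 / 2 ^ k" for j k
    using s(2)[of k] h1[of "j - 1"] by (auto simp: u_def weight_def abs_divide mult.commute intro: divide_right_mono less_imp_le)
  have ev: "even (snd (u j k))" for j k by (simp add: u_def)
  have "summable (\<lambda>k. 1 - (norm (cf \<mu> (u j k)))\<^sup>2)" for j
    by (rule summable_of_gaussian_bound[OF uY C lower[OF uY ev] wu])
  then obtain x0 where x0: "x0 \<in> carrier X"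
    "AE x in \<mu>. \<forall>j. (\<lambda>k. pair (u j k) (x \<otimes>\<^bsub>X\<^esub> inv\<^bsub>X\<^esub> x0)) \<longlonglongrightarrow> 1"
    using concentration[of u] uY by auto
  define \<psi> where "\<psi> x = psi (x \<otimes>\<^bsub>X\<^esub> inv\<^bsub>X\<^esub> x0)" for x
  define M where "M = distr \<mu> (borel_of RZ2_top) \<psi>"
  have \<psi>m: "\<psi> \<in> measurable \<mu> (borel_of RZ2_top)"
    unfolding \<psi>_def[abs_def] measurable_cong_sets[OF sets_\<mu> refl]
    by (rule measurable_compose[OF measurable_mult_right psi_measurable]) (simp add: x0)
  have phim: "phi \<in> measurable (borel_of RZ2_top) (borel_of XT)"
    by (rule continuous_map_imp_measurable[OF continuous_map_phi])
  have AE: "AE x in \<mu>. \<psi> x \<in> carrier RZ2_group \<and> x = phi (\<psi> x) \<otimes>\<^bsub>X\<^esub> x0"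
    using x0(2) AE_space
  proof eventually_elim
    case (elim x)
    then have x: "x \<in> carrier X" by (simp add: space_\<mu>)
    let ?y = "x \<otimes>\<^bsub>X\<^esub> inv\<^bsub>X\<^esub> x0"
    have y: "?y \<in> carrier X" using x x0(1) by simp
    obtain p where p: "p \<in> carrier RZ2_group" "phi p = ?y"
    proof (rule image_phi[OF y s(1)])
      have "(\<lambda>k. (1 / 2 :: real) ^ k) \<longlonglongrightarrow> 0" by (rule LIMSEQ_power_zero) simp
      then have z: "(\<lambda>k. 1 / 2 ^ k :: real) \<longlonglongrightarrow> 0" by (simp add: power_one_over)
      have "\<forall>k. norm (weight (s k, 2)) \<le> 1 / 2 ^ k" using wu[of 0] by (simp add: u_def)
      then show "(\<lambda>k. weight (s k, 2)) \<longlonglongrightarrow> 0"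
        by (intro Lim_null_comparison[OF _ z]) auto
      show "(\<lambda>k. pair (s k, 2) ?y) \<longlonglongrightarrow> 1" using elim(1)[THEN spec, of 0] by (simp add: u_def)
      show "(\<lambda>k. pair (1 / 2 ^ k, 0) ?y) \<longlonglongrightarrow> 1" using elim(1)[THEN spec, of 1] by (simp add: u_def h_def)
      show "(\<lambda>k. pair (1 / real (N (Suc j)) / 2 ^ k, 0) ?y) \<longlonglongrightarrow> 1" for j
        using elim(1)[THEN spec, of "Suc (Suc j)"] by (simp add: u_def h_def)
    qed (rule that)
    have "\<psi> x = p" unfolding \<psi>_def p(2)[symmetric] by (rule psi_phi[OF p(1)])
    then show ?case using p x x0(1) by (simp add: X.m_assoc)
  qed
  have Mp: "prob_space M" unfolding M_def by (rule prob_space_distr[OF \<psi>m])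
  have Ms: "sets M = sets (borel_of RZ2_top)" by (simp add: M_def)
  have phiM: "phi \<in> measurable M (borel_of XT)" using phim by (simp add: M_def)
  have "group_shift X XT (distr M (borel_of XT) phi) x0
      = distr (distr M (borel_of XT) phi) (borel_of XT) (\<lambda>y. y \<otimes>\<^bsub>X\<^esub> x0)"
    by (rule group_shift_eq_distr) (auto simp: x0 intro: prob_space.prob_space_distr[OF Mp phiM])
  also have "\<dots> = distr \<mu> (borel_of XT) (\<lambda>x. phi (\<psi> x) \<otimes>\<^bsub>X\<^esub> x0)"
    unfolding M_def using phim \<psi>m measurable_mult_right[OF x0(1)]
    by (simp add: distr_distr o_def measurable_compose[OF \<psi>m phim])
  also have "\<dots> = distr \<mu> (borel_of XT) (\<lambda>x. x)"
  proof (rule distr_cong_AE[OF refl refl])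
    show "AE x in \<mu>. phi (\<psi> x) \<otimes>\<^bsub>X\<^esub> x0 = x" using AE by eventually_elim simp
    show "(\<lambda>x. phi (\<psi> x) \<otimes>\<^bsub>X\<^esub> x0) \<in> measurable \<mu> (borel_of XT)"
      by (rule measurable_compose[OF measurable_compose[OF \<psi>m phim] measurable_mult_right[OF x0(1)]])
  qed (simp add: measurable_cong_sets[OF sets_\<mu> refl])
  also have "\<dots> = \<mu>" by (rule distr_id2) (simp add: sets_\<mu>)
  finally have shift: "\<mu> = group_shift X XT (distr M (borel_of XT) phi) x0" by simp
  have cf: "cf \<mu> u = pair u x0 * char_fun M (RZ2_char (weight u) (snd u mod 2))" if u: "u \<in> Y" for u
  proof -
    let ?c = "RZ2_char (weight u) (snd u mod 2)"
    have "cf \<mu> u = (\<integral>x. pair u x0 * ?c (\<psi> x) \<partial>\<mu>)"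
      unfolding cf_def char_fun_def
    proof (rule integral_cong_AE)
      show "(\<lambda>x. pair u x0 * ?c (\<psi> x)) \<in> borel_measurable \<mu>"
        using measurable_compose[OF \<psi>m RZ2_char_measurable] by simp
      show "AE x in \<mu>. pair u x = pair u x0 * ?c (\<psi> x)"
        using AE
      proof eventually_elim
        case (elim x)
        then have "pair u x = pair u (phi (\<psi> x) \<otimes>\<^bsub>X\<^esub> x0)" by simp
        also have "\<dots> = pair u (phi (\<psi> x)) * pair u x0" by (rule pair_mult[OF u phi_closed x0(1)])
        also have "pair u (phi (\<psi> x)) = ?c (\<psi> x)" using elim by (intro pair_phi[OF u]) simp
        finally show ?case by simp
      qed
    qed (rule pair_meas[OF u])
    also have "\<dots> = pair u x0 * (\<integral>x. ?c (\<psi> x) \<partial>\<mu>)" by simp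
    also have "(\<integral>x. ?c (\<psi> x) \<partial>\<mu>) = char_fun M ?c"
      unfolding M_def char_fun_def by (rule integral_distr[OF \<psi>m RZ2_char_measurable, symmetric])
    finally show ?thesis .
  qed
  show thesis by (rule that[OF x0(1) Mp Ms shift cf])
qed

section \<open>The subgroup G and the case r > 0\<close>

lemma generate_order_2: "G_subgroup a = {\<one>\<^bsub>X\<^esub>, (\<one>\<^bsub>\<Sigma>\<^esub>, - 1)}"
proof -
  let ?g = "(\<one>\<^bsub>\<Sigma>\<^esub>, - 1 :: complex)"
  have g: "?g \<in> carrier X" "?g \<noteq> \<one>\<^bsub>X\<^esub>" "?g \<otimes>\<^bsub>X\<^esub> ?g = \<one>\<^bsub>X\<^esub>"
    by (auto simp: carrier_X one_X mult_X)
  have pow2: "x [^]\<^bsub>X\<^esub> (2::nat) = x \<otimes>\<^bsub>X\<^esub> x" if "x \<in> carrier X" for x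
    using that by (simp add: numeral_2_eq_2)
  have "{x \<in> carrier X. X.ord x = 2} = {?g}"
  proof (intro equalityI subsetI)
    fix x assume "x \<in> {x \<in> carrier X. X.ord x = 2}"
    then have x: "x \<in> carrier X" "X.ord x = 2" by auto
    have "x [^]\<^bsub>X\<^esub> X.ord x = \<one>\<^bsub>X\<^esub>" by (rule X.pow_ord_eq_1[OF x(1)])
    then have xx: "x \<otimes>\<^bsub>X\<^esub> x = \<one>\<^bsub>X\<^esub>" unfolding x(2) pow2[OF x(1)] .
    have f: "fst x \<in> carrier \<Sigma>" using x(1) by (simp add: carrier_X mem_Times_iff)
    have "fst x [^]\<^bsub>\<Sigma>\<^esub> (2::nat) = fst x \<otimes>\<^bsub>\<Sigma>\<^esub> fst x" using f by (simp add: numeral_2_eq_2)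
    also have "\<dots> = \<one>\<^bsub>\<Sigma>\<^esub>" using arg_cong[OF xx, of fst] by (simp add: mult_X one_X)
    finally have "fst x = \<one>\<^bsub>\<Sigma>\<^esub>" by (rule square_eq_one[OF f])
    moreover have "snd x * snd x = 1" using arg_cong[OF xx, of snd] by (simp add: mult_X one_X)
    then have "snd x = 1 \<or> snd x = - 1" by (simp add: square_eq_1_iff)
    moreover have "x \<noteq> \<one>\<^bsub>X\<^esub>" using x(2) X.ord_eq_1[OF x(1)] by auto
    ultimately show "x \<in> {?g}" by (cases x) (auto simp: one_X)
  next
    fix x assume "x \<in> {?g}"
    then have x: "x = ?g" by simp
    have "X.ord ?g dvd 2" using pow2[OF g(1)] g(3) X.pow_eq_id[OF g(1)] by simp
    moreover have "X.ord ?g \<noteq> 1" using X.ord_eq_1[OF g(1)] g(2) by simp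
    ultimately have "X.ord ?g = 2" using two_is_prime_nat by (metis prime_nat_iff)
    then show "x \<in> {x \<in> carrier X. X.ord x = 2}" using g(1) x by simp
  qed
  then have G: "G_subgroup a = generate X {?g}" by (simp add: G_subgroup_def)
  show ?thesis unfolding G
  proof (intro equalityI subsetI)
    fix x assume "x \<in> generate X {?g}"
    then show "x \<in> {\<one>\<^bsub>X\<^esub>, ?g}"
    proof induction
      case (inv h)
      then show ?case using g X.inv_equality[OF g(3)] by simp
    next
      case (eng h1 h2)
      then show ?case using g by auto
    qed auto
  next
    fix x assume "x \<in> {\<one>\<^bsub>X\<^esub>, ?g}"
    then show "x \<in> generate X {?g}" by (auto intro: generate.intros)
  qed
qed

text \<open>With modulus 1 even constant sequences are summable, so a single shift makes each chosen
  character equal to 1 almost surely. The characters (1 / N, 0) annihilate the solenoid coordinate,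
  and (0, 2) leaves a sign in the circle.\<close>

lemma supported:
  assumes \<mu>: "X_prob a \<mu>" and cf: "\<And>u. u \<in> Y \<Longrightarrow> even (snd u) \<Longrightarrow> norm (cf \<mu> u) = 1"
  shows "\<exists>x\<in>carrier X. supported_in (group_shift X XT \<mu> x) (G_subgroup a)"
proof -
  interpret X_prob a \<mu> by (rule \<mu>)
  define u where "u j k = (if j = 0 then (0, 2) else (1 / real (N j), 0 :: int))" for j k :: nat
  have uY: "u j k \<in> Y" for j k
    using inv_N_H[of "j - 1"] H.zero by (cases j) (simp_all add: u_def del: of_nat_Suc)
  have "norm (cf \<mu> (u j k)) = 1" for j k by (rule cf[OF uY]) (simp add: u_def)
  then have "summable (\<lambda>k. 1 - (norm (cf \<mu> (u j k)))\<^sup>2)" for j by simp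
  then obtain x0 where x0: "x0 \<in> carrier X"
    "AE x in \<mu>. \<forall>j. (\<lambda>k. pair (u j k) (x \<otimes>\<^bsub>X\<^esub> inv\<^bsub>X\<^esub> x0)) \<longlonglongrightarrow> 1"
    using concentration[of u] uY by auto
  let ?x = "inv\<^bsub>X\<^esub> x0"
  have x: "?x \<in> carrier X" using x0(1) by simp
  have AE: "AE x in \<mu>. x \<otimes>\<^bsub>X\<^esub> ?x \<in> G_subgroup a"
    using x0(2) AE_space
  proof eventually_elim
    case (elim y)
    let ?y = "y \<otimes>\<^bsub>X\<^esub> ?x"
    have y: "?y \<in> carrier X" using elim(2) x by (simp add: space_\<mu>)
    have all: "pair (u j 0) ?y = 1" for j
    proof -
      have "(\<lambda>k. pair (u j 0) ?y) \<longlonglongrightarrow> 1"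
        using elim(1)[THEN spec, of j] by (simp add: u_def)
      then show ?thesis by (simp add: LIMSEQ_const_iff)
    qed
    have p0: "pair (0, 2) ?y = 1" using all[of 0] by (simp add: u_def)
    have pj: "pair (1 / real (N (Suc n)), 0) ?y = 1" for n using all[of "Suc n"] by (simp add: u_def)
    have "fst ?y = \<one>\<^bsub>\<Sigma>\<^esub>"
      by (rule chi_eq_1_imp_one) (use y pj in \<open>auto simp: carrier_X pair_def\<close>)
    moreover have "(snd ?y)\<^sup>2 = 1" using p0 y by (auto simp: pair_def carrier_X chi_0)
    ultimately show ?case
      unfolding generate_order_2 by (cases ?y) (auto simp: one_X power2_eq_1_iff)
  qed
  have eq: "group_shift X XT \<mu> ?x = distr \<mu> (borel_of XT) (\<lambda>y. y \<otimes>\<^bsub>X\<^esub> ?x)"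
    by (rule group_shift_eq_distr[OF _ sets_\<mu> x]) unfold_locales
  have m: "(\<lambda>y. y \<otimes>\<^bsub>X\<^esub> ?x) \<in> measurable \<mu> (borel_of XT)"
    using measurable_mult_right[OF x] by (simp add: measurable_cong_sets[OF sets_\<mu> refl])
  have "{z} \<in> sets (borel_of XT)" if "z \<in> carrier X" for z
    by (rule closedin_imp_sets_borel_of[OF closedin_singleton_X[OF that]])
  from sets.Un[OF this this, of "\<one>\<^bsub>X\<^esub>" "(\<one>\<^bsub>\<Sigma>\<^esub>, - 1)"]
  have G: "G_subgroup a \<in> sets (borel_of XT)"
    unfolding generate_order_2 by (simp add: carrier_X one_X insert_commute)
  have "supported_in (group_shift X XT \<mu> ?x) (G_subgroup a)"
    unfolding supported_in_def eq
  proof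
    let ?D = "distr \<mu> (borel_of XT) (\<lambda>y. y \<otimes>\<^bsub>X\<^esub> ?x)"
    have D: "space ?D - G_subgroup a \<in> sets (borel_of XT)" using sets.compl_sets[OF G] by simp
    have pre: "(\<lambda>y. y \<otimes>\<^bsub>X\<^esub> ?x) -` (space ?D - G_subgroup a) \<inter> space \<mu> = {y \<in> space \<mu>. y \<otimes>\<^bsub>X\<^esub> ?x \<notin> G_subgroup a}"
      using measurable_space[OF m] by auto
    have "emeasure ?D (space ?D - G_subgroup a) = emeasure \<mu> {y \<in> space \<mu>. y \<otimes>\<^bsub>X\<^esub> ?x \<notin> G_subgroup a}"
      unfolding emeasure_distr[OF m D] pre ..
    also have "\<dots> = 0"
      using AE measurable_sets[OF m D] unfolding pre by (simp add: AE_iff_measurable[OF _ refl])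
    finally show "emeasure ?D (space ?D - G_subgroup a) = 0" .
  qed (simp add: G)
  then show ?thesis using x by blast
qed

end

section \<open>The class Theta\<close>

lemma quadratic_bounded_above:
  fixes a b K :: real
  assumes "\<And>x. a * x\<^sup>2 + b * x \<le> K"
  shows "a \<le> 0" "a = 0 \<Longrightarrow> b = 0"
proof -
  show "a \<le> 0"
  proof (rule ccontr)
    assume "\<not> a \<le> 0"
    then have a: "a > 0" by simp
    \<comment> \<open>Then a y = |K| + 1 + a exceeds K, and the sign of x below makes b x
      nonnegative.\<close>
    define y where "y = (\<bar>K\<bar> + 1) / a + 1"
    have y: "y \<ge> 1" using a by (simp add: y_def)
    define x where "x = (if b \<ge> 0 then y else - y)"
    have "0 \<le> b * x" using y by (auto simp: x_def mult_nonpos_nonneg)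
    moreover have "y * 1 \<le> y * y" using y by (intro mult_left_mono) auto
    then have "a * y \<le> a * x\<^sup>2" using a by (simp add: x_def power2_eq_square)
    moreover have "a * y = \<bar>K\<bar> + 1 + a" using a by (simp add: y_def field_simps)
    ultimately have "K < a * x\<^sup>2 + b * x" using a by linarith
    then show False using assms[of x] by linarith
  qed
  show "b = 0" if "a = 0"
    using assms[of "(K + 1) / b"] that by (cases "b = 0") auto
qed

text \<open>At \<epsilon> = 1, with x varying, the quadratic exponents give \<sigma>' \<le>
  \<sigma>, and \<beta> = \<beta>' if equality holds. A particular \<epsilon> excludes \<sigma>' = 0
  < \<sigma>. The limit \<epsilon> \<rightarrow> 0 at the best x gives the sharp bound on
  \<kappa>.\<close>

lemma gaussian_domination_parameters:
  fixes \<sigma> \<sigma>' \<beta> \<beta>' \<kappa> :: real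
  assumes \<sigma>: "\<sigma> \<ge> 0" "\<sigma>' \<ge> 0" and \<kappa>: "\<kappa> \<noteq> 0" "\<bar>\<kappa>\<bar> \<le> 1"
    and dom: "\<And>\<epsilon> x. \<epsilon> > 0 \<Longrightarrow> \<bar>\<kappa>\<bar> * sqrt (\<sigma> + \<epsilon>) * exp (- (\<beta>' - x)\<^sup>2 / (4 * (\<sigma>' + \<epsilon>)))
      \<le> sqrt (\<sigma>' + \<epsilon>) * exp (- (\<beta> - x)\<^sup>2 / (4 * (\<sigma> + \<epsilon>)))"
  shows "(0 < \<sigma>' \<and> \<sigma>' < \<sigma> \<and> 0 < \<bar>\<kappa>\<bar> \<and>
            \<bar>\<kappa>\<bar> \<le> sqrt (\<sigma>' / \<sigma>) * exp (- ((\<beta> - \<beta>')\<^sup>2 / (4 * (\<sigma> - \<sigma>'))))) \<or>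
         (\<sigma> = \<sigma>' \<and> \<beta> = \<beta>' \<and> \<bar>\<kappa>\<bar> \<le> 1)"
proof -
  define p q where "p = 1 / (4 * (\<sigma> + 1))" and "q = 1 / (4 * (\<sigma>' + 1))"
  have pq: "p > 0" "q > 0" using \<sigma> by (simp_all add: p_def q_def)
  have quad: "(p - q) * x\<^sup>2 + (2 * q * \<beta>' - 2 * p * \<beta>) * x
      \<le> ln (sqrt (\<sigma>' + 1)) - ln (\<bar>\<kappa>\<bar> * sqrt (\<sigma> + 1)) - p * \<beta>\<^sup>2 + q * \<beta>'\<^sup>2" for x
  proof -
    have pos: "\<bar>\<kappa>\<bar> * sqrt (\<sigma> + 1) > 0" "sqrt (\<sigma>' + 1) > 0" using \<sigma> \<kappa> by simp_all
    have "ln (\<bar>\<kappa>\<bar> * sqrt (\<sigma> + 1) * exp (- q * (\<beta>' - x)\<^sup>2)) \<le> ln (sqrt (\<sigma>' + 1) * exp (- p * (\<beta> - x)\<^sup>2))"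
      using dom[of 1 x] pos by (subst ln_le_cancel_iff) (auto simp: p_def q_def)
    then have "ln (\<bar>\<kappa>\<bar> * sqrt (\<sigma> + 1)) + - q * (\<beta>' - x)\<^sup>2 \<le> ln (sqrt (\<sigma>' + 1)) + - p * (\<beta> - x)\<^sup>2"
      using pos by (simp only: ln_mult_pos exp_gt_zero ln_exp)
    then show ?thesis by (simp add: power2_eq_square algebra_simps)
  qed
  note qb = quadratic_bounded_above[OF quad]
  have le: "\<sigma>' \<le> \<sigma>"
  proof -
    have "p \<le> q" using qb(1) by simp
    then show ?thesis using \<sigma> by (simp add: p_def q_def field_simps)
  qed
  show ?thesis
  proof (cases "\<sigma> = \<sigma>'")
    case True
    then have "p = q" by (simp add: p_def q_def)
    then have "2 * p * \<beta>' - 2 * p * \<beta> = 0" using qb(2) by simp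
    then have "\<beta> = \<beta>'" using pq by simp
    then show ?thesis using True \<kappa> by simp
  next
    case False
    then have less: "\<sigma>' < \<sigma>" using le by simp
    have "\<sigma>' \<noteq> 0"
    proof
      assume 0: "\<sigma>' = 0"
      \<comment> \<open>For \<sigma>' = 0 and x = \<beta>' the inequality implies \<kappa>^2
        (\<sigma> + \<epsilon>) \<le> \<epsilon>, while this choice makes \<kappa>^2 \<sigma> = 2
        \<epsilon>.\<close>
      define \<epsilon> where "\<epsilon> = \<kappa>\<^sup>2 * \<sigma> / 2"
      have \<epsilon>: "\<epsilon> > 0" using less 0 \<kappa> by (simp add: \<epsilon>_def)
      have "\<bar>\<kappa>\<bar> * sqrt (\<sigma> + \<epsilon>) \<le> sqrt \<epsilon> * exp (- (\<beta> - \<beta>')\<^sup>2 / (4 * (\<sigma> + \<epsilon>)))"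
        using dom[OF \<epsilon>, of \<beta>'] 0 by simp
      also have "\<dots> \<le> sqrt \<epsilon> * 1" using \<epsilon> \<sigma> by (intro mult_left_mono) auto
      finally have "(\<bar>\<kappa>\<bar> * sqrt (\<sigma> + \<epsilon>))\<^sup>2 \<le> (sqrt \<epsilon>)\<^sup>2" using \<epsilon> \<sigma> by (intro power_mono) auto
      then have "\<kappa>\<^sup>2 * \<sigma> + \<kappa>\<^sup>2 * \<epsilon> \<le> \<epsilon>" using \<epsilon> \<sigma> by (simp add: power_mult_distrib distrib_left)
      moreover have "0 \<le> \<kappa>\<^sup>2 * \<epsilon>" using \<epsilon> by simp
      moreover have "\<kappa>\<^sup>2 * \<sigma> = 2 * \<epsilon>" by (simp add: \<epsilon>_def)
      ultimately show False using \<epsilon> by linarith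
    qed
    then have \<sigma>'0: "\<sigma>' > 0" using \<sigma> by simp
    \<comment> \<open>The minimum of the convex function (\<beta>' - x)^2 / (4 \<sigma>') - (\<beta>
      - x)^2 / (4 \<sigma>), where the resulting bound on |\<kappa>| is strongest.\<close>
    define x where "x = (\<sigma> * \<beta>' - \<sigma>' * \<beta>) / (\<sigma> - \<sigma>')"
    have lim: "\<bar>\<kappa>\<bar> * sqrt \<sigma> * exp (- (\<beta>' - x)\<^sup>2 / (4 * \<sigma>')) \<le> sqrt \<sigma>' * exp (- (\<beta> - x)\<^sup>2 / (4 * \<sigma>))"
    proof (rule tendsto_le[where F = "at_right (0::real)"])
      have id: "((\<lambda>\<epsilon>. \<sigma> + \<epsilon>) \<longlongrightarrow> \<sigma>) (at_right 0)" "((\<lambda>\<epsilon>. \<sigma>' + \<epsilon>) \<longlongrightarrow> \<sigma>') (at_right 0)"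
        using tendsto_add[OF tendsto_const tendsto_ident_at, of \<sigma> 0 "{0<..}"]
          tendsto_add[OF tendsto_const tendsto_ident_at, of \<sigma>' 0 "{0<..}"] by simp_all
      show "((\<lambda>\<epsilon>. sqrt (\<sigma>' + \<epsilon>) * exp (- (\<beta> - x)\<^sup>2 / (4 * (\<sigma> + \<epsilon>)))) \<longlongrightarrow> sqrt \<sigma>' * exp (- (\<beta> - x)\<^sup>2 / (4 * \<sigma>))) (at_right 0)"
        by (intro tendsto_intros id) (use less \<sigma>'0 in auto)
      show "((\<lambda>\<epsilon>. \<bar>\<kappa>\<bar> * sqrt (\<sigma> + \<epsilon>) * exp (- (\<beta>' - x)\<^sup>2 / (4 * (\<sigma>' + \<epsilon>)))) \<longlongrightarrow> \<bar>\<kappa>\<bar> * sqrt \<sigma> * exp (- (\<beta>' - x)\<^sup>2 / (4 * \<sigma>'))) (at_right 0)"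
        by (intro tendsto_intros id) (use less \<sigma>'0 in auto)
      show "\<forall>\<^sub>F \<epsilon> in at_right 0. \<bar>\<kappa>\<bar> * sqrt (\<sigma> + \<epsilon>) * exp (- (\<beta>' - x)\<^sup>2 / (4 * (\<sigma>' + \<epsilon>)))
          \<le> sqrt (\<sigma>' + \<epsilon>) * exp (- (\<beta> - x)\<^sup>2 / (4 * (\<sigma> + \<epsilon>)))"
        using eventually_at_right_less[of "0::real"] by eventually_elim (rule dom)
    qed simp
    define d where "d = \<sigma> - \<sigma>'"
    have d: "d > 0" "\<sigma> = \<sigma>' + d" using less by (simp_all add: d_def)
    have bx: "\<beta> - x = \<sigma> * ((\<beta> - \<beta>') / d)" "\<beta>' - x = \<sigma>' * ((\<beta> - \<beta>') / d)"
      unfolding x_def d_def[symmetric] using d(1) by (simp_all add: field_simps d_def)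
    have ex: "- (\<beta> - x)\<^sup>2 / (4 * \<sigma>) = - (\<beta>' - x)\<^sup>2 / (4 * \<sigma>') + - ((\<beta> - \<beta>')\<^sup>2 / (4 * d))"
    proof -
      define w where "w = (\<beta> - \<beta>') / d"
      have w: "(\<beta> - \<beta>')\<^sup>2 = w\<^sup>2 * d\<^sup>2" using d(1) by (simp add: w_def power_divide)
      have "- (\<beta> - x)\<^sup>2 / (4 * \<sigma>) = - \<sigma> * w\<^sup>2 / 4" "- (\<beta>' - x)\<^sup>2 / (4 * \<sigma>') = - \<sigma>' * w\<^sup>2 / 4"
        unfolding bx w_def[symmetric] using less \<sigma>'0 by (simp_all add: power2_eq_square)
      moreover have "(\<beta> - \<beta>')\<^sup>2 / (4 * d) = d * w\<^sup>2 / 4"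
        unfolding w using d(1) by (simp add: power2_eq_square)
      ultimately show ?thesis using d(2) by (simp add: algebra_simps add_divide_distrib)
    qed
    have "\<bar>\<kappa>\<bar> * sqrt \<sigma> * exp (- (\<beta>' - x)\<^sup>2 / (4 * \<sigma>')) \<le> (sqrt \<sigma>' * exp (- ((\<beta> - \<beta>')\<^sup>2 / (4 * d)))) * exp (- (\<beta>' - x)\<^sup>2 / (4 * \<sigma>'))"
      using lim unfolding ex exp_add by (simp only: mult_ac)
    then have "\<bar>\<kappa>\<bar> * sqrt \<sigma> \<le> sqrt \<sigma>' * exp (- ((\<beta> - \<beta>')\<^sup>2 / (4 * d)))" by (simp only: mult_le_cancel_right_pos exp_gt_zero)
    then have "\<bar>\<kappa>\<bar> \<le> sqrt (\<sigma>' / \<sigma>) * exp (- ((\<beta> - \<beta>')\<^sup>2 / (4 * d)))"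
      using less \<sigma>'0 by (simp add: real_sqrt_divide field_simps)
    then show ?thesis using less \<sigma>'0 \<kappa> by (simp add: d_def)
  qed
qed

lemma RZ2_char_cnj: "RZ2_char (- s) l p = cnj (RZ2_char s l p)"
  by (cases p) (simp add: RZ2_char_def exp_cnj)

lemma norm_RZ2_char: "norm (RZ2_char s l p) = 1"
  by (cases p) (simp add: RZ2_char_def norm_mult norm_power mult.assoc flip: of_real_mult)

locale RZ2_prob = prob_space M for M :: "(real \<times> int) measure" +
  assumes sets_M: "sets M = sets (borel_of RZ2_top)"
begin

lemma space_M: "space M = UNIV \<times> {0, 1}"
  using sets_eq_imp_space_eq[OF sets_M] by (simp add: topspace_RZ2)

lemma RZ2_char_meas [measurable]: "RZ2_char s l \<in> borel_measurable M"
  using RZ2_char_measurable by (simp add: measurable_cong_sets[OF sets_M refl])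

lemma char_0: "char_fun M (RZ2_char 0 0) = 1"
proof -
  have "RZ2_char 0 0 = (\<lambda>p. 1)" by (auto simp: RZ2_char_def)
  then show ?thesis by (simp add: char_fun_def prob_space)
qed

lemma char_uminus: "char_fun M (RZ2_char (- s) l) = cnj (char_fun M (RZ2_char s l))"
  by (simp add: char_fun_def RZ2_char_cnj)

lemma norm_char_le: "norm (char_fun M (RZ2_char s l)) \<le> 1"
proof -
  have "norm (char_fun M (RZ2_char s l)) \<le> (\<integral>p. norm (RZ2_char s l p) \<partial>M)"
    unfolding char_fun_def by (rule integral_norm_bound)
  then show ?thesis by (simp add: norm_RZ2_char prob_space)
qed

lemma continuous_char: "continuous_on UNIV (\<lambda>s. char_fun M (RZ2_char s l))"
proof (rule continuous_on_sequentiallyI)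
  fix u :: "nat \<Rightarrow> real" and s assume lim: "u \<longlonglongrightarrow> s"
  show "(\<lambda>n. char_fun M (RZ2_char (u n) l)) \<longlonglongrightarrow> char_fun M (RZ2_char s l)"
    unfolding char_fun_def
  proof (rule integral_dominated_convergence[where w = "\<lambda>_. 1"])
    show "AE p in M. (\<lambda>n. RZ2_char (u n) l p) \<longlonglongrightarrow> RZ2_char s l p"
      by (rule AE_I2) (auto simp: RZ2_char_def case_prod_beta intro!: tendsto_intros lim)
  qed (auto simp: norm_RZ2_char)
qed

lemma fst_meas [measurable]: "fst \<in> borel_measurable M"
  using continuous_map_imp_measurable_borel_of[OF continuous_map_RZ2_fst]
  by (simp add: measurable_cong_sets[OF sets_M refl])

lemma sign_meas [measurable]: "(\<lambda>p. if snd p = 1 then - 1 else 1 :: real) \<in> borel_measurable M"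
  using continuous_map_imp_measurable_borel_of[OF continuous_map_RZ2_snd[of "\<lambda>k. if k = 1 then - 1 else 1 :: real"]]
  by (simp add: measurable_cong_sets[OF sets_M refl])

text \<open>The transform with index 1 is that of the law weighted by the sign of the Z(2)
  coordinate, so positivity of M enters through \<open>gaussian_domination\<close>.\<close>

lemma Theta_classI:
  assumes F0: "\<And>s. char_fun M (RZ2_char s 0) = exp (A0 + B0 * of_real s + C0 * of_real (s\<^sup>2))"
    and F1: "\<And>s. char_fun M (RZ2_char s 1) = exp (A1 + B1 * of_real s + C1 * of_real (s\<^sup>2))"
  shows "M \<in> Theta_class"
proof -
  obtain \<kappa>0 \<sigma> \<beta> where s: "\<sigma> \<ge> 0" "\<kappa>0 \<noteq> 0"
    and f0: "\<And>s. char_fun M (RZ2_char s 0) = of_real \<kappa>0 * exp (of_real (- \<sigma> * s\<^sup>2) + \<i> * of_real (\<beta> * s))"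
    by (rule hermitian_exp_quadratic[of "\<lambda>s. char_fun M (RZ2_char s 0)", OF F0 char_uminus norm_char_le]) (rule that)
  obtain \<kappa> \<sigma>' \<beta>' where s': "\<sigma>' \<ge> 0" "\<kappa> \<noteq> 0"
    and f1: "\<And>s. char_fun M (RZ2_char s 1) = of_real \<kappa> * exp (of_real (- \<sigma>' * s\<^sup>2) + \<i> * of_real (\<beta>' * s))"
    by (rule hermitian_exp_quadratic[of "\<lambda>s. char_fun M (RZ2_char s 1)", OF F1 char_uminus norm_char_le]) (rule that)
  have "complex_of_real \<kappa>0 = 1" using f0[of 0] char_0 by simp
  then have f0': "char_fun M (RZ2_char s 0) = exp (of_real (- \<sigma> * s\<^sup>2) + \<i> * of_real (\<beta> * s))" for s
    using f0[of s] by simp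
  have \<kappa>1: "\<bar>\<kappa>\<bar> \<le> 1" using norm_char_le[of 0 1] f1[of 0] by simp
  have "\<bar>\<kappa>\<bar> * sqrt (\<sigma> + \<epsilon>) * exp (- (\<beta>' - x)\<^sup>2 / (4 * (\<sigma>' + \<epsilon>)))
      \<le> sqrt (\<sigma>' + \<epsilon>) * exp (- (\<beta> - x)\<^sup>2 / (4 * (\<sigma> + \<epsilon>)))" if "\<epsilon> > 0" for \<epsilon> x
  proof (rule gaussian_domination[OF fst_meas sign_meas _ s(1) s'(1) that])
    fix t
    have "(\<integral>p. iexp (t * fst p) \<partial>M) = char_fun M (RZ2_char t 0)"
      unfolding char_fun_def
      by (rule Bochner_Integration.integral_cong[OF refl]) (auto simp: RZ2_char_def mult_ac)
    then show "(\<integral>p. iexp (t * fst p) \<partial>M) = exp (of_real (- \<sigma> * t\<^sup>2) + \<i> * of_real (\<beta> * t))"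
      by (simp only: f0')
    have "(\<integral>p. iexp (t * fst p) * of_real (if snd p = 1 then - 1 else 1) \<partial>M) = char_fun M (RZ2_char t 1)"
      unfolding char_fun_def
      by (rule Bochner_Integration.integral_cong[OF refl]) (auto simp: RZ2_char_def space_M mult_ac)
    then show "(\<integral>p. iexp (t * fst p) * of_real (if snd p = 1 then - 1 else 1) \<partial>M)
        = of_real \<kappa> * exp (of_real (- \<sigma>' * t\<^sup>2) + \<i> * of_real (\<beta>' * t))"
      by (simp only: f1)
  qed auto
  from gaussian_domination_parameters[OF s(1) s'(1,2) \<kappa>1 this]
  show ?thesis unfolding Theta_class_def using s s' f0' f1 sets_M prob_space_axioms by blast
qed

end

section \<open>Solutions of the functional equation\<close>

lemma zero_on_dense_product:
  fixes \<Phi> :: "real \<times> real \<Rightarrow> complex"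
  assumes "continuous_on UNIV \<Phi>" "closure S = UNIV" "closure T = UNIV"
    and "\<And>x y. x \<in> S \<Longrightarrow> y \<in> T \<Longrightarrow> \<Phi> (x, y) = 0"
  shows "\<Phi> (x, y) = 0"
proof (rule continuous_constant_on_closure[of "S \<times> T"])
  show "continuous_on (closure (S \<times> T)) \<Phi>" by (rule continuous_on_subset[OF assms(1)]) simp
qed (use assms in \<open>auto simp: closure_Times\<close>)

text \<open>A zero A of F, taken as x + y, forces F B * G t = 0 for every B = x - y, where t = ((1 -
  r) A + (1 + r) B) / 2. Near b0 the factor F B is nonzero, and the dense set where G is nonzero
  contains such a t with B near b0.\<close>

lemma heyde_equation_nonvanishing:
  fixes F G E :: "real \<Rightarrow> complex"
  assumes F: "continuous_on UNIV F" "F b0 \<noteq> 0" and G: "closure {t. G t \<noteq> 0} = UNIV" and r: "1 + r \<noteq> 0"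
    and eq: "\<And>x y. E y * (F (x + y) * G (x + r * y)) = F (x - y) * G (x - r * y)"
  shows "F A \<noteq> 0"
proof
  assume A: "F A = 0"
  have "isCont F b0" using F(1) by (simp add: continuous_on_eq_continuous_at)
  then have "\<forall>\<^sub>F t in at b0. F t \<noteq> 0"
    using F(2) by (intro tendsto_imp_eventually_ne[of F "F b0"]) (auto simp: isCont_def)
  then obtain \<delta> where \<delta>: "\<delta> > 0" "\<And>t. t \<noteq> b0 \<Longrightarrow> dist t b0 < \<delta> \<Longrightarrow> F t \<noteq> 0"
    by (auto simp: eventually_at)
  \<comment> \<open>The value of t that corresponds to B = b0.\<close>
  define c where "c = ((1 - r) * A + (1 + r) * b0) / 2"
  have "c \<in> closure {t. G t \<noteq> 0}" by (simp add: G)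
  moreover have "\<delta> * \<bar>1 + r\<bar> / 2 > 0" using \<delta>(1) r by simp
  ultimately obtain t where t: "G t \<noteq> 0" "dist t c < \<delta> * \<bar>1 + r\<bar> / 2"
    unfolding closure_approachable by blast
  define B where "B = (2 * t - (1 - r) * A) / (1 + r)"
  have rB: "(1 + r) * B = 2 * t - (1 - r) * A" using r by (simp add: B_def)
  have "(1 + r) * (B - b0) = 2 * (t - c)" unfolding right_diff_distrib rB by (simp add: c_def field_simps)
  then have "\<bar>1 + r\<bar> * \<bar>B - b0\<bar> = 2 * \<bar>t - c\<bar>" by (metis abs_mult abs_numeral)
  also have "\<dots> < \<bar>1 + r\<bar> * \<delta>" using t(2) by (simp add: dist_real_def mult.commute)
  finally have "dist B b0 < \<delta>" using r by (simp add: dist_real_def)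
  then have "F B \<noteq> 0" using \<delta>(2)[of B] F(2) by (cases "B = b0") auto
  define x y where "x = (A + B) / 2" and "y = (A - B) / 2"
  have xy: "x + y = A" "x - y = B" by (simp_all add: x_def y_def field_simps)
  have "2 * (x - r * y) = (1 - r) * A + (1 + r) * B"
    unfolding x_def y_def by (simp add: field_simps)
  also have "\<dots> = 2 * t" unfolding rB by simp
  finally have "x - r * y = t" by simp
  then show False using eq[of y x] A \<open>F B \<noteq> 0\<close> t(1) unfolding xy by simp
qed

context heyde_data begin

lemma closure_weight: "closure (weight ` (H \<times> {n})) = UNIV"
proof -
  have "t \<in> closure (weight ` (H \<times> {n}))" for t
    unfolding closure_approachable
  proof (intro allI impI)
    fix e :: real assume "e > 0"
    then obtain h where h: "h \<in> H" "\<bar>h * 1 - (t - slope * of_int n)\<bar> < e"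
      using H.dense_multiples[OF one_H, of e "t - slope * of_int n"] by auto
    have "weight (h, n) \<in> weight ` (H \<times> {n})" using h(1) by (intro imageI) simp
    moreover have "dist (weight (h, n)) t < e"
      using h(2) by (simp add: weight_def dist_real_def algebra_simps)
    ultimately show "\<exists>y\<in>weight ` (H \<times> {n}). dist y t < e" by blast
  qed
  then show ?thesis by blast
qed

text \<open>The weights of each parity class are dense in the line, so the equation extends by
  continuity once its multiplier does. The extension is twisted by the characters of the shifts x0
  and x1, which is why the equation on the line carries a factor E.\<close>

lemma theta_both:
  assumes r: "r < 0" and M: "RZ2_prob M" and M': "RZ2_prob M'"
    and x: "x0 \<in> carrier X" "x1 \<in> carrier X"
  defines "F \<equiv> \<lambda>l s. char_fun M (RZ2_char s l)" and "G \<equiv> \<lambda>l s. char_fun M' (RZ2_char s l)"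
  defines "f \<equiv> \<lambda>u. pair u x0 * F (snd u mod 2) (weight u)" and "g \<equiv> \<lambda>u. pair u x1 * G (snd u mod 2) (weight u)"
  assumes nz: "\<And>u. u \<in> Y \<Longrightarrow> f u \<noteq> 0" "\<And>u. u \<in> Y \<Longrightarrow> g u \<noteq> 0"
    and lower: "\<And>u. u \<in> Y \<Longrightarrow> even (snd u) \<Longrightarrow> exp (- C * (weight u)\<^sup>2) \<le> norm (f u)"
      "\<And>u. u \<in> Y \<Longrightarrow> even (snd u) \<Longrightarrow> exp (- C * (weight u)\<^sup>2) \<le> norm (g u)"
    and eq: "\<And>u v. u \<in> Y \<Longrightarrow> v \<in> Y \<Longrightarrow> f (u + v) * g (u + eps v) = f (u - v) * g (u - eps v)"
  shows "M \<in> Theta_class \<and> M' \<in> Theta_class"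
proof -
  interpret M: RZ2_prob M by (rule M)
  interpret M': RZ2_prob M' by (rule M')
  have contF: "continuous_on UNIV (F l)" and contG: "continuous_on UNIV (G l)" for l
    unfolding F_def G_def by (rule M.continuous_char M'.continuous_char)+
  have plus: "u + v \<in> Y" and minus: "u - v \<in> Y" if "u \<in> Y" "v \<in> Y" for u v
    using that H_add H.diff by auto
  have r1: "r \<noteq> 1" using r by simp
  have wminus: "weight (u - v) = weight u - weight v" for u v
    using weight_add[of "u - v" v] by simp
  \<comment> \<open>The quotient of the pairings of x0 with u + v and u - v is the square of its
    pairing with v; likewise for x1 with eps v.\<close>
  define e where "e v = (pair v x0)\<^sup>2 * (pair (eps v) x1)\<^sup>2" for v
  have pair_minus: "pair (u - v) y * pair v y = pair u y" if "u \<in> Y" "v \<in> Y" "y \<in> carrier X" for u v y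
    using pair_add[OF minus[OF that(1,2)] that(2,3)] by simp
  have base: "e v * (F ((snd u + snd v) mod 2) (weight u + weight v) * G ((snd u + snd v) mod 2) (weight u + r * weight v))
      = F ((snd u + snd v) mod 2) (weight u - weight v) * G ((snd u + snd v) mod 2) (weight u - r * weight v)"
    if u: "u \<in> Y" and v: "v \<in> Y" for u v
  proof -
    let ?l = "(snd u + snd v) mod 2"
    note ev = eps_Y[OF v]
    have l: "snd (u + v) mod 2 = ?l" "snd (u - v) mod 2 = ?l" "snd (u + eps v) mod 2 = ?l" "snd (u - eps v) mod 2 = ?l"
      by (simp_all add: eps_def) presburger+
    have pn: "pair u x0 \<noteq> 0" "pair u x1 \<noteq> 0" using norm_pair[OF u x(1)] norm_pair[OF u x(2)] by auto
    have "pair u x0 * pair v x0 * F ?l (weight u + weight v) * (pair u x1 * pair (eps v) x1 * G ?l (weight u + r * weight v))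
        = pair (u - v) x0 * F ?l (weight u - weight v) * (pair (u - eps v) x1 * G ?l (weight u - r * weight v))"
      using eq[OF u v] unfolding f_def g_def l weight_add wminus weight_eps[OF r1] pair_add[OF u v x(1)] pair_add[OF u ev x(2)] .
    then have "(pair u x0 * pair v x0 * F ?l (weight u + weight v) * (pair u x1 * pair (eps v) x1 * G ?l (weight u + r * weight v))) * (pair v x0 * pair (eps v) x1)
        = (pair (u - v) x0 * pair v x0) * F ?l (weight u - weight v) * ((pair (u - eps v) x1 * pair (eps v) x1) * G ?l (weight u - r * weight v))"
      by (simp only: mult_ac)
    then have "(pair u x0 * pair u x1) * (e v * (F ?l (weight u + weight v) * G ?l (weight u + r * weight v)))
        = (pair u x0 * pair u x1) * (F ?l (weight u - weight v) * G ?l (weight u - r * weight v))"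
      unfolding pair_minus[OF u v x(1)] pair_minus[OF u ev x(2)] e_def power2_eq_square by (simp only: mult_ac)
    then show ?thesis using pn by simp
  qed
  have F0: "F 0 s \<noteq> 0" and G0: "G 0 s \<noteq> 0" for s
  proof -
    have H0: "exp (- C * s\<^sup>2) \<le> norm (F 0 s) \<and> exp (- C * s\<^sup>2) \<le> norm (G 0 s)" if "s \<in> weight ` (H \<times> {0})" for s
    proof -
      obtain h where h: "h \<in> H" "s = weight (h, 0)" using \<open>s \<in> weight ` (H \<times> {0})\<close> by auto
      have hY: "(h, 0) \<in> Y" using h(1) by simp
      show ?thesis using lower[OF hY] norm_pair[OF hY x(1)] norm_pair[OF hY x(2)]
        by (simp add: f_def g_def norm_mult h(2))
    qed
    have cl: "closed {s. exp (- C * s\<^sup>2) \<le> norm (F 0 s)}" "closed {s. exp (- C * s\<^sup>2) \<le> norm (G 0 s)}"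
      by (intro closed_Collect_le continuous_intros contF contG)+
    have "closure (weight ` (H \<times> {0})) \<subseteq> {s. exp (- C * s\<^sup>2) \<le> norm (F 0 s)}"
      by (rule closure_minimal[OF subsetI cl(1)]) (rule CollectI, drule H0, erule conjunct1)
    moreover have "closure (weight ` (H \<times> {0})) \<subseteq> {s. exp (- C * s\<^sup>2) \<le> norm (G 0 s)}"
      by (rule closure_minimal[OF subsetI cl(2)]) (rule CollectI, drule H0, erule conjunct2)
    ultimately have "exp (- C * s\<^sup>2) \<le> norm (F 0 s)" "exp (- C * s\<^sup>2) \<le> norm (G 0 s)"
      unfolding closure_weight by auto
    then show "F 0 s \<noteq> 0" "G 0 s \<noteq> 0" using exp_gt_zero[of "- C * s\<^sup>2"] by auto
  qed
  \<comment> \<open>Solves the even equation at x = 0 for the multiplier, and thereby extends e (y,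
    0) continuously from H to the line.\<close>
  define E where "E y = F 0 (- y) * G 0 (- (r * y)) / (F 0 y * G 0 (r * y))" for y
  have contE: "continuous_on UNIV E"
    unfolding E_def using F0 G0
    by (intro continuous_intros continuous_on_compose2[OF contF] continuous_on_compose2[OF contG]) auto
  have w0: "weight (s, 0) = s" for s by (simp add: weight_def)
  have E: "E y = e (y, 0)" if "y \<in> H" for y
    using base[of "(0, 0)" "(y, 0)"] that H.zero F0[of y] G0[of "r * y"] by (simp add: E_def w0 field_simps)
  have cl0: "closure H = UNIV" using closure_weight[of 0] by (simp add: image_def w0)
  have Ehom: "E (x + y) = E x * E y" for x y
  proof -
    have "(\<lambda>(x, y). E (x + y) - E x * E y) (x, y) = 0"
    proof (rule zero_on_dense_product[OF _ cl0 cl0])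
      show "continuous_on UNIV (\<lambda>(x, y). E (x + y) - E x * E y)"
        unfolding case_prod_beta by (intro continuous_intros continuous_on_compose2[OF contE]) auto
      fix s t assume s: "s \<in> H" and t: "t \<in> H"
      then have Y: "(s, 0) \<in> Y" "(t, 0) \<in> Y" by auto
      have "e ((s, 0) + (t, 0)) = e (s, 0) * e (t, 0)"
        unfolding e_def eps_add pair_add[OF Y x(1)] pair_add[OF eps_Y[OF Y(1)] eps_Y[OF Y(2)] x(2)]
        by (simp add: power_mult_distrib mult_ac)
      then show "(\<lambda>(x, y). E (x + y) - E x * E y) (s, t) = 0"
        using E[OF s] E[OF t] E[OF H_add[OF s t]] by simp
    qed
    then show ?thesis by simp
  qed
  \<comment> \<open>Only v = (t, 0) is used, so the parity l of the first variable is kept.\<close>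
  have eqR: "E y * (F l (x + y) * G l (x + r * y)) = F l (x - y) * G l (x - r * y)" if l: "l \<in> {0, 1}" for l x y
  proof -
    let ?\<Phi> = "\<lambda>(x, y). E y * (F l (x + y) * G l (x + r * y)) - F l (x - y) * G l (x - r * y)"
    have "?\<Phi> (x, y) = 0"
    proof (rule zero_on_dense_product[OF _ closure_weight[of l] cl0])
      show "continuous_on UNIV ?\<Phi>"
        unfolding case_prod_beta
        by (intro continuous_intros continuous_on_compose2[OF contE] continuous_on_compose2[OF contF] continuous_on_compose2[OF contG]) auto
      fix s t assume "s \<in> weight ` (H \<times> {l})" and t: "t \<in> H"
      then obtain h where h: "h \<in> H" "s = weight (h, l)" by auto
      have "l mod 2 = l" using l by auto
      then show "?\<Phi> (s, t) = 0"
        using base[of "(h, l)" "(t, 0)"] h t E[OF t] by (simp add: w0)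
    qed
    then show ?thesis by simp
  qed
  have eqR': "E (y / r) * (G l (x + y) * F l (x + 1 / r * y)) = G l (x - y) * F l (x - 1 / r * y)" if l: "l \<in> {0, 1}" for l x y
    using eqR[OF l, of "y / r" x] H.r0 by (simp add: mult.commute)
  have dense1: "F 1 t \<noteq> 0" "G 1 t \<noteq> 0" if "t \<in> weight ` (H \<times> {1})" for t
  proof -
    obtain h where h: "h \<in> H" "t = weight (h, 1)" using \<open>t \<in> weight ` (H \<times> {1})\<close> by auto
    then have "(h, 1) \<in> Y" by simp
    from nz[OF this] show "F 1 t \<noteq> 0" "G 1 t \<noteq> 0" by (auto simp: f_def g_def h(2))
  qed
  \<comment> \<open>Provides one point where both odd functions are known to be nonzero.\<close>
  have sl: "slope \<in> weight ` (H \<times> {1})"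
    by (rule image_eqI[of _ _ "(0, 1)"]) (auto simp: weight_def H.zero)
  have "weight ` (H \<times> {1}) \<subseteq> {t. F 1 t \<noteq> 0}"
    by (rule subsetI, rule CollectI, erule dense1(1))
  from closure_mono[OF this] have cl1F: "closure {t. F 1 t \<noteq> 0} = UNIV" unfolding closure_weight by blast
  have "weight ` (H \<times> {1}) \<subseteq> {t. G 1 t \<noteq> 0}"
    by (rule subsetI, rule CollectI, erule dense1(2))
  from closure_mono[OF this] have cl1G: "closure {t. G 1 t \<noteq> 0} = UNIV" unfolding closure_weight by blast
  have r': "1 / r \<noteq> 0" "1 / r \<noteq> 1" "1 + 1 / r \<noteq> 0" using H.r0 H.r1 r1 by (auto simp: field_simps)
  have F1: "F 1 s \<noteq> 0" for s
    by (rule heyde_equation_nonvanishing[OF contF dense1(1)[OF sl] cl1G H.r1 eqR]) simp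
  have G1: "G 1 s \<noteq> 0" for s
    by (rule heyde_equation_nonvanishing[OF contG dense1(2)[OF sl] cl1F r'(3), where E = "\<lambda>y. E (y / r)"], rule eqR') simp
  have nzl: "F l s \<noteq> 0" "G l s \<noteq> 0" if "l \<in> {0, 1}" for l s
    using that F0 F1 G0 G1 by auto
  have qF: "\<exists>A B C. \<forall>s. F l s = exp (A + B * of_real s + C * of_real (s\<^sup>2))" if l: "l \<in> {0, 1}" for l
  proof (rule heyde_equation_real[OF H.r0 r1 H.r1 contF contG nzl(1)[OF l] nzl(2)[OF l] eqR[OF l] Ehom])
    fix A B C assume "\<And>s. F l s = exp (A + B * of_real s + C * of_real (s\<^sup>2))"
    then show ?thesis by blast
  qed
  have qG: "\<exists>A B C. \<forall>s. G l s = exp (A + B * of_real s + C * of_real (s\<^sup>2))" if l: "l \<in> {0, 1}" for l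
  proof (rule heyde_equation_real[OF r' contG contF nzl(2)[OF l] nzl(1)[OF l], where E = "\<lambda>y. E (y / r)"])
    fix A B C assume "\<And>s. G l s = exp (A + B * of_real s + C * of_real (s\<^sup>2))"
    then show ?thesis by blast
  next
    show "E (y / r) * (G l (x + y) * F l (x + 1 / r * y)) = G l (x - y) * F l (x - 1 / r * y)" for x y
      by (rule eqR'[OF l])
    show "E ((x + y) / r) = E (x / r) * E (y / r)" for x y
      by (simp add: add_divide_distrib Ehom)
  qed
  obtain A0 B0 C0 A1 B1 C1 where "\<And>s. F 0 s = exp (A0 + B0 * of_real s + C0 * of_real (s\<^sup>2))"
      "\<And>s. F 1 s = exp (A1 + B1 * of_real s + C1 * of_real (s\<^sup>2))"
    using qF[of 0] qF[of 1] by auto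
  then have "M \<in> Theta_class" unfolding F_def by (rule M.Theta_classI)
  moreover obtain A0 B0 C0 A1 B1 C1 where "\<And>s. G 0 s = exp (A0 + B0 * of_real s + C0 * of_real (s\<^sup>2))"
      "\<And>s. G 1 s = exp (A1 + B1 * of_real s + C1 * of_real (s\<^sup>2))"
    using qG[of 0] qG[of 1] by auto
  then have "M' \<in> Theta_class" unfolding G_def by (rule M'.Theta_classI)
  ultimately show ?thesis by blast
qed

end

theorem theorem4p1:
  fixes a :: "nat \<Rightarrow> nat"
    and A :: "solenoid_elt \<Rightarrow> solenoid_elt" and b :: real
    and \<alpha> :: "X_elt \<Rightarrow> X_elt"
    and P :: "'w measure" and \<xi>1 \<xi>2 :: "'w \<Rightarrow> X_elt"
    and \<mu>1 \<mu>2 :: "X_elt measure"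
  assumes "\<forall>n. 1 < a n"
    and "\<forall>g \<in> carrier (solenoid a). group.ord (solenoid a) g \<noteq> 2"
    and "A \<in> top_auts (solenoid a) (solenoid_top a)"
    and "b \<in> H_group a"
    and "\<alpha> = matrix_aut a A b"
    and "kernel (solenoid a) (solenoid a) (\<lambda>g. g \<otimes>\<^bsub>solenoid a\<^esub> A g) = {\<one>\<^bsub>solenoid a\<^esub>}"
    and "prob_space P"
    and "\<xi>1 \<in> measurable P (borel_of (X_top a))"
    and "\<xi>2 \<in> measurable P (borel_of (X_top a))"
    and "prob_space.indep_var P (borel_of (X_top a)) \<xi>1 (borel_of (X_top a)) \<xi>2"
    and "\<mu>1 = distr P (borel_of (X_top a)) \<xi>1"
    and "\<mu>2 = distr P (borel_of (X_top a)) \<xi>2"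
    and "\<forall>y \<in> characters (X_group a) (X_top a). char_fun \<mu>1 y \<noteq> 0"
    and "\<forall>y \<in> characters (X_group a) (X_top a). char_fun \<mu>2 y \<noteq> 0"
    and "cond_symmetric (X_group a) (X_top a) P
           (\<lambda>\<omega>. \<xi>1 \<omega> \<otimes>\<^bsub>X_group a\<^esub> \<alpha> (\<xi>2 \<omega>)) (\<lambda>\<omega>. \<xi>1 \<omega> \<otimes>\<^bsub>X_group a\<^esub> \<xi>2 \<omega>)"
  shows "((\<exists>r. aut_number a A r \<and> r < 0) \<longrightarrow>
            (\<exists>\<phi>. \<phi> \<in> mon RZ2_group (X_group a) \<and> continuous_map RZ2_top (X_top a) \<phi> \<and>
              (\<forall>\<mu> \<in> {\<mu>1, \<mu>2}. \<exists>x \<in> carrier (X_group a). \<exists>M \<in> Theta_class.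
                 \<mu> = group_shift (X_group a) (X_top a) (distr M (borel_of (X_top a)) \<phi>) x))) \<and>
         ((\<exists>r. aut_number a A r \<and> r > 0) \<longrightarrow>
            (\<forall>\<mu> \<in> {\<mu>1, \<mu>2}. \<exists>x \<in> carrier (X_group a).
               supported_in (group_shift (X_group a) (X_top a) \<mu> x) (G_subgroup a)))"
proof -
  interpret adic a by unfold_locales (use assms(1) in blast)
  have X1: "X_prob a \<mu>1" and X2: "X_prob a \<mu>2"
    using assms(7,8,9,11,12)
    by (auto simp: X_prob_def X_prob_axioms_def adic_axioms intro: prob_space.prob_space_distr)
  interpret X1: X_prob a \<mu>1 by (rule X1)
  interpret X2: X_prob a \<mu>2 by (rule X2)
  have nz: "cf \<mu>1 u \<noteq> 0" "cf \<mu>2 u \<noteq> 0" if "u \<in> Y" for u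
    using assms(13,14) pair_in_characters[OF that] by (simp_all add: cf_def)
  have hs: "heyde_data a A b r" if "aut_number a A r" for r
    by unfold_locales (use that assms(2,4,6) in auto)
  have eq: "cf \<mu>1 (u + v) * cf \<mu>2 (u + heyde_data.eps b r v) = cf \<mu>1 (u - v) * cf \<mu>2 (u - heyde_data.eps b r v)"
    if "aut_number a A r" "u \<in> Y" "v \<in> Y" for r u v
    using heyde_data.char_fun_heyde[OF hs[OF that(1)] assms(7-10) assms(15)[unfolded assms(5)] that(2,3)]
    unfolding cf_def assms(11,12) .
  show ?thesis
  proof (intro conjI impI)
    assume "\<exists>r. aut_number a A r \<and> r < 0"
    then obtain r where r: "aut_number a A r" "r < 0" by blast
    interpret heyde_data a A b r by (rule hs[OF r(1)])
    have "\<exists>C\<ge>0. (r > 0 \<longrightarrow> C = 0) \<and> (\<forall>u\<in>Y. even (snd u) \<longrightarrow>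
        exp (- C * (weight u)\<^sup>2) \<le> norm (cf \<mu>1 u) \<and> exp (- C * (weight u)\<^sup>2) \<le> norm (cf \<mu>2 u))"
      by (rule modulus_even[OF X1.cf_0 X1.cf_uminus X1.norm_cf_le nz(1) X2.cf_0 X2.cf_uminus X2.norm_cf_le nz(2) eq[OF r(1)]])
    then obtain C where C: "C \<ge> 0"
      and lower: "\<And>u. u \<in> Y \<Longrightarrow> even (snd u) \<Longrightarrow> exp (- C * (weight u)\<^sup>2) \<le> norm (cf \<mu>1 u)"
        "\<And>u. u \<in> Y \<Longrightarrow> even (snd u) \<Longrightarrow> exp (- C * (weight u)\<^sup>2) \<le> norm (cf \<mu>2 u)"
      by blast
    obtain x1 M1 where R1: "x1 \<in> carrier X" "prob_space M1" "sets M1 = sets (borel_of RZ2_top)"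
      "\<mu>1 = group_shift X XT (distr M1 (borel_of XT) phi) x1"
      "\<And>u. u \<in> Y \<Longrightarrow> cf \<mu>1 u = pair u x1 * char_fun M1 (RZ2_char (weight u) (snd u mod 2))"
      by (rule representation[OF X1 C lower(1)], assumption, assumption, rule that)
    obtain x2 M2 where R2: "x2 \<in> carrier X" "prob_space M2" "sets M2 = sets (borel_of RZ2_top)"
      "\<mu>2 = group_shift X XT (distr M2 (borel_of XT) phi) x2"
      "\<And>u. u \<in> Y \<Longrightarrow> cf \<mu>2 u = pair u x2 * char_fun M2 (RZ2_char (weight u) (snd u mod 2))"
      by (rule representation[OF X2 C lower(2)], assumption, assumption, rule that)
    have M: "RZ2_prob M1" "RZ2_prob M2"
      using R1 R2 by (simp_all add: RZ2_prob_def RZ2_prob_axioms_def)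
    have "M1 \<in> Theta_class \<and> M2 \<in> Theta_class"
    proof (rule theta_both[OF r(2) M R1(1) R2(1)])
      fix u assume u: "u \<in> Y"
      note c = R1(5)[OF u, symmetric] R2(5)[OF u, symmetric]
      show "pair u x1 * char_fun M1 (RZ2_char (weight u) (snd u mod 2)) \<noteq> 0"
        "pair u x2 * char_fun M2 (RZ2_char (weight u) (snd u mod 2)) \<noteq> 0"
        unfolding c by (rule nz[OF u])+
      show "exp (- C * (weight u)\<^sup>2) \<le> norm (pair u x1 * char_fun M1 (RZ2_char (weight u) (snd u mod 2)))"
        "exp (- C * (weight u)\<^sup>2) \<le> norm (pair u x2 * char_fun M2 (RZ2_char (weight u) (snd u mod 2)))"
        if "even (snd u)" unfolding c by (rule lower[OF u that])+
      fix v assume v: "v \<in> Y"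
      have Y: "u + v \<in> Y" "u - v \<in> Y" "u + eps v \<in> Y" "u - eps v \<in> Y"
        using u v eps_Y[OF v] by (auto intro: H_add H.diff)
      show "pair (u + v) x1 * char_fun M1 (RZ2_char (weight (u + v)) (snd (u + v) mod 2)) *
          (pair (u + eps v) x2 * char_fun M2 (RZ2_char (weight (u + eps v)) (snd (u + eps v) mod 2))) =
          pair (u - v) x1 * char_fun M1 (RZ2_char (weight (u - v)) (snd (u - v) mod 2)) *
          (pair (u - eps v) x2 * char_fun M2 (RZ2_char (weight (u - eps v)) (snd (u - eps v) mod 2)))"
        unfolding R1(5)[OF Y(1), symmetric] R1(5)[OF Y(2), symmetric] R2(5)[OF Y(3), symmetric] R2(5)[OF Y(4), symmetric]
        by (rule eq[OF r(1) u v])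
    qed
    then show "\<exists>\<phi>. \<phi> \<in> mon RZ2_group X \<and> continuous_map RZ2_top XT \<phi> \<and>
        (\<forall>\<mu>\<in>{\<mu>1, \<mu>2}. \<exists>x\<in>carrier X. \<exists>M\<in>Theta_class. \<mu> = group_shift X XT (distr M (borel_of XT) \<phi>) x)"
      using phi_mon continuous_map_phi R1(1,4) R2(1,4) by (intro exI[of _ phi]) blast
  next
    assume "\<exists>r. aut_number a A r \<and> r > 0"
    then obtain r where r: "aut_number a A r" "r > 0" by blast
    interpret heyde_data a A b r by (rule hs[OF r(1)])
    have "\<exists>C\<ge>0. (r > 0 \<longrightarrow> C = 0) \<and> (\<forall>u\<in>Y. even (snd u) \<longrightarrow>
        exp (- C * (weight u)\<^sup>2) \<le> norm (cf \<mu>1 u) \<and> exp (- C * (weight u)\<^sup>2) \<le> norm (cf \<mu>2 u))"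
      by (rule modulus_even[OF X1.cf_0 X1.cf_uminus X1.norm_cf_le nz(1) X2.cf_0 X2.cf_uminus X2.norm_cf_le nz(2) eq[OF r(1)]])
    \<comment> \<open>Here C = 0, so the Gaussian lower bound is exp 0 = 1.\<close>
    then have lower: "1 \<le> norm (cf \<mu>1 u)" "1 \<le> norm (cf \<mu>2 u)" if "u \<in> Y" "even (snd u)" for u
      using that r(2) by auto
    have "norm (cf \<mu>1 u) = 1" "norm (cf \<mu>2 u) = 1" if "u \<in> Y" "even (snd u)" for u
      using lower[OF that] X1.norm_cf_le[OF that(1)] X2.norm_cf_le[OF that(1)] by linarith+
    then show "\<forall>\<mu>\<in>{\<mu>1, \<mu>2}. \<exists>x\<in>carrier X. supported_in (group_shift X XT \<mu> x) (G_subgroup a)"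
      using supported[OF X1] supported[OF X2] by simp
  qed
qed

end
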